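(* Let $d\ge 1$ and let $\mathcal{S}:\mathcal{L}(\mathrm{Sym}^2(\mathbb{C}^d))\to\mathcal{L}(\mathbb{C}^d)$ be the symmetric subspace channel, i.e. the channel whose Stinespring isometry is the embedding of the symmetric subspace $A=\mathrm{Sym}^2(\mathbb{C}^d)\subset\mathbb{C}^d\otimes\mathbb{C}^d$ into $B\otimes E$ with $B\simeq E\simeq\mathbb{C}^d$, so that $\mathcal{S}(\rho)=\operatorname{Tr}_E\rho$. Then $\mathcal{S}$ has zero private capacity, $P(\mathcal{S})=0$, but its weak locking capacity satisfies $L_W(\mathcal{S})\geq\frac12\log d$.
   Context: All Hilbert spaces are finite dimensional; $\log$ is to base 2. A quantum channel $\mathcal{N}:\mathcal{L}(A)\to\mathcal{L}(B)$ is a completely positive trace preserving map. It has a Stinespring isometry $V:A\hookrightarrow B\otimes E$ with $\mathcal{N}(\rho)=\operatorname{Tr}_E V\rho V^\dagger$; the complementary channel is $\mathcal{N}^c(\rho)=\operatorname{Tr}_B V\rho V^\dagger$ (unique up to isometries on $E$). Codes (with sublinear pre-shared secret, modelled by auxiliary ideal qubit channels). For integers $n\ge 1$, $\kappa\ge 0$, an $(n,\epsilon)$-code with $\kappa$ auxiliary qubits for $\mathcal{N}$ is a collection $\{(\rho_m,D_m): m=1,\dots,N\}$ of states $\rho_m$ on $(\mathbb{C}^2)^{\otimes\kappa}\otimes A^{\otimes n}$ and a POVM $(D_m)$ on $(\mathbb{C}^2)^{\otimes\kappa}\otimes B^{\otimes n}$ ($D_m\ge 0$, $\sum_m D_m=\mathbb{1}$)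 such that $$\frac1N\sum_{m=1}^N\operatorname{Tr}\Bigl[\bigl(\mathrm{id}_2^{\otimes\kappa}\otimes\mathcal{N}^{\otimes n}\bigr)(\rho_m)\,(\mathbb{1}-D_m)\Bigr]\le\epsilon .$$ Eve's state for message $m$ is $\omega_m=\bigl(\operatorname{Tr}^{\otimes\kappa}\otimes(\mathcal{N}^c)^{\otimes n}\bigr)(\rho_m)$ on $E^{\otimes n}$ (the auxiliary qubits are traced out, the complement of an ideal qubit channel being trivial). The code is $\delta$-private if there is a state $\omega_0$ on $E^{\otimes n}$ with $\frac1N\sum_{m=1}^N\|\omega_m-\omega_0\|_1\le\delta$. The code is $\delta$-weakly-locked if for every POVM $(Q_j)$ on $E^{\otimes n}$ there is a probability distribution $(\Omega_j)$ with $\frac1N\sum_{m=1}^N\sum_j\bigl|\operatorname{Tr}(\omega_m Q_j)-\Omega_j\bigr|\le\delta$. The private capacity $P(\mathcal{N})$ (resp. the weak locking capacity $L_W(\mathcal{N})$) is the supremum of all $R$ such that, as $n\to\infty$, there exist $\delta_n$-private (resp. $\delta_n$-weakly-locked) $(n,\epsilon_n)$-codes for $\mathcal{N}$ with $\kappa_n=o(n)$ auxiliary qubits, $N_n\ge 2^{nR}$, and $\epsilon_n,\delta_n\to 0$. *)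

theory Defs
  imports
    Complex_Main
    "HOL-Library.Landau_Symbols"
    "HOL-Library.Extended_Real"
    "Jordan_Normal_Form.Schur_Decomposition"
begin

text \<open>
  A Hilbert space of dimension \<open>a\<close> is \<open>carrier_vec a\<close> over the complex numbers, and its operators
  are \<open>carrier_mat a a\<close>. The basis vector number \<open>i\<close> of the first factor tensored with number \<open>j\<close>
  of the second factor, of dimension \<open>c\<close>, has index \<open>i * c + j\<close>; the \<open>n\<close>-th tensor power of a space
  of dimension \<open>a\<close> thus has dimension \<open>a ^ n\<close>.
\<close>

definition mat_trace :: "complex mat \<Rightarrow> complex" where
  "mat_trace M = (\<Sum>i<dim_row M. M $$ (i, i))"

text \<open>The order on complex numbers makes \<open>0 \<le> z\<close> say that \<open>z\<close> is real and nonnegative;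
  over the complex numbers this implies that \<open>M\<close> is Hermitian.\<close>
definition psd :: "nat \<Rightarrow> complex mat \<Rightarrow> bool" where
  "psd a M \<longleftrightarrow> M \<in> carrier_mat a a \<and> (\<forall>v\<in>carrier_vec a. 0 \<le> (M *\<^sub>v v) \<bullet>c v)"

definition density_operator :: "nat \<Rightarrow> complex mat \<Rightarrow> bool" where
  "density_operator a \<rho> \<longleftrightarrow> psd a \<rho> \<and> mat_trace \<rho> = 1"

definition povm :: "nat \<Rightarrow> nat \<Rightarrow> (nat \<Rightarrow> complex mat) \<Rightarrow> bool" where
  "povm a J Q \<longleftrightarrow> (\<forall>j<J. psd a (Q j)) \<and> mat a a (\<lambda>rs. \<Sum>j<J. Q j $$ rs) = 1\<^sub>m a"

definition psd_sqrt :: "complex mat \<Rightarrow> complex mat" where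
  "psd_sqrt M = (THE S. psd (dim_row M) S \<and> S * S = M)"

definition trace_norm :: "complex mat \<Rightarrow> real" where
  "trace_norm M = Re (mat_trace (psd_sqrt (mat_adjoint M * M)))"

definition trace_fst :: "nat \<Rightarrow> nat \<Rightarrow> complex mat \<Rightarrow> complex mat" where
  "trace_fst a c M = mat c c (\<lambda>(j, j'). \<Sum>i<a. M $$ (i * c + j, i * c + j'))"

definition trace_snd :: "nat \<Rightarrow> nat \<Rightarrow> complex mat \<Rightarrow> complex mat" where
  "trace_snd a c M = mat a a (\<lambda>(i, i'). \<Sum>j<c. M $$ (i * c + j, i' * c + j))"

definition kronecker :: "complex mat \<Rightarrow> complex mat \<Rightarrow> complex mat" where
  "kronecker M M' = mat (dim_row M * dim_row M') (dim_col M * dim_col M')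
     (\<lambda>(r, s). M $$ (r div dim_row M', s div dim_col M') * M' $$ (r mod dim_row M', s mod dim_col M'))"

definition matrix_unit :: "nat \<Rightarrow> nat \<Rightarrow> nat \<Rightarrow> complex mat" where
  "matrix_unit a i i' = mat a a (\<lambda>rs. if rs = (i, i') then 1 else 0)"

text \<open>
  The tensor product of a linear map \<open>\<Phi>\<close> from \<open>carrier_mat a a\<close> to \<open>carrier_mat b b\<close> and a linear
  map \<open>\<Psi>\<close> from \<open>carrier_mat c c\<close> to \<open>carrier_mat e e\<close>, by linear extension from products of matrix
  units.
\<close>
definition tensor_map ::
  "nat \<Rightarrow> nat \<Rightarrow> nat \<Rightarrow> nat \<Rightarrow> (complex mat \<Rightarrow> complex mat) \<Rightarrow> (complex mat \<Rightarrow> complex mat)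
    \<Rightarrow> complex mat \<Rightarrow> complex mat" where
  "tensor_map a b c e \<Phi> \<Psi> X = mat (b * e) (b * e) (\<lambda>rs.
     \<Sum>i<a. \<Sum>i'<a. \<Sum>j<c. \<Sum>j'<c. X $$ (i * c + j, i' * c + j') *
       kronecker (\<Phi> (matrix_unit a i i')) (\<Psi> (matrix_unit c j j')) $$ rs)"

primrec tensor_power_map ::
  "nat \<Rightarrow> nat \<Rightarrow> (complex mat \<Rightarrow> complex mat) \<Rightarrow> nat \<Rightarrow> complex mat \<Rightarrow> complex mat" where
  "tensor_power_map a b \<Phi> 0 = (\<lambda>X. X)"
| "tensor_power_map a b \<Phi> (Suc n) = tensor_map a b (a ^ n) (b ^ n) \<Phi> (tensor_power_map a b \<Phi> n)"

definition isometry :: "nat \<Rightarrow> nat \<Rightarrow> complex mat \<Rightarrow> bool" where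
  "isometry a b V \<longleftrightarrow> V \<in> carrier_mat b a \<and> mat_adjoint V * V = 1\<^sub>m a"

text \<open>
  A channel is given by a Stinespring isometry \<open>V\<close> from the input space, of dimension \<open>dA\<close>, to the
  tensor product of the output space, of dimension \<open>dB\<close>, with the environment, of dimension \<open>dE\<close>.
  This also fixes the complementary channel, which the channel alone determines only up to
  isometries on the environment.
\<close>
definition channel :: "nat \<Rightarrow> nat \<Rightarrow> complex mat \<Rightarrow> complex mat \<Rightarrow> complex mat" where
  "channel dB dE V \<rho> = trace_snd dB dE (V * \<rho> * mat_adjoint V)"

definition complementary_channel ::
  "nat \<Rightarrow> nat \<Rightarrow> complex mat \<Rightarrow> complex mat \<Rightarrow> complex mat" where
  "complementary_channel dB dE V \<rho> = trace_fst dB dE (V * \<rho> * mat_adjoint V)"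

text \<open>The map which acts as the identity on the \<open>\<kappa>\<close> auxiliary qubits and as \<open>n\<close> copies of the channel.\<close>
definition assisted_channel ::
  "nat \<Rightarrow> nat \<Rightarrow> nat \<Rightarrow> complex mat \<Rightarrow> nat \<Rightarrow> nat \<Rightarrow> complex mat \<Rightarrow> complex mat" where
  "assisted_channel dA dB dE V n \<kappa> =
     tensor_map (2 ^ \<kappa>) (2 ^ \<kappa>) (dA ^ n) (dB ^ n)
       (\<lambda>X. X) (tensor_power_map dA dB (channel dB dE V) n)"

definition is_code ::
  "nat \<Rightarrow> nat \<Rightarrow> nat \<Rightarrow> complex mat \<Rightarrow> nat \<Rightarrow> real \<Rightarrow> nat \<Rightarrow> nat
    \<Rightarrow> (nat \<Rightarrow> complex mat) \<Rightarrow> (nat \<Rightarrow> complex mat) \<Rightarrow> bool" where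
  "is_code dA dB dE V n \<epsilon> \<kappa> N \<rho> D \<longleftrightarrow>
     (\<forall>m<N. density_operator (2 ^ \<kappa> * dA ^ n) (\<rho> m)) \<and>
     povm (2 ^ \<kappa> * dB ^ n) N D \<and>
     1 / real N * (\<Sum>m<N. Re (mat_trace
        (assisted_channel dA dB dE V n \<kappa> (\<rho> m) * (1\<^sub>m (2 ^ \<kappa> * dB ^ n) - D m)))) \<le> \<epsilon>"

definition eve_state ::
  "nat \<Rightarrow> nat \<Rightarrow> nat \<Rightarrow> complex mat \<Rightarrow> nat \<Rightarrow> nat \<Rightarrow> complex mat \<Rightarrow> complex mat" where
  "eve_state dA dB dE V n \<kappa> \<rho> =
     tensor_power_map dA dE (complementary_channel dB dE V) n (trace_fst (2 ^ \<kappa>) (dA ^ n) \<rho>)"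

text \<open>In the next two definitions \<open>\<omega> m\<close>, for \<open>m < N\<close>, are Eve's states, on a space of
  dimension \<open>k\<close>.\<close>
definition private_states :: "nat \<Rightarrow> nat \<Rightarrow> (nat \<Rightarrow> complex mat) \<Rightarrow> real \<Rightarrow> bool" where
  "private_states k N \<omega> \<delta> \<longleftrightarrow>
     (\<exists>\<omega>0. density_operator k \<omega>0 \<and> 1 / real N * (\<Sum>m<N. trace_norm (\<omega> m - \<omega>0)) \<le> \<delta>)"

definition weakly_locked_states :: "nat \<Rightarrow> nat \<Rightarrow> (nat \<Rightarrow> complex mat) \<Rightarrow> real \<Rightarrow> bool" where
  "weakly_locked_states k N \<omega> \<delta> \<longleftrightarrow>
     (\<forall>J Q. povm k J Q \<longrightarrow>
       (\<exists>\<Omega> :: nat \<Rightarrow> real. (\<forall>j<J. 0 \<le> \<Omega> j) \<and> (\<Sum>j<J. \<Omega> j) = 1 \<and>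
          1 / real N * (\<Sum>m<N. \<Sum>j<J. cmod (mat_trace (\<omega> m * Q j) - of_real (\<Omega> j))) \<le> \<delta>))"

definition achievable_rate ::
  "(nat \<Rightarrow> nat \<Rightarrow> (nat \<Rightarrow> complex mat) \<Rightarrow> real \<Rightarrow> bool)
    \<Rightarrow> nat \<Rightarrow> nat \<Rightarrow> nat \<Rightarrow> complex mat \<Rightarrow> real \<Rightarrow> bool" where
  "achievable_rate secret dA dB dE V R \<longleftrightarrow>
     (\<exists>\<kappa> \<epsilon> \<delta>. (\<lambda>n. real (\<kappa> n)) \<in> o(\<lambda>n. real n) \<and> \<epsilon> \<longlonglongrightarrow> 0 \<and> \<delta> \<longlonglongrightarrow> 0 \<and>
       (\<forall>\<^sub>F n in sequentially. \<exists>N \<rho> D.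
          real N \<ge> 2 powr (real n * R) \<and>
          is_code dA dB dE V n (\<epsilon> n) (\<kappa> n) N \<rho> D \<and>
          secret (dE ^ n) N (\<lambda>m. eve_state dA dB dE V n (\<kappa> n) (\<rho> m)) (\<delta> n)))"

text \<open>The suprema are taken in the extended reals, so that they exist without a boundedness
  argument.\<close>
definition private_capacity :: "nat \<Rightarrow> nat \<Rightarrow> nat \<Rightarrow> complex mat \<Rightarrow> ereal" where
  "private_capacity dA dB dE V =
     (SUP R \<in> {R. achievable_rate private_states dA dB dE V R}. ereal R)"

definition weak_locking_capacity :: "nat \<Rightarrow> nat \<Rightarrow> nat \<Rightarrow> complex mat \<Rightarrow> ereal" where
  "weak_locking_capacity dA dB dE V =
     (SUP R \<in> {R. achievable_rate weakly_locked_states dA dB dE V R}. ereal R)"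

definition sym2 :: "nat \<Rightarrow> complex vec set" where
  "sym2 d = {v \<in> carrier_vec (d * d). \<forall>i<d. \<forall>j<d. v $ (i * d + j) = v $ (j * d + i)}"

text \<open>
  The embedding of the symmetric subspace, once that subspace is identified with \<open>carrier_vec dA\<close>
  through an arbitrary orthonormal basis.
\<close>
definition sym2_embedding :: "nat \<Rightarrow> nat \<Rightarrow> complex mat \<Rightarrow> bool" where
  "sym2_embedding d dA V \<longleftrightarrow>
     isometry dA (d * d) V \<and> (\<lambda>x. V *\<^sub>v x) ` carrier_vec dA = sym2 d"

lemma sym2_embedding_exists: "\<exists>dA V. sym2_embedding d dA V"
proof -
  define ps where "ps = filter (\<lambda>(i, j). i \<le> j) (List.product [0..<d] [0..<d])"
  define L where "L = length ps"
  define s where "s = (\<lambda>p :: nat \<times> nat. if fst p = snd p then 1 else sqrt 2)"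
  define pr where "pr = (\<lambda>r. (min (r div d) (r mod d), max (r div d) (r mod d)))"
  define V where "V = mat (d * d) L
    (\<lambda>(r, c). if pr r = ps ! c then complex_of_real (1 / s (ps ! c)) else 0)"
  have V: "V \<in> carrier_mat (d * d) L" by (simp add: V_def)
  have dis: "distinct ps" by (simp add: ps_def distinct_product)
  have set_ps: "set ps = {(i, j). i \<le> j \<and> j < d}" by (auto simp: ps_def)
  have s_pos: "s p > 0" for p by (simp add: s_def)
  have idx: "i * d + j < d * d" if "i < d" "j < d" for i j
    using that by (metis add.commute div_less_iff_less_mult div_mult_self3 less_nat_zero_code
        div_less add_0 gr0I)
  have pr_idx: "pr (i * d + j) = (min i j, max i j)" if "j < d" for i j
    using that by (simp add: pr_def)
  have pr_in: "pr r \<in> set ps" if "r < d * d" for r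
  proof -
    have "d > 0" using that by (cases d) auto
    then have "r div d < d" "r mod d < d"
      using that by (auto simp: less_mult_imp_div_less)
    then show ?thesis by (simp add: pr_def set_ps)
  qed
  have card_pr: "(\<Sum>r<d * d. if pr r = p then (1::complex) else 0) = of_real ((s p)\<^sup>2)"
    if "p \<in> set ps" for p
  proof -
    obtain i j where p: "p = (i, j)" and ij: "i \<le> j" "j < d"
      using \<open>p \<in> set ps\<close> set_ps by auto
    have *: "{r. r < d * d \<and> pr r = p} = {i * d + j, j * d + i}"
    proof (intro equalityI subsetI)
      fix r assume "r \<in> {r. r < d * d \<and> pr r = p}"
      then have "(r div d = i \<and> r mod d = j) \<or> (r div d = j \<and> r mod d = i)"
        by (auto simp: pr_def p min_def max_def split: if_splits)
      then show "r \<in> {i * d + j, j * d + i}"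
        by (metis div_mult_mod_eq insertCI)
    next
      fix r assume "r \<in> {i * d + j, j * d + i}"
      then show "r \<in> {r. r < d * d \<and> pr r = p}"
        using ij idx pr_idx by (auto simp: p min_def max_def)
    qed
    have neq: "i * d + j = j * d + i \<longleftrightarrow> i = j"
      using ij by (metis div_mult_self3 div_less add.right_neutral le_less_trans less_nat_zero_code
          add.commute)
    have "(\<Sum>r<d * d. if pr r = p then (1::complex) else 0) = of_nat (card {r. r < d * d \<and> pr r = p})"
      by (simp add: sum.If_cases lessThan_def Collect_conj_eq)
    also have "\<dots> = of_real ((s p)\<^sup>2)"
      unfolding * using neq by (auto simp: s_def p card_insert_if simp flip: of_real_power)
    finally show ?thesis .
  qed
  have adj: "mat_adjoint V \<in> carrier_mat L (d * d)"
    using V by (auto simp: mat_adjoint_def)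
  have "mat_adjoint V * V = 1\<^sub>m L"
  proof (rule eq_matI)
    fix c c' assume "c < dim_row (1\<^sub>m L :: complex mat)" "c' < dim_col (1\<^sub>m L :: complex mat)"
    then have c: "c < L" "c' < L" by auto
    have eq: "ps ! c = ps ! c' \<longleftrightarrow> c = c'"
      using c dis by (simp add: L_def nth_eq_iff_index_eq)
    have "(mat_adjoint V * V) $$ (c, c') = (\<Sum>r<d * d. cnj (V $$ (r, c)) * V $$ (r, c'))"
      using c V adj by (simp add: mat_adjoint_def scalar_prod_def lessThan_atLeast0)
    also have "\<dots> = (\<Sum>r<d * d. if c = c' then
        (if pr r = ps ! c then 1 else 0) * of_real ((1 / s (ps ! c))\<^sup>2) else 0)"
      using c eq by (intro sum.cong) (auto simp: V_def power2_eq_square)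
    also have "\<dots> = (if c = c' then
        (\<Sum>r<d * d. if pr r = ps ! c then 1 else 0) * of_real ((1 / s (ps ! c))\<^sup>2) else 0)"
      by (simp add: sum_distrib_right)
    also have "\<dots> = (if c = c' then 1 else 0)"
      using c s_pos[of "ps ! c"]
      by (subst card_pr) (auto simp: L_def simp flip: of_real_mult power_mult_distrib)
    finally show "(mat_adjoint V * V) $$ (c, c') = 1\<^sub>m L $$ (c, c')"
      using c by simp
  qed (use V adj in auto)
  moreover have "(\<lambda>x. V *\<^sub>v x) ` carrier_vec L = sym2 d"
  proof (intro equalityI subsetI)
    fix v assume "v \<in> (\<lambda>x. V *\<^sub>v x) ` carrier_vec L"
    then obtain x where v: "v = V *\<^sub>v x" "x \<in> carrier_vec L" by auto
    have "row V (i * d + j) = row V (j * d + i)" if "i < d" "j < d" for i j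
      using that idx pr_idx by (intro eq_vecI) (auto simp: V_def min.commute max.commute)
    then show "v \<in> sym2 d" using v V idx by (auto simp: sym2_def)
  next
    fix v assume v: "v \<in> sym2 d"
    define x where "x = vec L (\<lambda>c. of_real (s (ps ! c)) * v $ (fst (ps ! c) * d + snd (ps ! c)))"
    have "V *\<^sub>v x = v"
    proof (rule eq_vecI)
      fix r assume "r < dim_vec v"
      then have r: "r < d * d" using v by (auto simp: sym2_def)
      obtain k where k: "k < L" "ps ! k = pr r"
        using pr_in[OF r] by (auto simp: in_set_conv_nth L_def)
      have d: "d > 0" using r by (cases d) auto
      then have rd: "r div d < d" "r mod d < d" using r by (auto simp: less_mult_imp_div_less)
      have "(V *\<^sub>v x) $ r = (\<Sum>c<L. V $$ (r, c) * x $ c)"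
        using r V by (simp add: scalar_prod_def lessThan_atLeast0 x_def)
      also have "\<dots> = (\<Sum>c<L. if c = k then v $ (fst (pr r) * d + snd (pr r)) else 0)"
      proof (intro sum.cong refl)
        fix c assume "c \<in> {..<L}"
        then have c: "c < L" by simp
        have "pr r = ps ! c \<longleftrightarrow> c = k"
          using c k dis by (metis L_def nth_eq_iff_index_eq)
        then show "V $$ (r, c) * x $ c = (if c = k then v $ (fst (pr r) * d + snd (pr r)) else 0)"
          using c r k s_pos[of "pr r"] by (auto simp: V_def x_def)
      qed
      also have "\<dots> = v $ (fst (pr r) * d + snd (pr r))" using k by simp
      also have "\<dots> = v $ (r div d * d + r mod d)"
        using v rd by (auto simp: pr_def min_def max_def sym2_def)
      finally show "(V *\<^sub>v x) $ r = v $ r" by simp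
    qed (use V v in \<open>auto simp: sym2_def\<close>)
    moreover have "x \<in> carrier_vec L" by (simp add: x_def)
    ultimately show "v \<in> (\<lambda>x. V *\<^sub>v x) ` carrier_vec L" by force
  qed
  ultimately show ?thesis using V by (auto simp: sym2_embedding_def isometry_def)
qed

end

theory Submission
  imports
    Defs
    "HOL-Analysis.Convex"
    "HOL-Library.FuncSet"
    "HOL-Real_Asymp.Real_Asymp"
begin

text \<open>
  Since the channel equals its complement, Eve's state is Bob's state with the \<open>\<kappa>\<close> auxiliary qubits
  discarded. A decoder \<open>D\<^sub>m\<close> is, up to a factor \<open>2 ^ \<kappa>\<close> in the operator order, dominated by its partial
  trace over these qubits, so a spectral projection of that partial trace distinguishes Eve's \<open>m\<close>-th
  state from any fixed state as soon as \<open>4 ^ \<kappa> / N\<close> is small. Hence no positive rate is private.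

  For locking, cut the \<open>n\<close> positions into a large constant number \<open>t\<close> of blocks. A key selects for each
  block the computational or the Fourier basis, together with a seed of a hash function \<open>h\<close>. A message
  \<open>m\<close> is sent as the basis vector with label \<open>x\<close>, for random \<open>x\<close> with \<open>h x = m\<close>; a product vector
  \<open>\<phi> \<otimes> \<phi>\<close> is symmetric, so Bob and Eve both receive \<open>\<phi>\<close>. Bob knows the key and makes no error. On
  Eve's side, averaged over the block bases, every vector puts little weight on any set of fewer than
  \<open>d powr (n * \<theta>)\<close> labels, \<open>\<theta> < 1 / 2\<close>: this follows by induction on the blocks from an uncertainty
  relation for one pair of mutually unbiased bases. A random hash function is uniform up to such a set,
  so that every outcome of Eve's measurement is nearly independent of the message.
\<close>

section \<open>Uncertainty for a pair of mutually unbiased bases\<close>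

text \<open>One pair of bases cannot lock: a vector of either basis puts, averaged over the two, at
  least half of its weight on a single label. Each block can at best contribute a factor close to 1
  / 2, so the smallness has to come from the number of blocks, which costs only a key of constant
  length. For the induction over the blocks, the size of a label set is measured by
  \<open>card L powr \<tau>\<close> with \<tau> of order 1 / n. On sets of
  \<open>d powr (n * \<theta>)\<close> labels such a power amounts to a constant factor per block,
  and its sum over the fibres of \<open>L\<close> above the labels of one block can still be
  controlled. The threshold 1 / 2 comes from the overlap \<open>sqrt (card A * card A' / q)\<close>,
  which is useful only while the cardinalities multiply to less than \<open>q\<close>. In the
  parameters it becomes 1 + v ^ m < 2 * v powr \<alpha> with \<alpha> = (m + 2) * \<theta>'. For
  \<open>v\<close> just below 1 this holds if m > 2 * \<alpha>, so \<theta>' may approach 1 / 2 as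
  \<open>m\<close> grows.\<close>

lemma sum_mult_index:
  fixes f :: "nat \<Rightarrow> 'a :: comm_monoid_add"
  shows "(\<Sum>p<a * c. f p) = (\<Sum>i<a. \<Sum>j<c. f (i * c + j))"
proof -
  have "(\<Sum>p<a * c. f p) = (\<Sum>i<a. sum f {i * c..<i * c + c})"
    by (rule sum.nat_group[symmetric])
  moreover have "sum f {i * c..<i * c + c} = (\<Sum>j<c. f (i * c + j))" for i
    using sum.shift_bounds_nat_ivl[of f 0 "i * c" c]
    by (simp add: atLeast0LessThan add.commute)
  ultimately show ?thesis by simp
qed

text \<open>A discrete layer-cake bound: the weights v ^ k * (1 - v) and the remainder v ^ K
  telescope to 1. In the induction a passed threshold \<open>\<Theta> K\<close> splits v ^ K without
  loss, while for a missed one the new remainder alone dominates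
  \<open>s powr \<tau>\<close>.\<close>

lemma level_sum_bound:
  fixes v \<tau> \<Lambda> s :: real and \<Theta> :: "nat \<Rightarrow> real"
  assumes v: "0 < v" "v < 1" and \<tau>: "\<tau> > 0" and s: "0 \<le> s" "s \<le> \<Lambda>"
    and \<Theta>: "\<And>k. k < K \<Longrightarrow> 0 \<le> \<Theta> k" "\<And>k. k < K \<Longrightarrow> \<Theta> k powr \<tau> \<le> \<Lambda> powr \<tau> * v ^ Suc k"
  shows "s powr \<tau> \<le> \<Lambda> powr \<tau> * ((\<Sum>k<K. if s > \<Theta> k then v ^ k * (1 - v) else 0) + v ^ K)"
  using \<Theta>
proof (induction K)
  case 0
  then show ?case using s \<tau> by (simp add: powr_mono2)
next
  case (Suc K)
  show ?case
  proof (cases "s > \<Theta> K")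
    case True
    have "v ^ K * (1 - v) + v ^ Suc K = v ^ K" by (simp add: algebra_simps)
    with True Suc show ?thesis by (simp add: algebra_simps)
  next
    case False
    have "0 \<le> (\<Sum>k<K. if s > \<Theta> k then v ^ k * (1 - v) else 0)"
      using v by (intro sum_nonneg) auto
    moreover have "s powr \<tau> \<le> \<Lambda> powr \<tau> * v ^ Suc K"
      using False s \<tau> Suc.prems(2)[of K] powr_mono2[of \<tau> s "\<Theta> K"] by simp
    ultimately show ?thesis using False
      by (simp add: distrib_left) (smt (verit) mult_nonneg_nonneg powr_ge_zero)
  qed
qed

text \<open>The uncertainty relation applies to the pairs of level sets \<open>X k\<close>, \<open>X (m - 1 - k)\<close> of \<open>s\<close>, whose
  cardinalities multiply to less than \<open>q\<close>; since the weight of \<open>X k\<close> decreases in \<open>k\<close>, Chebyshev's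
  sum inequality turns the sum over these pairs into a bound on the weighted sum.\<close>
lemma two_basis_power_bound:
  fixes p0 p1 s :: "nat \<Rightarrow> real" and q m :: nat and v \<tau> E :: real
  assumes q: "q \<ge> 1" and v: "0 < v" "v < 1" and \<tau>: "\<tau> > 0"
    and vq: "real q powr (- (\<tau> / real (m + 2))) = v"
    and p: "\<And>x. 0 \<le> p0 x" "\<And>x. 0 \<le> p1 x" and s: "\<And>x. 0 \<le> s x"
    and E: "(\<Sum>x<q. p0 x) = E" "(\<Sum>x<q. p1 x) = E"
    and unc: "\<And>A A'. A \<subseteq> {..<q} \<Longrightarrow> A' \<subseteq> {..<q} \<Longrightarrow>
      sum p0 A + sum p1 A' \<le> (1 + sqrt (real (card A) * real (card A') / real q)) * E"
  shows "(\<Sum>x<q. (p0 x + p1 x) * s x powr \<tau>)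
    \<le> (1 + v ^ m + real q powr (- (1 / (2 * real (m + 2))))) * (\<Sum>x<q. s x) powr \<tau> * E"
proof -
  define J where "J = real (m + 2)"
  define \<Lambda> where "\<Lambda> = (\<Sum>x<q. s x)"
  define \<eta> where "\<eta> = real q powr (- (1 / (2 * J)))"
  \<comment> \<open>By Markov's inequality \<open>X k\<close> has at most
    \<open>q powr ((k + 1) / (m + 2))\<close> elements. For the levels k and m - 1 - k the exponents
    add up to (m + 1) / (m + 2); the missing 1 / (m + 2), under the square root, gives \<eta>. The
    \<tau>-th power of the threshold is \<open>\<Lambda> powr \<tau> * v ^ Suc k\<close>, as
    \<open>level_sum_bound\<close> wants it.\<close>
  define X where "X = (\<lambda>k. {x\<in>{..<q}. s x > \<Lambda> * real q powr (- (real (Suc k) / J))})"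
  define \<rho> where "\<rho> = (\<lambda>k. sum p0 (X k) + sum p1 (X k))"
  define w where "w = (\<lambda>k::nat. v ^ k * (1 - v))"
  have J: "J > 0" by (simp add: J_def)
  have q0: "real q > 0" using q by simp
  have E0: "E \<ge> 0" using E(1) p by (metis sum_nonneg)
  have \<eta>0: "\<eta> \<ge> 0" by (simp add: \<eta>_def)
  have \<Lambda>0: "\<Lambda> \<ge> 0" unfolding \<Lambda>_def using s by (intro sum_nonneg) auto
  have sL: "s x \<le> \<Lambda>" if "x < q" for x
    unfolding \<Lambda>_def using s that by (intro member_le_sum) auto
  have fX: "finite (X k)" "X k \<subseteq> {..<q}" for k by (auto simp: X_def)
  show ?thesis
  proof (cases "\<Lambda> = 0")
    case True
    then have "s x = 0" if "x < q" for x
      using sL[OF that] s[of x] by simp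
    then have "(\<Sum>x<q. (p0 x + p1 x) * s x powr \<tau>) = 0" by simp
    then show ?thesis using True by (simp add: \<Lambda>_def)
  next
    case False
    with \<Lambda>0 have Lpos: "\<Lambda> > 0" by simp
    have cardX: "real (card (X k)) \<le> real q powr (real (Suc k) / J)" for k
    proof -
      have "real (card (X k)) * (\<Lambda> * real q powr (- (real (Suc k) / J))) \<le> sum s (X k)"
        using fX by (intro sum_bounded_below) (auto simp: X_def)
      also have "\<dots> \<le> \<Lambda>" unfolding \<Lambda>_def using fX s by (intro sum_mono2) auto
      finally have "real (card (X k)) * real q powr (- (real (Suc k) / J)) \<le> 1"
        using Lpos by (simp add: mult.left_commute)
      then show ?thesis using q0 by (simp add: powr_minus field_simps)
    qed
    have pair: "sum p0 (X k) + sum p1 (X (m - Suc k)) \<le> (1 + \<eta>) * E" if "k < m" for k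
    proof -
      have "real (card (X k)) * real (card (X (m - Suc k)))
          \<le> real q powr (real (Suc k) / J) * real q powr (real (Suc (m - Suc k)) / J)"
        by (intro mult_mono cardX) auto
      also have "\<dots> = real q powr (real (m + 1) / J)"
        using that by (simp add: powr_add[symmetric] add_divide_distrib[symmetric] of_nat_diff)
      also have "real (m + 1) / J = 1 + (- (1 / J))" by (simp add: J_def field_simps)
      also have "real q powr (1 + (- (1 / J))) = real q * real q powr (- (1 / J))"
        using q0 by (simp only: powr_add powr_one)
      finally have "real (card (X k)) * real (card (X (m - Suc k))) / real q \<le> real q powr (- (1 / J))"
        using q0 by (simp add: field_simps)
      then have "sqrt (real (card (X k)) * real (card (X (m - Suc k))) / real q)
          \<le> sqrt (real q powr (- (1 / J)))" by simp
      also have "\<dots> = \<eta>" using q0 by (simp add: \<eta>_def powr_half_sqrt[symmetric] powr_powr mult.commute)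
      finally have "(1 + sqrt (real (card (X k)) * real (card (X (m - Suc k))) / real q)) * E
        \<le> (1 + \<eta>) * E" using E0 by (intro mult_right_mono) auto
      with unc[OF fX(2) fX(2), of k "m - Suc k"] show ?thesis by linarith
    qed
    have "(\<Sum>k<m. \<rho> k) = (\<Sum>k<m. sum p0 (X k)) + (\<Sum>k<m. sum p1 (X (m - Suc k)))"
      unfolding \<rho>_def sum.distrib using sum.nat_diff_reindex[of "\<lambda>k. sum p1 (X k)" m] by simp
    also have "\<dots> \<le> (\<Sum>k<m. (1 + \<eta>) * E)"
      unfolding sum.distrib[symmetric] by (intro sum_mono pair) auto
    finally have \<rho>sum: "(\<Sum>k<m. \<rho> k) \<le> real m * ((1 + \<eta>) * E)" by simp
    have wsum: "(\<Sum>k<m. w k) = 1 - v ^ m"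
      unfolding w_def sum_distrib_right[symmetric] using sum_gp_strict[of v m] v by simp
    have vm: "0 \<le> v ^ m" "v ^ m \<le> 1" using v by (auto simp: power_le_one)
    have \<rho>w: "(\<Sum>k<m. \<rho> k * w k) \<le> (1 + \<eta>) * E * (1 - v ^ m)"
    proof (cases "m = 0")
      case False
      have "real m * (\<Sum>k=0..<m. \<rho> k * w k) \<le> (\<Sum>k=0..<m. \<rho> k) * (\<Sum>k=0..<m. w k)"
      proof (rule Chebyshev_sum_upper)
        fix i j :: nat assume "i \<le> j" "j < m"
        have "- (real (Suc j) / J) \<le> - (real (Suc i) / J)"
          using \<open>i \<le> j\<close> J by (simp add: divide_right_mono)
        then have "real q powr (- (real (Suc j) / J)) \<le> real q powr (- (real (Suc i) / J))"
          using q by (intro powr_mono) auto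
        then have "\<Lambda> * real q powr (- (real (Suc j) / J)) \<le> \<Lambda> * real q powr (- (real (Suc i) / J))"
          using Lpos by simp
        then have "X i \<subseteq> X j" unfolding X_def by auto
        then show "\<rho> i \<le> \<rho> j" unfolding \<rho>_def using fX p by (intro add_mono sum_mono2) auto
        show "w i \<ge> w j" unfolding w_def using v \<open>i \<le> j\<close>
          by (intro mult_right_mono power_decreasing) auto
      qed
      then have "real m * (\<Sum>k<m. \<rho> k * w k) \<le> (\<Sum>k<m. \<rho> k) * (1 - v ^ m)"
        by (simp add: wsum atLeast0LessThan)
      also have "\<dots> \<le> real m * ((1 + \<eta>) * E) * (1 - v ^ m)"
        using \<rho>sum vm by (intro mult_right_mono) auto
      finally show ?thesis using False by (simp add: mult.assoc)
    qed simp
    have pt: "s x powr \<tau> \<le> \<Lambda> powr \<tau> * ((\<Sum>k<m. if x \<in> X k then w k else 0) + v ^ m)" if "x < q" for x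
    proof -
      have "s x powr \<tau> \<le> \<Lambda> powr \<tau> * ((\<Sum>k<m. if s x > \<Lambda> * real q powr (- (real (Suc k) / J))
          then v ^ k * (1 - v) else 0) + v ^ m)"
      proof (rule level_sum_bound[OF v \<tau> s sL[OF that]])
        fix k
        show "0 \<le> \<Lambda> * real q powr (- (real (Suc k) / J))" using \<Lambda>0 by simp
        have "(real q powr (- (real (Suc k) / J))) powr \<tau> = (real q powr (- (\<tau> / J))) powr (real (Suc k))"
          by (simp add: powr_powr mult.commute)
        also have "\<dots> = v ^ Suc k" using vq v by (simp add: J_def powr_add powr_realpow)
        finally show "(\<Lambda> * real q powr (- (real (Suc k) / J))) powr \<tau> \<le> \<Lambda> powr \<tau> * v ^ Suc k"
          using \<Lambda>0 by (simp add: powr_mult)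
      qed
      then show ?thesis using that by (auto simp: X_def w_def cong: if_cong)
    qed
    have "(\<Sum>x<q. (p0 x + p1 x) * s x powr \<tau>) \<le>
      (\<Sum>x<q. (p0 x + p1 x) * (\<Lambda> powr \<tau> * ((\<Sum>k<m. if x \<in> X k then w k else 0) + v ^ m)))"
      using p pt by (intro sum_mono mult_left_mono) (auto intro: add_nonneg_nonneg)
    also have "\<dots> = \<Lambda> powr \<tau> * ((\<Sum>x<q. \<Sum>k<m. (p0 x + p1 x) * (if x \<in> X k then w k else 0)) + 2 * E * v ^ m)"
    proof -
      have "(\<Sum>x<q. (p0 x + p1 x) * (\<Lambda> powr \<tau> * v ^ m)) = 2 * E * (\<Lambda> powr \<tau> * v ^ m)"
        using E by (simp only: sum_distrib_right[symmetric] sum.distrib) simp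
      then show ?thesis
        by (simp add: distrib_left sum.distrib sum_distrib_left mult_ac)
    qed
    also have "(\<Sum>x<q. \<Sum>k<m. (p0 x + p1 x) * (if x \<in> X k then w k else 0))
      = (\<Sum>k<m. \<Sum>x<q. (p0 x + p1 x) * (if x \<in> X k then w k else 0))" by (rule sum.swap)
    also have "\<dots> = (\<Sum>k<m. \<rho> k * w k)"
    proof (rule sum.cong[OF refl])
      fix k
      have "(\<Sum>x<q. (p0 x + p1 x) * (if x \<in> X k then w k else 0)) = (\<Sum>x\<in>X k. (p0 x + p1 x) * w k)"
        using fX[of k] by (intro sum.mono_neutral_cong_right) auto
      then show "(\<Sum>x<q. (p0 x + p1 x) * (if x \<in> X k then w k else 0)) = \<rho> k * w k"
        by (simp add: \<rho>_def sum.distrib sum_distrib_right distrib_right)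
    qed
    also have "\<Lambda> powr \<tau> * ((\<Sum>k<m. \<rho> k * w k) + 2 * E * v ^ m)
      \<le> \<Lambda> powr \<tau> * ((1 + \<eta>) * E * (1 - v ^ m) + 2 * E * v ^ m)"
      using \<rho>w by (intro mult_left_mono) auto
    also have "(1 + \<eta>) * E * (1 - v ^ m) + 2 * E * v ^ m = (1 + v ^ m + \<eta>) * E - \<eta> * E * v ^ m"
      by (simp add: algebra_simps)
    also have "\<Lambda> powr \<tau> * ((1 + v ^ m + \<eta>) * E - \<eta> * E * v ^ m) \<le> \<Lambda> powr \<tau> * ((1 + v ^ m + \<eta>) * E)"
      using \<eta>0 E0 vm by (intro mult_left_mono) auto
    finally show ?thesis by (simp add: \<Lambda>_def \<eta>_def J_def mult_ac)
  qed
qed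

section \<open>Coefficients in a basis and the overlap of two coordinate subspaces\<close>

definition coeff_sq :: "nat \<Rightarrow> ('a \<Rightarrow> nat \<Rightarrow> complex) \<Rightarrow> (nat \<Rightarrow> complex) \<Rightarrow> 'a \<Rightarrow> real" where
  "coeff_sq n B w x = (cmod (\<Sum>r<n. cnj (B x r) * w r))\<^sup>2"

definition orthonormal :: "nat \<Rightarrow> (nat \<Rightarrow> nat \<Rightarrow> complex) \<Rightarrow> bool" where
  "orthonormal n B \<longleftrightarrow>
     (\<forall>x<n. \<forall>y<n. (\<Sum>r<n. B x r * cnj (B y r)) = (if x = y then 1 else 0)) \<and>
     (\<forall>r<n. \<forall>s<n. (\<Sum>x<n. B x r * cnj (B x s)) = (if r = s then 1 else 0))"

lemma complex_cmod_square: "(complex_of_real (cmod z))\<^sup>2 = z * cnj z"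
  using complex_norm_square[of z] by simp

lemma sum_swap3: "(\<Sum>i\<in>A. \<Sum>j\<in>B. \<Sum>k\<in>C. f i j k) = (\<Sum>j\<in>B. \<Sum>k\<in>C. \<Sum>i\<in>A. f i j k)"
  by (subst sum.swap, intro sum.cong refl, rule sum.swap)

lemma parseval:
  assumes "orthonormal n B"
  shows "(\<Sum>x<n. coeff_sq n B w x) = (\<Sum>r<n. (cmod (w r))\<^sup>2)"
proof -
  have "complex_of_real (\<Sum>x<n. coeff_sq n B w x)
      = (\<Sum>x<n. (\<Sum>r<n. cnj (B x r) * w r) * cnj (\<Sum>s<n. cnj (B x s) * w s))"
    by (simp add: coeff_sq_def complex_cmod_square)
  also have "\<dots> = (\<Sum>x<n. \<Sum>r<n. \<Sum>s<n. w r * cnj (w s) * (B x s * cnj (B x r)))"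
    by (simp add: sum_product mult_ac)
  also have "\<dots> = (\<Sum>r<n. \<Sum>s<n. w r * cnj (w s) * (\<Sum>x<n. B x s * cnj (B x r)))"
    unfolding sum_distrib_left by (rule sum_swap3)
  also have "\<dots> = (\<Sum>r<n. \<Sum>s<n. if s = r then w r * cnj (w s) else 0)"
    using assms by (intro sum.cong refl) (simp add: orthonormal_def)
  also have "\<dots> = complex_of_real (\<Sum>r<n. (cmod (w r))\<^sup>2)"
    by (simp add: complex_cmod_square)
  finally show ?thesis by (simp only: of_real_eq_iff)
qed

lemma sum_le_sqrt_card:
  assumes "finite A"
  shows "(\<Sum>x\<in>A. f x) \<le> sqrt (real (card A)) * sqrt (\<Sum>x\<in>A. (f x)\<^sup>2 :: real)"
proof -
  have "(\<Sum>x\<in>A. 1 * f x)\<^sup>2 \<le> (\<Sum>x\<in>A. 1\<^sup>2) * (\<Sum>x\<in>A. (f x)\<^sup>2)"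
    by (rule Cauchy_Schwarz_ineq_sum)
  then have "sqrt ((\<Sum>x\<in>A. f x)\<^sup>2) \<le> sqrt (real (card A) * (\<Sum>x\<in>A. (f x)\<^sup>2))"
    by (intro real_sqrt_le_mono) simp
  then show ?thesis by (simp add: real_sqrt_mult)
qed

lemma cmod_sum_mult_le:
  "(cmod (\<Sum>r\<in>A. f r * g r))\<^sup>2 \<le> (\<Sum>r\<in>A. (cmod (f r))\<^sup>2) * (\<Sum>r\<in>A. (cmod (g r))\<^sup>2)"
proof -
  have "cmod (\<Sum>r\<in>A. f r * g r) \<le> (\<Sum>r\<in>A. cmod (f r) * cmod (g r))"
    using norm_sum[of "\<lambda>r. f r * g r" A] by (simp add: norm_mult)
  then have "(cmod (\<Sum>r\<in>A. f r * g r))\<^sup>2 \<le> (\<Sum>r\<in>A. cmod (f r) * cmod (g r))\<^sup>2"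
    by (intro power_mono) auto
  also have "\<dots> \<le> (\<Sum>r\<in>A. (cmod (f r))\<^sup>2) * (\<Sum>r\<in>A. (cmod (g r))\<^sup>2)"
    by (rule Cauchy_Schwarz_ineq_sum)
  finally show ?thesis .
qed

text \<open>The projections of \<open>v\<close> onto the two coordinate subspaces have an inner product of modulus at
  most \<open>sqrt (card A * card A' / q)\<close> times their norms, so \<open>v\<close> cannot lie close to both.\<close>
lemma mutually_unbiased_uncertainty:
  fixes v :: "nat \<Rightarrow> complex"
  assumes B: "orthonormal q B" and mub: "\<And>x r. x < q \<Longrightarrow> r < q \<Longrightarrow> (cmod (B x r))\<^sup>2 = 1 / real q"
    and A: "A \<subseteq> {..<q}" and A': "A' \<subseteq> {..<q}"
  shows "(\<Sum>x\<in>A. (cmod (v x))\<^sup>2) + (\<Sum>y\<in>A'. coeff_sq q B v y)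
    \<le> (1 + sqrt (real (card A) * real (card A') / real q)) * (\<Sum>r<q. (cmod (v r))\<^sup>2)"
proof -
  define \<kappa> where "\<kappa> = sqrt (real (card A) * real (card A') / real q)"
  define c where "c = (\<lambda>y. \<Sum>r<q. cnj (B y r) * v r)"
  \<comment> \<open>\<open>u\<close> and \<open>g\<close> are the projections of \<open>v\<close>
    onto the coordinates in \<open>A\<close> and onto the span of the basis vectors in
    \<open>A'\<close>; \<open>a\<close> and \<open>b\<close> are their squared norms.\<close>
  define u where "u = (\<lambda>r. if r \<in> A then v r else 0)"
  define g where "g = (\<lambda>r. \<Sum>y\<in>A'. c y * B y r)"
  define a where "a = (\<Sum>x\<in>A. (cmod (v x))\<^sup>2)"
  define b where "b = (\<Sum>y\<in>A'. (cmod (c y))\<^sup>2)"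
  define e where "e = (\<Sum>r<q. (cmod (v r))\<^sup>2)"
  have fin: "finite A" "finite A'" using A A' finite_subset by blast+
  have nonneg: "a \<ge> 0" "b \<ge> 0" "e \<ge> 0" "\<kappa> \<ge> 0"
    by (auto simp: a_def b_def e_def \<kappa>_def intro: sum_nonneg)
  have cu: "(\<Sum>r<q. f r * u r) = (\<Sum>r\<in>A. f r * v r)" for f
    using A by (intro sum.mono_neutral_cong_right) (auto simp: u_def)
  have uu: "(\<Sum>r<q. cnj (u r) * u r) = of_real a"
  proof -
    have "(\<Sum>r<q. cnj (u r) * u r) = (\<Sum>r\<in>A. cnj (u r) * v r)" by (rule cu)
    also have "\<dots> = (\<Sum>r\<in>A. of_real ((cmod (v r))\<^sup>2))"
      by (intro sum.cong refl) (simp add: u_def complex_cmod_square mult.commute)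
    finally show ?thesis by (simp add: a_def)
  qed
  have vu: "(\<Sum>r<q. cnj (v r) * u r) = of_real a"
    using uu unfolding cu by (simp add: u_def cong: sum.cong)
  have vg: "(\<Sum>r<q. cnj (v r) * g r) = of_real b"
  proof -
    have "(\<Sum>r<q. cnj (v r) * g r) = (\<Sum>r<q. \<Sum>y\<in>A'. c y * (cnj (v r) * B y r))"
      by (simp add: g_def sum_distrib_left mult_ac)
    also have "\<dots> = (\<Sum>y\<in>A'. c y * (\<Sum>r<q. cnj (v r) * B y r))"
      by (subst sum.swap) (simp add: sum_distrib_left)
    also have "\<dots> = (\<Sum>y\<in>A'. c y * cnj (c y))"
      by (simp add: c_def mult.commute)
    finally show ?thesis by (simp add: b_def complex_cmod_square)
  qed
  have gg: "(\<Sum>r<q. cnj (g r) * g r) = of_real b"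
  proof -
    have "(\<Sum>r<q. cnj (g r) * g r) = (\<Sum>r<q. \<Sum>y\<in>A'. \<Sum>z\<in>A'. cnj (c y) * c z * (B z r * cnj (B y r)))"
      unfolding g_def cnj_sum sum_product by (intro sum.cong refl) simp
    also have "\<dots> = (\<Sum>y\<in>A'. \<Sum>z\<in>A'. cnj (c y) * c z * (\<Sum>r<q. B z r * cnj (B y r)))"
      unfolding sum_distrib_left by (rule sum_swap3)
    also have "\<dots> = (\<Sum>y\<in>A'. \<Sum>z\<in>A'. if z = y then cnj (c y) * c z else 0)"
    proof (intro sum.cong refl)
      fix y z assume "y \<in> A'" "z \<in> A'"
      then have "(\<Sum>r<q. B z r * cnj (B y r)) = (if z = y then 1 else 0)"
        using B A' unfolding orthonormal_def by blast
      then show "cnj (c y) * c z * (\<Sum>r<q. B z r * cnj (B y r)) = (if z = y then cnj (c y) * c z else 0)"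
        by simp
    qed
    also have "\<dots> = of_real b"
      using fin by (simp add: b_def complex_cmod_square mult.commute)
    finally show ?thesis .
  qed
  have ug: "cmod (\<Sum>r<q. cnj (u r) * g r) \<le> \<kappa> * (sqrt a * sqrt b)"
  proof -
    have "(\<Sum>r<q. cnj (u r) * g r) = (\<Sum>r\<in>A. cnj (v r) * g r)"
      using A by (intro sum.mono_neutral_cong_right) (auto simp: u_def)
    also have "\<dots> = (\<Sum>r\<in>A. \<Sum>y\<in>A'. cnj (v r) * (c y * B y r))"
      by (simp add: g_def sum_distrib_left)
    finally have "cmod (\<Sum>r<q. cnj (u r) * g r) \<le> (\<Sum>r\<in>A. \<Sum>y\<in>A'. cmod (cnj (v r) * (c y * B y r)))"
      by (auto intro: order_trans[OF norm_sum sum_mono] norm_sum)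
    also have "\<dots> = (\<Sum>r\<in>A. \<Sum>y\<in>A'. sqrt (1 / real q) * (cmod (v r) * cmod (c y)))"
    proof (intro sum.cong refl)
      fix r y assume "r \<in> A" "y \<in> A'"
      then have "cmod (B y r) = sqrt (1 / real q)"
        using mub[of y r] A A' by (metis lessThan_iff norm_ge_zero real_sqrt_unique subsetD)
      then show "cmod (cnj (v r) * (c y * B y r)) = sqrt (1 / real q) * (cmod (v r) * cmod (c y))"
        by (simp add: norm_mult)
    qed
    also have "\<dots> = sqrt (1 / real q) * ((\<Sum>r\<in>A. cmod (v r)) * (\<Sum>y\<in>A'. cmod (c y)))"
      by (subst sum_product) (simp only: sum_distrib_left)
    also have "\<dots> \<le> sqrt (1 / real q) * ((sqrt (real (card A)) * sqrt a) * (sqrt (real (card A')) * sqrt b))"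
      unfolding a_def b_def using fin
      by (intro mult_left_mono mult_mono sum_le_sqrt_card)
        (auto intro!: sum_nonneg mult_nonneg_nonneg real_sqrt_ge_zero)
    also have "\<dots> = \<kappa> * (sqrt a * sqrt b)"
      by (simp add: \<kappa>_def real_sqrt_mult real_sqrt_divide)
    finally show ?thesis .
  qed
  have norm2: "(\<Sum>r<q. (cmod (u r + g r))\<^sup>2) \<le> (a + b) * (1 + \<kappa>)"
  proof -
    have "complex_of_real (\<Sum>r<q. (cmod (u r + g r))\<^sup>2)
        = (\<Sum>r<q. cnj (u r) * u r + cnj (g r) * g r + (cnj (u r) * g r + cnj (cnj (u r) * g r)))"
      unfolding of_real_sum complex_norm_square by (intro sum.cong refl) (simp add: algebra_simps)
    also have "\<dots> = of_real a + of_real b + of_real (2 * Re (\<Sum>r<q. cnj (u r) * g r))"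
      unfolding sum.distrib uu gg complex_add_cnj[symmetric] by simp
    finally have "(\<Sum>r<q. (cmod (u r + g r))\<^sup>2) = a + b + 2 * Re (\<Sum>r<q. cnj (u r) * g r)"
      by (simp only: of_real_add[symmetric] of_real_eq_iff)
    also have "\<dots> \<le> a + b + 2 * (\<kappa> * (sqrt a * sqrt b))"
      using ug complex_Re_le_cmod[of "\<Sum>r<q. cnj (u r) * g r"] by linarith
    also have "\<dots> = a + b + \<kappa> * (2 * (sqrt a * sqrt b))" by simp
    also have "\<dots> \<le> a + b + \<kappa> * (a + b)"
      using nonneg arith_geo_mean_sqrt[of a b] by (intro add_left_mono mult_left_mono) (auto simp: real_sqrt_mult)
    finally show ?thesis by (simp add: algebra_simps)
  qed
  \<comment> \<open>Since \<open>u\<close> and \<open>g\<close> are projections of \<open>v\<close>,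
    its inner product with their sum is a + b, while the squared norm of the sum is at most (a + b)
    * (1 + \<kappa>). Cauchy-Schwarz then leaves one factor a + b to cancel.\<close>
  have "(cmod (\<Sum>r<q. cnj (v r) * (u r + g r)))\<^sup>2
      \<le> (\<Sum>r<q. (cmod (cnj (v r)))\<^sup>2) * (\<Sum>r<q. (cmod (u r + g r))\<^sup>2)"
    by (rule cmod_sum_mult_le)
  also have "\<dots> \<le> e * ((a + b) * (1 + \<kappa>))"
    using norm2 nonneg by (simp add: e_def mult_left_mono)
  also have "(\<Sum>r<q. cnj (v r) * (u r + g r)) = of_real (a + b)"
    using vu vg by (simp add: distrib_left sum.distrib)
  finally have "(a + b) * (a + b) \<le> (a + b) * ((1 + \<kappa>) * e)"
    using nonneg by (simp add: power2_eq_square mult_ac del: of_real_add)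
  then have "a + b \<le> (1 + \<kappa>) * e"
    using nonneg by (cases "a + b = 0") (auto simp: mult_le_cancel_left)
  then show ?thesis by (simp add: a_def b_def e_def \<kappa>_def c_def coeff_sq_def)
qed

section \<open>Product bases\<close>

definition qudit_basis :: "nat \<Rightarrow> bool \<Rightarrow> nat \<Rightarrow> nat \<Rightarrow> complex" where
  "qudit_basis d \<beta> x r =
     (if \<beta> then cis (2 * pi * real x * real r / real d) / of_real (sqrt (real d)) else if x = r then 1 else 0)"

text \<open>The first bit governs the most significant base-\<open>d\<close> digit of label and
  index, in accordance with the index convention \<open>i * c + j\<close> for tensor
  products.\<close>

primrec product_basis :: "nat \<Rightarrow> bool list \<Rightarrow> nat \<Rightarrow> nat \<Rightarrow> complex" where
  "product_basis d [] x r = 1"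
| "product_basis d (\<beta> # \<beta>s) x r =
     qudit_basis d \<beta> (x div d ^ length \<beta>s) (r div d ^ length \<beta>s) *
     product_basis d \<beta>s (x mod d ^ length \<beta>s) (r mod d ^ length \<beta>s)"

text \<open>The key \<open>b\<close> holds one bit for each of the \<open>t\<close> blocks of length
  \<open>l\<close>, most significant bit first. The \<open>r\<close> positions left over when
  \<open>n\<close> is divided by \<open>t\<close> always carry the computational basis.\<close>

primrec key_bits :: "nat \<Rightarrow> nat \<Rightarrow> nat \<Rightarrow> nat \<Rightarrow> bool list" where
  "key_bits l r 0 b = replicate r False"
| "key_bits l r (Suc t) b = replicate l (b div 2 ^ t = 1) @ key_bits l r t (b mod 2 ^ t)"

lemma length_key_bits [simp]: "length (key_bits l r t b) = t * l + r"
  by (induction t arbitrary: b) auto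

lemma sum_roots_of_unity:
  assumes "x < d" "y < d"
  shows "(\<Sum>r<d. cis (2 * pi * real x * real r / real d) * cnj (cis (2 * pi * real y * real r / real d)))
    = (if x = y then of_nat d else 0)"
proof (cases "x = y")
  case True
  then show ?thesis by (simp add: cis_cnj cis_mult)
next
  case False
  define z where "z = cis (2 * pi * (real x - real y) / real d)"
  have d: "d > 0" using assms by simp
  have "cis (2 * pi * real x * real r / real d) * cnj (cis (2 * pi * real y * real r / real d)) = z ^ r" for r
    by (simp add: z_def cis_cnj cis_mult DeMoivre algebra_simps diff_divide_distrib)
  moreover have "z ^ d = 1"
  proof -
    have "z ^ d = cis (2 * pi * of_int (int x - int y))"
      using d by (simp add: z_def DeMoivre mult_ac)
    then show ?thesis using cis_multiple_2pi[of "of_int (int x - int y)"] by simp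
  qed
  moreover have "z \<noteq> 1"
  proof
    assume "z = 1"
    then have "cos (2 * pi * (real x - real y) / real d) = 1" by (simp add: z_def complex_eq_iff)
    then obtain k :: int where "2 * pi * (real x - real y) / real d = of_int k * 2 * pi"
      using cos_one_2pi_int by metis
    then have "2 * pi * (real x - real y) = 2 * pi * (of_int k * real d)"
      using d by (simp add: field_simps)
    then have "real x - real y = of_int k * real d" by simp
    then have "of_int (int x - int y) = (of_int (k * int d) :: real)" by simp
    then have k: "int x - int y = k * int d" by (simp only: of_int_eq_iff)
    have "\<bar>int x - int y\<bar> < int d" using assms by linarith
    then have "\<bar>k\<bar> * int d < 1 * int d" by (simp add: k abs_mult)
    then have "k = 0" using d by (simp add: mult_less_cancel_right)
    then show False using k False by simp
  qed
  ultimately show ?thesis using False by (simp add: geometric_sum)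
qed

lemma qudit_basis_sym: "qudit_basis d \<beta> x r = qudit_basis d \<beta> r x"
  by (auto simp: qudit_basis_def mult_ac)

text \<open>For a symmetric array the column relations are the row relations read again; both the
  Fourier and the computational basis, and hence their products, are symmetric in label and
  index.\<close>

lemma orthonormal_symI:
  assumes "\<And>x r. B x r = B r x"
    and "\<And>x y. x < n \<Longrightarrow> y < n \<Longrightarrow> (\<Sum>r<n. B x r * cnj (B y r)) = (if x = y then 1 else 0)"
  shows "orthonormal n B"
proof -
  have "(\<Sum>x<n. B x r * cnj (B x s)) = (\<Sum>x<n. B r x * cnj (B s x))" for r s
    by (intro sum.cong refl arg_cong2[where f = "(*)"] arg_cong[where f = cnj] assms(1))
  with assms(2) show ?thesis by (simp add: orthonormal_def)
qed

lemma orthonormal_qudit_basis: "orthonormal d (qudit_basis d \<beta>)"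
proof (rule orthonormal_symI[OF qudit_basis_sym])
  fix x y assume xy: "x < d" "y < d"
  show "(\<Sum>r<d. qudit_basis d \<beta> x r * cnj (qudit_basis d \<beta> y r)) = (if x = y then 1 else 0)"
  proof (cases \<beta>)
    case True
    have "(\<Sum>r<d. qudit_basis d \<beta> x r * cnj (qudit_basis d \<beta> y r)) =
      (\<Sum>r<d. cis (2 * pi * real x * real r / real d) * cnj (cis (2 * pi * real y * real r / real d)) / of_nat d)"
      using True by (intro sum.cong refl)
        (simp add: qudit_basis_def of_real_mult[symmetric] del: of_real_mult)
    also have "\<dots> = (if x = y then of_nat d else 0) / of_nat d"
      unfolding sum_divide_distrib[symmetric] sum_roots_of_unity[OF xy] ..
    also have "\<dots> = (if x = y then 1 else 0)" using xy by simp
    finally show ?thesis .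
  next
    case False
    have "(\<Sum>r<d. qudit_basis d \<beta> x r * cnj (qudit_basis d \<beta> y r)) = (\<Sum>r<d. if x = r then (if x = y then 1 else 0) else 0)"
      using False by (intro sum.cong refl) (auto simp: qudit_basis_def)
    also have "\<dots> = (if x = y then 1 else 0)" using xy by simp
    finally show ?thesis .
  qed
qed

lemma product_basis_sym: "product_basis d \<beta>s x r = product_basis d \<beta>s r x"
proof (induction \<beta>s arbitrary: x r)
  case (Cons \<beta> \<beta>s)
  show ?case
    unfolding product_basis.simps using Cons qudit_basis_sym by metis
qed simp

lemma orthonormal_product_basis: "orthonormal (d ^ length \<beta>s) (product_basis d \<beta>s)"
proof (rule orthonormal_symI[OF product_basis_sym])
  show "(\<Sum>r<d ^ length \<beta>s. product_basis d \<beta>s x r * cnj (product_basis d \<beta>s y r)) = (if x = y then 1 else 0)"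
    if "x < d ^ length \<beta>s" "y < d ^ length \<beta>s" for x y
    using that
  proof (induction \<beta>s arbitrary: x y)
    case (Cons \<beta> \<beta>s)
    define c where "c = d ^ length \<beta>s"
    have c: "c > 0" using Cons.prems by (cases "d = 0") (auto simp: c_def)
    have xy: "x div c < d" "y div c < d" "x mod c < c" "y mod c < c"
      using Cons.prems c by (auto simp: c_def less_mult_imp_div_less)
    have "(\<Sum>r<d ^ length (\<beta> # \<beta>s). product_basis d (\<beta> # \<beta>s) x r * cnj (product_basis d (\<beta> # \<beta>s) y r)) =
      (\<Sum>i<d. \<Sum>j<c. (qudit_basis d \<beta> (x div c) i * cnj (qudit_basis d \<beta> (y div c) i)) *
          (product_basis d \<beta>s (x mod c) j * cnj (product_basis d \<beta>s (y mod c) j)))"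
      unfolding list.size power_Suc add_0_right add_Suc_right sum_mult_index c_def[symmetric]
      by (intro sum.cong refl) (simp add: c_def[symmetric])
    also have "\<dots> = (\<Sum>i<d. qudit_basis d \<beta> (x div c) i * cnj (qudit_basis d \<beta> (y div c) i)) *
        (\<Sum>j<c. product_basis d \<beta>s (x mod c) j * cnj (product_basis d \<beta>s (y mod c) j))"
      by (simp add: sum_product)
    also have "\<dots> = (if x div c = y div c then 1 else 0) * (if x mod c = y mod c then 1 else 0)"
      using xy Cons.IH[folded c_def] orthonormal_qudit_basis[of d \<beta>] by (simp add: orthonormal_def)
    also have "\<dots> = (if x = y then 1 else 0)"
    proof -
      have "x = y \<longleftrightarrow> x div c = y div c \<and> x mod c = y mod c" by (metis div_mult_mod_eq)
      then show ?thesis by simp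
    qed
    finally show ?case .
  qed simp
qed

lemma product_basis_append:
  assumes "x < d ^ (length xs + length ys)" "r < d ^ (length xs + length ys)"
  shows "product_basis d (xs @ ys) x r =
     product_basis d xs (x div d ^ length ys) (r div d ^ length ys) *
     product_basis d ys (x mod d ^ length ys) (r mod d ^ length ys)"
  using assms
proof (induction xs arbitrary: x r)
  case (Cons \<beta> xs)
  have d: "d > 0" using Cons.prems by (cases "d = 0") auto
  have e: "d ^ (length xs + length ys) = d ^ length ys * d ^ length xs"
    by (simp add: power_add)
  have m: "z mod (d ^ length ys * d ^ length xs) div d ^ length ys = z div d ^ length ys mod d ^ length xs"
    "z mod (d ^ length ys * d ^ length xs) mod d ^ length ys = z mod d ^ length ys" for z
    using d by (auto simp: mod_mult2_eq)
  have "product_basis d (xs @ ys) (x mod d ^ (length xs + length ys)) (r mod d ^ (length xs + length ys)) =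
     product_basis d xs (x div d ^ length ys mod d ^ length xs) (r div d ^ length ys mod d ^ length xs) *
     product_basis d ys (x mod d ^ length ys) (r mod d ^ length ys)"
    by (subst Cons.IH) (use d in \<open>auto simp: e m\<close>)
  then show ?case by (simp add: e div_mult2_eq)
qed simp

lemma cmod_product_basis_fourier:
  assumes "d \<ge> 1"
  shows "(cmod (product_basis d (replicate l True) x r))\<^sup>2 = 1 / real (d ^ l)"
proof (induction l arbitrary: x r)
  case (Suc l)
  have "(cmod (qudit_basis d True a b))\<^sup>2 = 1 / real d" for a b
    using assms by (simp add: qudit_basis_def norm_divide power_divide)
  then show ?case by (simp add: Suc norm_mult power_mult_distrib)
qed simp

lemma product_basis_computational:
  assumes "d \<ge> 1" "x < d ^ l" "r < d ^ l"
  shows "product_basis d (replicate l False) x r = (if x = r then 1 else 0)"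
  using assms(2,3)
proof (induction l arbitrary: x r)
  case (Suc l)
  have "x = r \<longleftrightarrow> x div d ^ l = r div d ^ l \<and> x mod d ^ l = r mod d ^ l"
    by (metis div_mult_mod_eq)
  then show ?case using assms(1) Suc by (auto simp: qudit_basis_def)
qed simp

text \<open>Peel off the first block. Once it is found with label \<open>x1\<close>, the other
  positions are left in a vector depending on the basis of this block, and the induction hypothesis
  for the fibre \<open>Ls x1\<close> gives a multiple of \<open>card (Ls x1) powr \<tau>\<close>
  times its squared norm. The sum over \<open>x1\<close> is what
  \<open>two_basis_power_bound\<close> controls, with the fibre cardinalities as \<open>s\<close>;
  they add up to \<open>card L\<close>, so the same \<tau> serves at every step.\<close>

lemma basis_choice_uncertainty:
  fixes w :: "nat \<Rightarrow> complex"
  assumes d: "d \<ge> 1" and v: "0 < v" "v < 1" and \<tau>: "\<tau> > 0"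
    and vq: "real (d ^ l) powr (- (\<tau> / real (m + 2))) = v"
    and L: "L \<subseteq> {..<d ^ (t * l + r)}"
  shows "(\<Sum>b<2 ^ t. \<Sum>x\<in>L. coeff_sq (d ^ (t * l + r)) (product_basis d (key_bits l r t b)) w x)
    \<le> (1 + v ^ m + real (d ^ l) powr (- (1 / (2 * real (m + 2))))) ^ t * real (card L) powr \<tau> *
      (\<Sum>i<d ^ (t * l + r). (cmod (w i))\<^sup>2)"
  using L
proof (induction t arbitrary: L w)
  case 0
  show ?case
  \<comment> \<open>Nothing is gained on the leftover positions: the weight of \<open>L\<close> is
    at most the total, and a nonempty \<open>L\<close> has \<open>card L powr \<tau>\<close> at
    least 1.\<close>
  proof (cases "L = {}")
    case False
    have "finite L" using 0 finite_subset by blast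
    with False have "card L \<ge> 1" by (simp add: Suc_leI card_gt_0_iff)
    then have c1: "real (card L) powr \<tau> \<ge> 1"
      using \<tau> by (intro ge_one_powr_ge_zero) auto
    let ?B = "product_basis d (key_bits l r 0 0)"
    have "(\<Sum>x\<in>L. coeff_sq (d ^ r) ?B w x) \<le> (\<Sum>x<d ^ r. coeff_sq (d ^ r) ?B w x)"
      using 0 by (intro sum_mono2) (auto simp: coeff_sq_def)
    also have "\<dots> = (\<Sum>i<d ^ r. (cmod (w i))\<^sup>2)"
      using parseval[OF orthonormal_product_basis[of d "key_bits l r 0 0"]] by simp
    also have "\<dots> \<le> real (card L) powr \<tau> * (\<Sum>i<d ^ r. (cmod (w i))\<^sup>2)"
      using c1 mult_right_mono[OF c1, of "\<Sum>i<d ^ r. (cmod (w i))\<^sup>2"] by (simp add: sum_nonneg)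
    finally show ?thesis by simp
  qed simp
next
  case (Suc t)
  define q where "q = d ^ l"
  define Y where "Y = d ^ (t * l + r)"
  define c where "c = 1 + v ^ m + real q powr (- (1 / (2 * real (m + 2))))"
  define E where "E = (\<Sum>i<q * Y. (cmod (w i))\<^sup>2)"
  define F where "F = product_basis d (replicate l True)"
  define Ls where "Ls = (\<lambda>x1. {x'. x' < Y \<and> x1 * Y + x' \<in> L})"
  \<comment> \<open>The unnormalised vectors left on the other positions when the first block is
    found with label \<open>x1\<close> in the computational or in the Fourier basis;
    \<open>p0\<close> and \<open>p1\<close> are their squared norms.\<close>
  define e0 where "e0 = (\<lambda>x1 r'. w (x1 * Y + r'))"
  define e1 where "e1 = (\<lambda>x1 r'. \<Sum>r1<q. cnj (F x1 r1) * w (r1 * Y + r'))"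
  define p0 where "p0 = (\<lambda>x1. \<Sum>r'<Y. (cmod (e0 x1 r'))\<^sup>2)"
  define p1 where "p1 = (\<lambda>x1. \<Sum>r'<Y. (cmod (e1 x1 r'))\<^sup>2)"
  define B where "B = (\<lambda>b. product_basis d (key_bits l r t b))"
  have q1: "q \<ge> 1" and Y1: "Y \<ge> 1" using d by (auto simp: q_def Y_def)
  have dim: "d ^ (Suc t * l + r) = q * Y" by (simp add: q_def Y_def power_add)
  have c0: "c \<ge> 0" using v by (simp add: c_def add_nonneg_nonneg)
  have F: "orthonormal q F" unfolding F_def q_def using orthonormal_product_basis[of d "replicate l True"] by simp
  have Ls: "Ls x1 \<subseteq> {..<Y}" "finite (Ls x1)" for x1 by (auto simp: Ls_def)
  have Lsum: "(\<Sum>x\<in>L. f x) = (\<Sum>x1<q. \<Sum>x'\<in>Ls x1. f (x1 * Y + x'))" for f :: "nat \<Rightarrow> real"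
  proof -
    have "(\<Sum>x\<in>L. f x) = (\<Sum>x<q * Y. if x \<in> L then f x else 0)"
      using Suc.prems unfolding dim by (intro sum.mono_neutral_cong_left) auto
    also have "\<dots> = (\<Sum>x1<q. \<Sum>x'<Y. if x1 * Y + x' \<in> L then f (x1 * Y + x') else 0)"
      by (rule sum_mult_index)
    also have "\<dots> = (\<Sum>x1<q. \<Sum>x'\<in>Ls x1. f (x1 * Y + x'))"
      by (intro sum.cong refl sum.mono_neutral_cong_right) (auto simp: Ls_def)
    finally show ?thesis .
  qed
  have split: "coeff_sq (q * Y) (product_basis d (key_bits l r (Suc t) (b1 * 2 ^ t + b'))) w (x1 * Y + x')
      = coeff_sq Y (B b') (if b1 = 1 then e1 x1 else e0 x1) x'"
    if "b1 < 2" "b' < 2 ^ t" "x1 < q" "x' < Y" for b1 b' x1 x'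
  proof -
    have *: "product_basis d (key_bits l r (Suc t) (b1 * 2 ^ t + b')) (x1 * Y + x') (r1 * Y + r') =
       product_basis d (replicate l (b1 = 1)) x1 r1 * B b' x' r'" if "r1 < q" "r' < Y" for r1 r'
    proof -
      have lt: "i * Y + j < d ^ (length (replicate l (b1 = 1)) + length (key_bits l r t b'))"
        if "i < q" "j < Y" for i j
      proof -
        have "i * Y + j < Suc i * Y" using that by simp
        also have "\<dots> \<le> q * Y" using that by (intro mult_right_mono) auto
        finally show ?thesis by (simp add: q_def Y_def power_add)
      qed
      have "product_basis d (key_bits l r (Suc t) (b1 * 2 ^ t + b')) =
          product_basis d (replicate l (b1 = 1) @ key_bits l r t b')"
        using \<open>b' < 2 ^ t\<close> by simp
      then show ?thesis
        using \<open>x' < Y\<close> \<open>r' < Y\<close>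
        by (simp only: product_basis_append[OF lt[OF \<open>x1 < q\<close> \<open>x' < Y\<close>] lt[OF \<open>r1 < q\<close> \<open>r' < Y\<close>]])
          (simp add: B_def flip: Y_def)
    qed
    have "(\<Sum>i<q * Y. cnj (product_basis d (key_bits l r (Suc t) (b1 * 2 ^ t + b')) (x1 * Y + x') i) * w i)
      = (\<Sum>r1<q. \<Sum>r'<Y. cnj (B b' x' r') * (cnj (product_basis d (replicate l (b1 = 1)) x1 r1) * w (r1 * Y + r')))"
      unfolding sum_mult_index by (intro sum.cong refl) (simp add: * del: key_bits.simps)
    also have "\<dots> = (\<Sum>r'<Y. cnj (B b' x' r') * (\<Sum>r1<q. cnj (product_basis d (replicate l (b1 = 1)) x1 r1) * w (r1 * Y + r')))"
      by (subst sum.swap) (simp add: sum_distrib_left)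
    also have "\<dots> = (\<Sum>r'<Y. cnj (B b' x' r') * (if b1 = 1 then e1 x1 else e0 x1) r')"
    proof (intro sum.cong refl arg_cong2[where f = "(*)"])
      fix r'
      show "(\<Sum>r1<q. cnj (product_basis d (replicate l (b1 = 1)) x1 r1) * w (r1 * Y + r'))
        = (if b1 = 1 then e1 x1 else e0 x1) r'"
      proof (cases "b1 = 1")
        case False
        have "(\<Sum>r1<q. cnj (product_basis d (replicate l (b1 = 1)) x1 r1) * w (r1 * Y + r'))
          = (\<Sum>r1<q. if r1 = x1 then w (r1 * Y + r') else 0)"
          using False \<open>x1 < q\<close> d by (intro sum.cong refl) (auto simp: product_basis_computational q_def)
        then show ?thesis using False \<open>x1 < q\<close> by (simp add: e0_def)
      qed (simp add: e1_def F_def)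
    qed
    finally show ?thesis by (simp only: coeff_sq_def)
  qed
  have pE: "(\<Sum>x1<q. p0 x1) = E"
    unfolding E_def sum_mult_index p0_def e0_def ..
  \<comment> \<open>The uncertainty relation for the first block holds for every fixed index
    \<open>r'\<close> of the other positions, and both sides are additive over
    \<open>r'\<close>.\<close>
  have unc: "sum p0 A + sum p1 A' \<le> (1 + sqrt (real (card A) * real (card A') / real q)) * E"
    if "A \<subseteq> {..<q}" "A' \<subseteq> {..<q}" for A A'
  proof -
    have "sum p0 A + sum p1 A' =
      (\<Sum>r'<Y. (\<Sum>x\<in>A. (cmod (w (x * Y + r')))\<^sup>2) + (\<Sum>y\<in>A'. coeff_sq q F (\<lambda>x. w (x * Y + r')) y))"
      unfolding p0_def p1_def e0_def e1_def coeff_sq_def sum.distrib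
      by (rule arg_cong2[where f = "(+)"]; rule sum.swap)
    also have "\<dots> \<le> (\<Sum>r'<Y. (1 + sqrt (real (card A) * real (card A') / real q)) * (\<Sum>x<q. (cmod (w (x * Y + r')))\<^sup>2))"
      by (intro sum_mono mutually_unbiased_uncertainty F that)
        (simp add: F_def q_def cmod_product_basis_fourier[OF d])
    also have "\<dots> = (1 + sqrt (real (card A) * real (card A') / real q)) * E"
      unfolding E_def sum_mult_index sum_distrib_left by (rule sum.swap)
    finally show ?thesis .
  qed
  have p1E: "(\<Sum>x1<q. p1 x1) = E"
  proof -
    have "(\<Sum>x1<q. p1 x1) = (\<Sum>r'<Y. \<Sum>y<q. coeff_sq q F (\<lambda>x. w (x * Y + r')) y)"
      unfolding p1_def e1_def coeff_sq_def by (rule sum.swap)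
    also have "\<dots> = E" unfolding parseval[OF F] E_def sum_mult_index by (rule sum.swap)
    finally show ?thesis .
  qed
  have IH: "(\<Sum>b<2 ^ t. \<Sum>x'\<in>Ls x1. coeff_sq Y (B b) e x') \<le>
      c ^ t * real (card (Ls x1)) powr \<tau> * (\<Sum>i<Y. (cmod (e i))\<^sup>2)" for e x1
    using Suc.IH[of "Ls x1" e, folded Y_def, OF Ls(1)] unfolding c_def q_def B_def .
  have "(\<Sum>b<2 ^ Suc t. \<Sum>x\<in>L. coeff_sq (q * Y) (product_basis d (key_bits l r (Suc t) b)) w x)
    = (\<Sum>b1<2::nat. \<Sum>b'<2 ^ t. \<Sum>x1<q. \<Sum>x'\<in>Ls x1. coeff_sq Y (B b') (if b1 = 1 then e1 x1 else e0 x1) x')"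
    unfolding power_Suc sum_mult_index Lsum
    by (intro sum.cong refl split) (auto simp: Ls_def)
  also have "\<dots> = (\<Sum>b1<2::nat. \<Sum>x1<q. \<Sum>b'<2 ^ t. \<Sum>x'\<in>Ls x1. coeff_sq Y (B b') (if b1 = 1 then e1 x1 else e0 x1) x')"
    by (rule sum.cong[OF refl], rule sum.swap)
  also have "\<dots> \<le> (\<Sum>b1<2::nat. \<Sum>x1<q. c ^ t * real (card (Ls x1)) powr \<tau> *
      (\<Sum>i<Y. (cmod ((if b1 = 1 then e1 x1 else e0 x1) i))\<^sup>2))"
    by (intro sum_mono IH)
  also have "\<dots> = (\<Sum>x1<q. c ^ t * real (card (Ls x1)) powr \<tau> * p0 x1) + (\<Sum>x1<q. c ^ t * real (card (Ls x1)) powr \<tau> * p1 x1)"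
    by (simp only: numeral_2_eq_2 sum.lessThan_Suc lessThan_0 sum.empty p0_def p1_def) simp
  also have "\<dots> = c ^ t * (\<Sum>x1<q. (p0 x1 + p1 x1) * real (card (Ls x1)) powr \<tau>)"
    unfolding sum_distrib_left sum.distrib[symmetric] by (intro sum.cong refl) (simp add: algebra_simps)
  finally have 1: "(\<Sum>b<2 ^ Suc t. \<Sum>x\<in>L. coeff_sq (q * Y) (product_basis d (key_bits l r (Suc t) b)) w x)
    \<le> c ^ t * (\<Sum>x1<q. (p0 x1 + p1 x1) * real (card (Ls x1)) powr \<tau>)" .
  have p: "0 \<le> p0 x" "0 \<le> p1 x" for x by (simp_all add: p0_def p1_def sum_nonneg)
  have 2: "(\<Sum>x1<q. (p0 x1 + p1 x1) * real (card (Ls x1)) powr \<tau>)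
      \<le> c * (\<Sum>x1<q. real (card (Ls x1))) powr \<tau> * E"
    unfolding c_def
    by (rule two_basis_power_bound[OF q1 v \<tau> vq[folded q_def] p _ pE p1E unc]) auto
  have 3: "(\<Sum>x1<q. real (card (Ls x1))) = real (card L)"
    using Lsum[of "\<lambda>_. 1"] by simp
  have "c ^ t * (\<Sum>x1<q. (p0 x1 + p1 x1) * real (card (Ls x1)) powr \<tau>)
      \<le> c ^ t * (c * real (card L) powr \<tau> * E)"
    by (rule mult_left_mono[OF 2[unfolded 3] zero_le_power[OF c0]])
  with 1 have "(\<Sum>b<2 ^ Suc t. \<Sum>x\<in>L. coeff_sq (q * Y) (product_basis d (key_bits l r (Suc t) b)) w x)
    \<le> c ^ Suc t * real (card L) powr \<tau> * E" by (simp only: power_Suc2 mult.assoc)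
  then show ?case
    unfolding dim q_def[symmetric] c_def[symmetric] E_def[symmetric] .
qed

section \<open>Seeded hash functions\<close>

text \<open>For negative \<open>y\<close>, the product of 1 - y and the right-hand side is 1 - y ^
  3, which is at least 1, and 1 - y is at most exp (- y).\<close>

lemma exp_le_quadratic:
  fixes y :: real
  assumes "y \<le> 1"
  shows "exp y \<le> 1 + y + y\<^sup>2"
proof (cases "y \<ge> 0")
  case True
  then show ?thesis using assms exp_bound by blast
next
  case False
  have q: "1 + y + y\<^sup>2 > 0"
  proof -
    have "1 + y + y\<^sup>2 = (y + 1 / 2)\<^sup>2 + 3 / 4" by (simp add: power2_eq_square algebra_simps)
    then show ?thesis by (simp add: add_nonneg_pos)
  qed
  have "1 \<le> 1 - y ^ 3" using False by (simp add: power3_eq_cube mult_le_0_iff zero_le_mult_iff)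
  also have "\<dots> = (1 - y) * (1 + y + y\<^sup>2)" by (simp add: algebra_simps power2_eq_square power3_eq_cube)
  also have "\<dots> \<le> exp (- y) * (1 + y + y\<^sup>2)"
    using q exp_ge_add_one_self[of "- y"] by (intro mult_right_mono) auto
  finally have "exp y * 1 \<le> exp y * (exp (- y) * (1 + y + y\<^sup>2))"
    by (intro mult_left_mono) auto
  then show ?thesis by (simp add: mult.assoc[symmetric] exp_add[symmetric])
qed

text \<open>The number of seeds that hash \<open>x\<close> into \<open>T\<close>, minus its
  expectation for uniformly random hash values.\<close>

definition excess :: "nat \<Rightarrow> nat \<Rightarrow> (nat \<Rightarrow> nat \<Rightarrow> nat) \<Rightarrow> nat set \<Rightarrow> nat \<Rightarrow> real" where
  "excess N S h T x = (\<Sum>s<S. (if h s x \<in> T then 1 else 0) - real (card T) / real N)"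

text \<open>The exponents \<open>y a\<close> have mean 0 and modulus at most \<delta> / 2, so the
  second-order bound on exp costs a factor exp (\<delta> ^ 2 / 4); the shift by \<delta> contributes
  exp (- \<delta> ^ 2 / 2).\<close>

lemma chernoff_indicator:
  assumes \<delta>: "0 < \<delta>" "\<delta> \<le> 1" and N: "N \<ge> 1" and T: "T \<subseteq> {..<N}"
  shows "(\<Sum>a<N. exp (\<delta> / 2 * ((if a \<in> T then 1 else 0) - real (card T) / real N - \<delta>)))
    \<le> real N * exp (- (\<delta>\<^sup>2 / 4))"
proof -
  define p where "p = real (card T) / real N"
  define y where "y = (\<lambda>a. \<delta> / 2 * ((if a \<in> T then 1 else 0) - p))"
  have cT: "real (card T) \<le> real N" using card_mono[OF _ T] by simp
  have p: "0 \<le> p" "p \<le> 1" using N cT by (auto simp: p_def)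
  have z: "\<bar>(if a \<in> T then 1 else 0) - p\<bar> \<le> 1" for a using p by auto
  have y: "\<bar>y a\<bar> \<le> \<delta> / 2" for a
    using z[of a] \<delta> unfolding y_def abs_mult by (intro order_trans[OF mult_left_mono[OF z]]) auto
  have ysum: "(\<Sum>a<N. y a) = 0"
  proof -
    have "(\<Sum>a<N. if a \<in> T then 1 else (0::real)) = real (card T)"
      using T by (simp add: sum.If_cases Int_absorb1)
    then show ?thesis using N
      unfolding y_def sum_distrib_left[symmetric] sum_subtractf by (simp add: p_def)
  qed
  have "(\<Sum>a<N. exp (y a)) \<le> (\<Sum>a<N. 1 + y a + (\<delta> / 2)\<^sup>2)"
  proof (intro sum_mono)
    fix a
    have "exp (y a) \<le> 1 + y a + (y a)\<^sup>2"
      using y[of a] \<delta> by (intro exp_le_quadratic) linarith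
    also have "(y a)\<^sup>2 \<le> (\<delta> / 2)\<^sup>2" using y[of a] by (simp add: abs_le_square_iff[symmetric])
    finally show "exp (y a) \<le> 1 + y a + (\<delta> / 2)\<^sup>2" by simp
  qed
  also have "\<dots> = real N * (1 + (\<delta> / 2)\<^sup>2)" by (simp add: sum.distrib ysum algebra_simps)
  also have "\<dots> \<le> real N * exp ((\<delta> / 2)\<^sup>2)" by (intro mult_left_mono exp_ge_add_one_self) auto
  finally have "exp (- (\<delta>\<^sup>2 / 2)) * (\<Sum>a<N. exp (y a)) \<le> exp (- (\<delta>\<^sup>2 / 2)) * (real N * exp ((\<delta> / 2)\<^sup>2))"
    by (intro mult_left_mono) auto
  also have "\<dots> = real N * exp (- (\<delta>\<^sup>2 / 4))"
    by (simp add: exp_add[symmetric] power_divide field_simps)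
  also have "exp (- (\<delta>\<^sup>2 / 2)) * (\<Sum>a<N. exp (y a)) =
      (\<Sum>a<N. exp (\<delta> / 2 * ((if a \<in> T then 1 else 0) - p - \<delta>)))"
    unfolding sum_distrib_left exp_add[symmetric] y_def
    by (intro sum.cong refl arg_cong[where f = exp]) (simp add: power2_eq_square algebra_simps add_divide_distrib)
  finally show ?thesis by (simp add: p_def)
qed

text \<open>A union bound over all tests \<open>T\<close> and all sets \<open>B\<close> of \<open>N\<close> arguments, done by averaging the
  exponential weights \<open>W\<close> over all functions.\<close>
lemma random_hash_exists:
  assumes \<delta>: "0 < \<delta>" "\<delta> \<le> 1" and N: "N \<ge> 1" and D: "D \<ge> 1"
    and S: "2 * real D * exp (- (real S * \<delta>\<^sup>2 / 4)) < 1"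
  obtains h :: "nat \<Rightarrow> nat \<Rightarrow> nat" where
    "\<And>s x. s < S \<Longrightarrow> x < D \<Longrightarrow> h s x < N"
    "\<And>T. T \<subseteq> {..<N} \<Longrightarrow> card {x\<in>{..<D}. excess N S h T x > \<delta> * real S} < N"
proof -
  define I where "I = {..<D} \<times> {..<S}"
  define \<Omega> where "\<Omega> = PiE I (\<lambda>_. {..<N})"
  \<comment> \<open>\<open>f T a\<close> is the exponential weight of one hash value. Its product
    over all seeds of a label is at least 1 if and only if the excess of that label is at least
    \<delta> * S. \<open>W (T, B)\<close> is the product over the labels in \<open>B\<close>, hence
    at least 1 when all of \<open>B\<close> is bad for \<open>T\<close>.\<close>
  define f where "f = (\<lambda>(T :: nat set) a. exp (\<delta> / 2 * ((if a \<in> T then 1 else 0) - real (card T) / real N - \<delta>)))"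
  define W where "W = (\<lambda>(T, B) g. \<Prod>i\<in>I. if fst i \<in> B then f T (g i) else 1)"
  define \<T> where "\<T> = Pow {..<N} \<times> {B. B \<subseteq> {..<D} \<and> card B = N}"
  define \<rho> where "\<rho> = exp (- (\<delta>\<^sup>2 / 4))"
  have fin: "finite I" "finite \<T>" by (auto simp: I_def \<T>_def)
  have W0: "W TB g \<ge> 0" for TB g
    unfolding W_def by (cases TB) (auto intro!: prod_nonneg simp: f_def)
  have card\<Omega>: "real (card \<Omega>) = real N ^ (D * S)"
    unfolding \<Omega>_def using fin by (simp add: card_PiE I_def card_cartesian_product)
  have Wsum: "(\<Sum>g\<in>\<Omega>. W TB g) \<le> real (card \<Omega>) * \<rho> ^ (N * S)" if "TB \<in> \<T>" for TB
  proof -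
    obtain T B where TB1: "TB = (T, B)" by (cases TB)
    then have TB: "TB = (T, B)" "T \<subseteq> {..<N}" "B \<subseteq> {..<D}" "card B = N"
      using that by (auto simp: \<T>_def)
    have "(\<Sum>g\<in>\<Omega>. W TB g) = (\<Prod>i\<in>I. \<Sum>a<N. if fst i \<in> B then f T a else 1)"
      unfolding \<Omega>_def W_def TB(1) using fin
      by (subst prod_sum_PiE) auto
    also have "\<dots> \<le> (\<Prod>i\<in>I. real N * (if fst i \<in> B then \<rho> else 1))"
    proof (intro prod_mono conjI)
      fix i
      show "0 \<le> (\<Sum>a<N. if fst i \<in> B then f T a else 1)" by (auto intro!: sum_nonneg simp: f_def)
      show "(\<Sum>a<N. if fst i \<in> B then f T a else 1) \<le> real N * (if fst i \<in> B then \<rho> else 1)"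
        using chernoff_indicator[OF \<delta> N TB(2)] by (auto simp: f_def \<rho>_def)
    qed
    also have "\<dots> = real (card \<Omega>) * (\<Prod>i\<in>I. if fst i \<in> B then \<rho> else 1)"
      by (simp add: prod.distrib card\<Omega> I_def card_cartesian_product)
    also have "(\<Prod>i\<in>I. if fst i \<in> B then \<rho> else 1) = (\<Prod>i\<in>B \<times> {..<S}. \<rho>)"
      using TB fin by (intro prod.mono_neutral_cong_right) (auto simp: I_def)
    also have "\<dots> = \<rho> ^ (N * S)" using TB by (simp add: card_cartesian_product)
    finally show ?thesis .
  qed
  \<comment> \<open>There are 2 ^ N tests and at most D ^ N sets of \<open>N\<close> labels. This
    count and the bound on the mean of \<open>W\<close> are both N-th powers, which is why the
    condition on \<open>S\<close> does not involve \<open>N\<close>.\<close>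
  have card\<T>: "real (card \<T>) \<le> (2 * real D) ^ N"
  proof -
    have "card \<T> = 2 ^ N * (D choose N)"
      unfolding \<T>_def by (simp add: card_cartesian_product card_Pow n_subsets)
    also have "\<dots> \<le> 2 ^ N * D ^ N"
      by (cases "N \<le> D") (auto simp: binomial_le_pow binomial_eq_0)
    finally have "real (card \<T>) \<le> real (2 ^ N * D ^ N)" by (rule of_nat_mono)
    then show ?thesis by (simp add: power_mult_distrib)
  qed
  have c0: "real (card \<Omega>) > 0" using N by (simp add: card\<Omega>)
  have "(\<Sum>g\<in>\<Omega>. \<Sum>TB\<in>\<T>. W TB g) = (\<Sum>TB\<in>\<T>. \<Sum>g\<in>\<Omega>. W TB g)" by (rule sum.swap)
  also have "\<dots> \<le> (\<Sum>TB\<in>\<T>. real (card \<Omega>) * \<rho> ^ (N * S))" by (intro sum_mono Wsum)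
  also have "\<dots> = real (card \<T>) * (real (card \<Omega>) * \<rho> ^ (N * S))" by simp
  also have "\<dots> \<le> (2 * real D) ^ N * (real (card \<Omega>) * \<rho> ^ (N * S))"
    using card\<T> by (intro mult_right_mono) (auto simp: \<rho>_def)
  also have "\<dots> = real (card \<Omega>) * (2 * real D * \<rho> ^ S) ^ N"
    by (simp add: power_mult_distrib power_mult[symmetric] mult_ac)
  also have "\<dots> < real (card \<Omega>) * 1"
  proof -
    have "2 * real D * \<rho> ^ S < 1" using S by (simp add: \<rho>_def exp_of_nat_mult[symmetric])
    moreover have "0 \<le> 2 * real D * \<rho> ^ S" by (simp add: \<rho>_def)
    ultimately have "(2 * real D * \<rho> ^ S) ^ N < 1"
      using N power_strict_mono[of "2 * real D * \<rho> ^ S" 1 N] by simp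
    then show ?thesis using c0 by (intro mult_strict_left_mono)
  qed
  finally have lt: "(\<Sum>g\<in>\<Omega>. \<Sum>TB\<in>\<T>. W TB g) < (\<Sum>g\<in>\<Omega>. 1)" by simp
  obtain g where g: "g \<in> \<Omega>" "(\<Sum>TB\<in>\<T>. W TB g) < 1"
  proof (rule ccontr)
    assume "\<not> thesis"
    with that have "\<And>g. g \<in> \<Omega> \<Longrightarrow> 1 \<le> (\<Sum>TB\<in>\<T>. W TB g)" by (meson not_le)
    then have "(\<Sum>g\<in>\<Omega>. 1) \<le> (\<Sum>g\<in>\<Omega>. \<Sum>TB\<in>\<T>. W TB g)" by (rule sum_mono)
    with lt show False by simp
  qed
  define h where "h = (\<lambda>s x. g (x, s))"
  show ?thesis
  proof (rule that[of h])
    show "h s x < N" if "s < S" "x < D" for s x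
      using g(1) that by (auto simp: \<Omega>_def I_def h_def PiE_iff)
    fix T assume T: "T \<subseteq> {..<N}"
    show "card {x\<in>{..<D}. excess N S h T x > \<delta> * real S} < N"
    proof (rule ccontr)
      assume "\<not> ?thesis"
      then obtain B where B: "B \<subseteq> {x\<in>{..<D}. excess N S h T x > \<delta> * real S}" "card B = N"
        by (meson not_le obtain_subset_with_card_n)
      then have TB: "(T, B) \<in> \<T>" using T by (auto simp: \<T>_def)
      have finB: "finite B" using B finite_subset by fastforce
      have BD: "B \<subseteq> {..<D}" using B by auto
      have "1 \<le> (\<Prod>x\<in>B. exp (\<delta> / 2 * (excess N S h T x - \<delta> * real S)))"
        using B \<delta> by (intro prod_ge_1) auto
      also have "\<dots> = (\<Prod>x\<in>B. \<Prod>s<S. f T (g (x, s)))"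
      proof (intro prod.cong refl)
        fix x
        have "(\<Prod>s<S. f T (g (x, s))) = exp (\<Sum>s<S. \<delta> / 2 * ((if h s x \<in> T then 1 else 0) - real (card T) / real N - \<delta>))"
          by (simp add: f_def h_def exp_sum)
        also have "(\<Sum>s<S. \<delta> / 2 * ((if h s x \<in> T then 1 else 0) - real (card T) / real N - \<delta>))
          = \<delta> / 2 * (excess N S h T x - \<delta> * real S)"
          unfolding excess_def sum_distrib_left[symmetric] by (simp add: sum_subtractf)
        finally show "exp (\<delta> / 2 * (excess N S h T x - \<delta> * real S)) = (\<Prod>s<S. f T (g (x, s)))" ..
      qed
      also have "\<dots> = (\<Prod>i\<in>B \<times> {..<S}. f T (g i))"
        by (simp add: prod.cartesian_product case_prod_beta)
      also have "\<dots> = (\<Prod>i\<in>I. if fst i \<in> B then f T (g i) else 1)"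
        using BD fin by (intro prod.mono_neutral_cong_left) (auto simp: I_def split: if_splits)
      also have "\<dots> = W (T, B) g" by (simp add: W_def)
      also have "\<dots> \<le> (\<Sum>TB\<in>\<T>. W TB g)" using fin W0 TB by (intro member_le_sum) auto
      finally show False using g by simp
    qed
  qed
qed

text \<open>The first seed is not random: it makes every message occur.\<close>
lemma surjective_hash_exists:
  assumes \<delta>: "0 < \<delta>" "\<delta> \<le> 1" and N: "N \<ge> 1" "N \<le> D"
    and S: "2 * real D * exp (- (real S * \<delta>\<^sup>2 / 4)) < 1" and S\<delta>: "1 \<le> \<delta> * real (Suc S)"
  obtains h :: "nat \<Rightarrow> nat \<Rightarrow> nat" where
    "\<And>s x. s < Suc S \<Longrightarrow> x < D \<Longrightarrow> h s x < N"
    "\<And>m. m < N \<Longrightarrow> h 0 m = m"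
    "\<And>T. T \<subseteq> {..<N} \<Longrightarrow> card {x\<in>{..<D}. excess N (Suc S) h T x > 2 * \<delta> * real (Suc S)} < N"
proof -
  have D: "D \<ge> 1" using N by simp
  obtain g where g: "\<And>s x. s < S \<Longrightarrow> x < D \<Longrightarrow> g s x < N"
    "\<And>T. T \<subseteq> {..<N} \<Longrightarrow> card {x\<in>{..<D}. excess N S g T x > \<delta> * real S} < N"
    using random_hash_exists[OF \<delta> N(1) D S] by blast
  \<comment> \<open>The fixed seed changes an excess by at most 1; by \<open>S\<delta>\<close> this
    is absorbed when \<delta> is doubled.\<close>
  define h where "h = (\<lambda>s x. if s = 0 then x mod N else g (s - 1) x)"
  show ?thesis
  proof (rule that[of h])
    show "h s x < N" if "s < Suc S" "x < D" for s x using that g(1) N by (auto simp: h_def)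
    show "h 0 m = m" if "m < N" for m using that by (simp add: h_def)
    fix T assume T: "T \<subseteq> {..<N}"
    have "- 1 \<le> real (card T) / real N" by (rule order_trans[of _ 0]) auto
    then have "(if h 0 x \<in> T then 1 else 0) - real (card T) / real N \<le> (1 :: real)" for x by (auto split: if_splits)
    then have ex: "excess N (Suc S) h T x \<le> 1 + excess N S g T x" for x
      unfolding excess_def sum.lessThan_Suc_shift by (simp add: h_def)
    have "{x\<in>{..<D}. excess N (Suc S) h T x > 2 * \<delta> * real (Suc S)}
        \<subseteq> {x\<in>{..<D}. excess N S g T x > \<delta> * real S}"
    proof clarsimp
      fix x assume "2 * \<delta> * (1 + real S) < excess N (Suc S) h T x"
      moreover have "2 * \<delta> * (1 + real S) = \<delta> * (1 + real S) + (\<delta> + \<delta> * real S)"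
        by (simp add: algebra_simps)
      ultimately show "\<delta> * real S < excess N S g T x" using ex[of x] S\<delta> \<delta> by simp
    qed
    then have "card {x\<in>{..<D}. excess N (Suc S) h T x > 2 * \<delta> * real (Suc S)}
        \<le> card {x\<in>{..<D}. excess N S g T x > \<delta> * real S}" by (intro card_mono) auto
    with g(2)[OF T] show "card {x\<in>{..<D}. excess N (Suc S) h T x > 2 * \<delta> * real (Suc S)} < N"
      by simp
  qed
qed

section \<open>From balanced seeds to nearly uniform messages\<close>

lemma sum_abs_eq_twice_pos:
  fixes y :: "'a \<Rightarrow> real"
  assumes "finite A" "sum y A = 0"
  shows "(\<Sum>m\<in>A. \<bar>y m\<bar>) = 2 * sum y {m\<in>A. y m > 0}"
proof -
  have "(\<Sum>m\<in>A. \<bar>y m\<bar>) = (\<Sum>m\<in>A. 2 * (if y m > 0 then y m else 0) - y m)"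
    by (intro sum.cong) auto
  also have "\<dots> = 2 * (\<Sum>m\<in>A. if y m > 0 then y m else 0)"
    using assms by (simp add: sum_subtractf sum_distrib_left)
  also have "(\<Sum>m\<in>A. if y m > 0 then y m else 0) = sum y {m\<in>A. y m > 0}"
    using assms by (simp add: sum.inter_filter)
  finally show ?thesis .
qed

text \<open>The deviations \<open>y\<close> sum to 0, so their absolute sum is twice the sum over
  the set \<open>T\<close> of messages where they are positive. That sum is the average of
  \<open>excess N S h T\<close> under the weights \<open>P\<close>: at most \<gamma> * S per label
  off the bad set \<open>L\<close>, and at most S on it. As \<open>L\<close> has fewer than
  \<open>N\<close> labels, its weight is bounded by \<open>unc\<close>.\<close>

lemma hashed_outcomes_near_uniform:
  fixes P :: "nat \<Rightarrow> nat \<Rightarrow> real" and h :: "nat \<Rightarrow> nat \<Rightarrow> nat"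
  assumes K: "K \<ge> 1" and S: "S \<ge> 1" and N: "N \<ge> 1" and \<gamma>: "\<gamma> \<ge> 0"
    and P: "\<And>b x. 0 \<le> P b x" "\<And>b. b < K \<Longrightarrow> (\<Sum>x<D. P b x) = E"
    and h: "\<And>s x. s < S \<Longrightarrow> x < D \<Longrightarrow> h s x < N"
    and sampler: "\<And>T. T \<subseteq> {..<N} \<Longrightarrow> card {x\<in>{..<D}. excess N S h T x > \<gamma> * real S} < N"
    and unc: "\<And>L. L \<subseteq> {..<D} \<Longrightarrow> card L < N \<Longrightarrow> (\<Sum>b<K. \<Sum>x\<in>L. P b x) \<le> \<beta> * real K * E"
  shows "(\<Sum>m<N. \<bar>(\<Sum>b<K. \<Sum>s<S. \<Sum>x<D. if h s x = m then P b x else 0) / (real K * real S) - E / real N\<bar>)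
    \<le> 2 * (\<gamma> + \<beta>) * E"
proof -
  define y where "y = (\<lambda>m. (\<Sum>b<K. \<Sum>s<S. \<Sum>x<D. if h s x = m then P b x else 0) / (real K * real S) - E / real N)"
  have K0: "real K > 0" "real S > 0" "real N > 0" using K S N by auto
  have PE: "(\<Sum>b<K. \<Sum>x<D. P b x) = real K * E" using P by simp
  have swap: "(\<Sum>m\<in>T. \<Sum>b<K. \<Sum>s<S. \<Sum>x<D. if h s x = m then P b x else 0)
     = (\<Sum>b<K. \<Sum>x<D. P b x * (\<Sum>s<S. if h s x \<in> T then 1 else 0))" if "finite T" for T
  proof -
    have "(\<Sum>m\<in>T. \<Sum>b<K. \<Sum>s<S. \<Sum>x<D. if h s x = m then P b x else 0)
      = (\<Sum>b<K. \<Sum>s<S. \<Sum>x<D. \<Sum>m\<in>T. if h s x = m then P b x else 0)"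
      by (simp only: sum.swap[where A = T])
    also have "\<dots> = (\<Sum>b<K. \<Sum>s<S. \<Sum>x<D. P b x * (if h s x \<in> T then 1 else 0))"
      using that by (intro sum.cong refl) simp
    also have "\<dots> = (\<Sum>b<K. \<Sum>x<D. \<Sum>s<S. P b x * (if h s x \<in> T then 1 else 0))"
      by (rule sum.cong[OF refl], rule sum.swap)
    finally show ?thesis by (simp only: sum_distrib_left)
  qed
  have ysum: "(\<Sum>m\<in>T. y m) = (\<Sum>b<K. \<Sum>x<D. P b x * excess N S h T x) / (real K * real S)"
    if T: "T \<subseteq> {..<N}" for T
  proof -
    have finT: "finite T" using T finite_subset by blast
    have "(\<Sum>m\<in>T. y m) = (\<Sum>b<K. \<Sum>x<D. P b x * (\<Sum>s<S. if h s x \<in> T then 1 else 0)) / (real K * real S)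
        - real (card T) * (E / real N)"
      unfolding y_def sum_subtractf sum_divide_distrib[symmetric] swap[OF finT] by simp
    also have "real (card T) * (E / real N) =
        (\<Sum>b<K. \<Sum>x<D. P b x * (real S * (real (card T) / real N))) / (real K * real S)"
      unfolding sum_distrib_right[symmetric] PE using K0 by simp
    finally show ?thesis
      by (simp add: excess_def sum_subtractf diff_divide_distrib right_diff_distrib)
  qed
  have "(\<Sum>m<N. y m) = 0"
  proof -
    have "excess N S h {..<N} x = 0" if "x < D" for x
      using that h N by (simp add: excess_def)
    then show ?thesis by (simp add: ysum)
  qed
  then have "(\<Sum>m<N. \<bar>y m\<bar>) = 2 * sum y {m\<in>{..<N}. y m > 0}"
    by (intro sum_abs_eq_twice_pos) auto
  also have "2 * sum y {m\<in>{..<N}. y m > 0} \<le> 2 * ((\<gamma> + \<beta>) * E)"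
  proof -
    define T where "T = {m\<in>{..<N}. y m > 0}"
    define L where "L = {x\<in>{..<D}. excess N S h T x > \<gamma> * real S}"
    have T: "T \<subseteq> {..<N}" by (auto simp: T_def)
    have exS: "excess N S h T x \<le> real S" for x
    proof -
      have "- 1 \<le> real (card T) / real N" by (rule order_trans[of _ 0]) auto
      then have "(if h s x \<in> T then 1 else 0) - real (card T) / real N \<le> (1 :: real)" for s by (auto split: if_splits)
      then show ?thesis
        unfolding excess_def using sum_bounded_above[of "{..<S}" _ "1 :: real"] by simp
    qed
    have ex: "excess N S h T x \<le> \<gamma> * real S + (if x \<in> L then real S else 0)" if "x < D" for x
      using that exS[of x] \<gamma> by (cases "x \<in> L") (auto simp: L_def add_increasing)
    have "(\<Sum>b<K. \<Sum>x<D. P b x * excess N S h T x)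
      \<le> (\<Sum>b<K. \<Sum>x<D. P b x * (\<gamma> * real S + (if x \<in> L then real S else 0)))"
      using P ex by (intro sum_mono mult_left_mono) auto
    also have "\<dots> = real K * E * (\<gamma> * real S) + (\<Sum>b<K. \<Sum>x\<in>L. P b x) * real S"
    proof -
      have "(\<Sum>x<D. P b x * (if x \<in> L then real S else 0)) = (\<Sum>x\<in>L. P b x) * real S" for b
        unfolding sum_distrib_right by (intro sum.mono_neutral_cong_right) (auto simp: L_def)
      then show ?thesis
        by (simp add: distrib_left sum.distrib sum_distrib_right[symmetric] PE)
    qed
    also have "\<dots> \<le> real K * E * (\<gamma> * real S) + \<beta> * real K * E * real S"
      using unc[of L] sampler[OF T] by (intro add_left_mono mult_right_mono) (auto simp: L_def)
    also have "\<dots> = (\<gamma> + \<beta>) * E * (real K * real S)" by (simp add: algebra_simps)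
    finally show ?thesis
      unfolding T_def[symmetric] ysum[OF T] using K0 by (simp add: divide_le_eq mult.assoc)
  qed
  finally show ?thesis unfolding y_def by (simp only: mult.assoc)
qed

section \<open>Hermitian matrices and the trace norm\<close>

text \<open>Orthonormal rows make the adjoint a right inverse; for a square matrix it is then a left
  inverse as well, which is orthonormality of the columns.\<close>

lemma orthonormalI_rows:
  assumes rows: "\<And>x y. x < n \<Longrightarrow> y < n \<Longrightarrow> (\<Sum>r<n. B x r * cnj (B y r)) = (if x = y then 1 else 0)"
  shows "orthonormal n B"
proof -
  define M where "M = mat n n (\<lambda>(x, r). B x r)"
  define M' where "M' = mat n n (\<lambda>(r, x). cnj (B x r))"
  have carr: "M \<in> carrier_mat n n" "M' \<in> carrier_mat n n" by (auto simp: M_def M'_def)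
  have "M * M' = 1\<^sub>m n"
    using rows by (intro eq_matI) (auto simp: M_def M'_def scalar_prod_def lessThan_atLeast0)
  then have inv: "M' * M = 1\<^sub>m n" using mat_mult_left_right_inverse[OF carr] by blast
  have "(\<Sum>x<n. B x r * cnj (B x s)) = (if r = s then 1 else 0)" if "r < n" "s < n" for r s
  proof -
    have "(M' * M) $$ (s, r) = (\<Sum>x<n. cnj (B x s) * B x r)"
      using that by (simp add: M_def M'_def scalar_prod_def lessThan_atLeast0)
    then show ?thesis using that by (simp add: inv mult.commute eq_commute[of r s])
  qed
  with rows show ?thesis by (simp add: orthonormal_def)
qed

section \<open>The spectral theorem for Hermitian matrices\<close>

lemma cscalar_prod_sum:
  assumes "v \<in> carrier_vec n" "w \<in> carrier_vec n"
  shows "v \<bullet>c w = (\<Sum>r<n. v $ r * cnj (w $ r))"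
  using assms by (simp add: scalar_prod_def lessThan_atLeast0)

lemma mult_mat_vec_sum:
  assumes "A \<in> carrier_mat n m" "v \<in> carrier_vec m" "r < n"
  shows "(A *\<^sub>v v) $ r = (\<Sum>s<m. A $$ (r, s) * v $ s)"
  using assms by (simp add: scalar_prod_def lessThan_atLeast0)

lemma orthonormal_completion:
  assumes v: "v \<in> carrier_vec n" "v \<noteq> 0\<^sub>v n"
  obtains W :: "nat \<Rightarrow> nat \<Rightarrow> complex" and c where
    "orthonormal n W" "\<And>r. r < n \<Longrightarrow> W 0 r = c * v $ r"
proof -
  interpret cof_vec_space n "TYPE(complex)" .
  define b where "b = basis_completion v"
  define ws where "ws = gram_schmidt n b"
  note bc = basis_completion[OF v, folded b_def]
  have ws: "corthogonal ws" "set ws \<subseteq> carrier_vec n" "length ws = n"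
    using gram_schmidt_result[OF bc(2) bc(4) bc(5) ws_def] bc by auto
  have n: "n > 0" using v by (cases n) auto
  obtain vs where "b = v # vs" using bc n by (cases b) auto
  \<comment> \<open>Gram-Schmidt leaves the head of its list in place, so the first basis vector
    keeps the direction of \<open>v\<close>.\<close>
  then have hd: "hd ws = v" unfolding ws_def using v by simp
  then have ws0: "ws ! 0 = v" using ws n by (simp add: hd_conv_nth[symmetric] flip: length_greater_0_conv)
  define nn where "nn = (\<lambda>i. \<Sum>r<n. (cmod (ws ! i $ r))\<^sup>2)"
  have wsc: "ws ! i \<in> carrier_vec n" if "i < n" for i using ws that by (meson nth_mem subsetD)
  have ip: "ws ! i \<bullet>c ws ! j = (\<Sum>r<n. ws ! i $ r * cnj (ws ! j $ r))" if "i < n" "j < n" for i j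
    using cscalar_prod_sum wsc that by blast
  have nn: "ws ! i \<bullet>c ws ! i = of_real (nn i)" if "i < n" for i
    using ip[OF that that] by (simp add: nn_def complex_cmod_square)
  have nn0: "nn i > 0" if "i < n" for i
  proof -
    have "of_real (nn i) \<noteq> (0 :: complex)" using nn[OF that] corthogonalD[OF ws(1)] ws(3) that by metis
    moreover have "nn i \<ge> 0" by (simp add: nn_def sum_nonneg)
    ultimately show ?thesis by simp
  qed
  define W where "W = (\<lambda>i r. of_real (1 / sqrt (nn i)) * ws ! i $ r)"
  have "orthonormal n W"
  proof (rule orthonormalI_rows)
    fix x y assume xy: "x < n" "y < n"
    have "(\<Sum>r<n. W x r * cnj (W y r)) = of_real (1 / sqrt (nn x)) * of_real (1 / sqrt (nn y)) * (ws ! x \<bullet>c ws ! y)"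
      unfolding ip[OF xy] sum_distrib_left by (simp add: W_def mult_ac)
    also have "\<dots> = (if x = y then 1 else 0)"
    proof (cases "x = y")
      case True
      have "1 / sqrt (nn y) * (1 / sqrt (nn y)) * nn y = 1"
        using nn0[OF xy(2)] by (simp add: field_simps)
      then show ?thesis unfolding True nn[OF xy(2)] of_real_mult[symmetric] by simp
    next
      case False
      then show ?thesis using corthogonalD[OF ws(1)] ws(3) xy by simp
    qed
    finally show "(\<Sum>r<n. W x r * cnj (W y r)) = (if x = y then 1 else 0)" .
  qed
  moreover have "W 0 r = of_real (1 / sqrt (nn 0)) * v $ r" for r by (simp add: W_def ws0)
  ultimately show ?thesis using that by blast
qed

lemma orthonormal_rowsD:
  "orthonormal n B \<Longrightarrow> x < n \<Longrightarrow> y < n \<Longrightarrow> (\<Sum>r<n. B x r * cnj (B y r)) = (if x = y then 1 else 0)"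
  by (simp add: orthonormal_def)

lemma orthonormal_colsD:
  "orthonormal n B \<Longrightarrow> r < n \<Longrightarrow> s < n \<Longrightarrow> (\<Sum>x<n. B x r * cnj (B x s)) = (if r = s then 1 else 0)"
  by (simp add: orthonormal_def)

lemma sum_change_basis:
  assumes W: "orthonormal n W" and rs: "r < n" "s < n"
  shows "(\<Sum>i<n. \<Sum>j<n. W i r * (\<Sum>p<n. \<Sum>q<n. cnj (W i p) * a p q * W j q) * cnj (W j s)) = a r s"
proof -
  have "(\<Sum>i<n. \<Sum>j<n. W i r * (\<Sum>p<n. \<Sum>q<n. cnj (W i p) * a p q * W j q) * cnj (W j s))
    = (\<Sum>i<n. \<Sum>j<n. \<Sum>p<n. \<Sum>q<n. (W i r * cnj (W i p)) * ((W j q * cnj (W j s)) * a p q))"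
    by (simp add: sum_distrib_left sum_distrib_right mult_ac)
  also have "\<dots> = (\<Sum>i<n. \<Sum>p<n. \<Sum>q<n. \<Sum>j<n. (W i r * cnj (W i p)) * ((W j q * cnj (W j s)) * a p q))"
    by (rule sum.cong[OF refl], rule sum_swap3)
  also have "\<dots> = (\<Sum>p<n. \<Sum>q<n. \<Sum>i<n. \<Sum>j<n. (W i r * cnj (W i p)) * ((W j q * cnj (W j s)) * a p q))"
    by (rule sum_swap3)
  also have "\<dots> = (\<Sum>p<n. \<Sum>q<n. (\<Sum>i<n. W i r * cnj (W i p)) * (\<Sum>j<n. W j q * cnj (W j s)) * a p q)"
    unfolding sum_product unfolding sum_distrib_right mult.assoc ..
  also have "\<dots> = (\<Sum>p<n. \<Sum>q<n. if p = r then if q = s then a p q else 0 else 0)"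
    using rs by (intro sum.cong refl) (simp add: orthonormal_colsD[OF W])
  also have "\<dots> = (\<Sum>p<n. if p = r then (\<Sum>q<n. if q = s then a p q else 0) else 0)"
    by (intro sum.cong refl) simp
  also have "\<dots> = a r s" using rs by simp
  finally show ?thesis .
qed

text \<open>Deflation: complete an eigenvector to an orthonormal basis \<open>W\<close>. In this
  basis the first column of the matrix vanishes below its head, by Hermiticity so does the first
  row, and the induction hypothesis diagonalises the remaining block \<open>A3\<close>. The
  eigenvectors are the rows of \<open>u\<close>.\<close>

theorem hermitian_spectral:
  assumes "A \<in> carrier_mat n n" and "\<And>r s. r < n \<Longrightarrow> s < n \<Longrightarrow> A $$ (s, r) = cnj (A $$ (r, s))"
  shows "\<exists>(\<mu> :: nat \<Rightarrow> real) u. orthonormal n u \<and>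
    (\<forall>r<n. \<forall>s<n. A $$ (r, s) = (\<Sum>i<n. of_real (\<mu> i) * u i r * cnj (u i s)))"
  using assms
proof (induction n arbitrary: A)
  case 0
  then show ?case by (simp add: orthonormal_def)
next
  case (Suc n)
  let ?n = "Suc n"
  note A = Suc.prems(1) and herm = Suc.prems(2)
  obtain as where as: "char_poly A = (\<Prod>a\<leftarrow>as. [:- a, 1:])" "length as = ?n"
    using char_poly_factorized[OF A] by auto
  then obtain e as' where "as = e # as'" by (cases as) auto
  then have "poly (char_poly A) e = 0" using as by simp
  then have "eigenvalue A e" using eigenvalue_root_char_poly[OF A] by simp
  then obtain v where v: "v \<in> carrier_vec ?n" "v \<noteq> 0\<^sub>v ?n" "A *\<^sub>v v = e \<cdot>\<^sub>v v"
    using A by (auto simp: eigenvalue_def eigenvector_def)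
  obtain W c where W: "orthonormal ?n W" and W0: "\<And>r. r < ?n \<Longrightarrow> W 0 r = c * v $ r"
    by (rule orthonormal_completion[OF v(1,2)]) blast
  have AW: "(\<Sum>s<?n. A $$ (r, s) * W 0 s) = e * W 0 r" if "r < ?n" for r
  proof -
    have "(\<Sum>s<?n. A $$ (r, s) * W 0 s) = c * (\<Sum>s<?n. A $$ (r, s) * v $ s)"
      unfolding sum_distrib_left by (intro sum.cong refl) (simp add: W0)
    also have "\<dots> = c * (e * v $ r)"
      using mult_mat_vec_sum[OF A v(1) that] v that by simp
    finally show ?thesis using W0[OF that] by simp
  qed
  define A' where "A' = (\<lambda>i j. \<Sum>p<?n. \<Sum>q<?n. cnj (W i p) * A $$ (p, q) * W j q)"
  have A'herm: "A' j i = cnj (A' i j)" for i j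
  proof -
    have "cnj (A' i j) = (\<Sum>p<?n. \<Sum>q<?n. cnj (W j q) * cnj (A $$ (p, q)) * W i p)"
      unfolding A'_def cnj_sum by (intro sum.cong refl) (simp add: mult_ac)
    also have "\<dots> = (\<Sum>p<?n. \<Sum>q<?n. cnj (W j q) * A $$ (q, p) * W i p)"
    proof (intro sum.cong refl)
      fix p q assume "p \<in> {..<?n}" "q \<in> {..<?n}"
      then have "cnj (A $$ (p, q)) = A $$ (q, p)" using herm[of p q] by simp
      then show "cnj (W j q) * cnj (A $$ (p, q)) * W i p = cnj (W j q) * A $$ (q, p) * W i p" by simp
    qed
    also have "\<dots> = A' j i" unfolding A'_def by (rule sum.swap)
    finally show ?thesis by (rule sym)
  qed
  have A'0: "A' i 0 = (if i = 0 then e else 0)" if "i < ?n" for i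
  proof -
    have "A' i 0 = (\<Sum>p<?n. cnj (W i p) * (\<Sum>q<?n. A $$ (p, q) * W 0 q))"
      unfolding A'_def sum_distrib_left by (simp only: mult.assoc)
    also have "\<dots> = e * (\<Sum>p<?n. W 0 p * cnj (W i p))"
      unfolding sum_distrib_left[where r = e] by (intro sum.cong refl) (simp add: AW del: sum.lessThan_Suc)
    also have "\<dots> = (if i = 0 then e else 0)"
      using orthonormal_rowsD[OF W, of 0 i] that by simp
    finally show ?thesis .
  qed
  have A'00: "A' 0 0 = e" using A'0[of 0] by simp
  have "Im e = Im (cnj e)" using A'herm[where i = 0 and j = 0] unfolding A'00 by (rule arg_cong)
  then have "Im e = 0" by simp
  then have er: "e = of_real (Re e)" by (simp add: complex_eq_iff)
  have A'0': "A' 0 (Suc j) = 0" if "j < n" for j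
    by (subst A'herm) (use A'0[of "Suc j"] that in simp)
  define A3 where "A3 = mat n n (\<lambda>(i, j). A' (Suc i) (Suc j))"
  obtain \<mu> :: "nat \<Rightarrow> real" and u where u: "orthonormal n u"
    and lu: "\<And>r s. r < n \<Longrightarrow> s < n \<Longrightarrow> A3 $$ (r, s) = (\<Sum>i<n. of_real (\<mu> i) * u i r * cnj (u i s))"
  proof -
    have "A3 $$ (s, r) = cnj (A3 $$ (r, s))" if "r < n" "s < n" for r s
      using that A'herm[where i = "Suc r" and j = "Suc s"] by (simp add: A3_def)
    moreover have "A3 \<in> carrier_mat n n" by (simp add: A3_def)
    ultimately show ?thesis using that Suc.IH[of A3] by blast
  qed
  define U where "U = (\<lambda>k r. case k of 0 \<Rightarrow> W 0 r | Suc i \<Rightarrow> (\<Sum>j<n. u i j * W (Suc j) r))"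
  define L where "L = (\<lambda>k. case k of 0 \<Rightarrow> Re e | Suc i \<Rightarrow> \<mu> i)"
  have "orthonormal ?n U"
  proof (rule orthonormalI_rows)
    fix x y assume xy: "x < ?n" "y < ?n"
    have 00: "(\<Sum>r<?n. U 0 r * cnj (U 0 r)) = 1" using orthonormal_rowsD[OF W, of 0 0] by (simp add: U_def)
    have 01: "(\<Sum>r<?n. U 0 r * cnj (U (Suc i) r)) = 0" for i
    proof -
      have "(\<Sum>r<?n. U 0 r * cnj (U (Suc i) r)) = (\<Sum>r<?n. \<Sum>j<n. cnj (u i j) * (W 0 r * cnj (W (Suc j) r)))"
        by (simp add: U_def sum_distrib_left mult_ac del: sum.lessThan_Suc)
      also have "\<dots> = (\<Sum>j<n. cnj (u i j) * (\<Sum>r<?n. W 0 r * cnj (W (Suc j) r)))"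
        by (subst sum.swap) (simp only: sum_distrib_left)
      also have "\<dots> = 0"
        by (intro sum.neutral ballI) (subst orthonormal_rowsD[OF W], auto)
      finally show ?thesis .
    qed
    have 10: "(\<Sum>r<?n. U (Suc i) r * cnj (U 0 r)) = 0" for i
      using arg_cong[OF 01[of i], of cnj] by (simp add: cnj_sum mult.commute del: sum.lessThan_Suc)
    have 11: "(\<Sum>r<?n. U (Suc i) r * cnj (U (Suc j) r)) = (if i = j then 1 else 0)" if "i < n" "j < n" for i j
    proof -
      have "(\<Sum>r<?n. U (Suc i) r * cnj (U (Suc j) r)) =
        (\<Sum>r<?n. \<Sum>k<n. \<Sum>l<n. u i k * cnj (u j l) * (W (Suc k) r * cnj (W (Suc l) r)))"
        unfolding U_def nat.case cnj_sum sum_product by (intro sum.cong refl) simp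
      also have "\<dots> = (\<Sum>k<n. \<Sum>l<n. u i k * cnj (u j l) * (\<Sum>r<?n. W (Suc k) r * cnj (W (Suc l) r)))"
        unfolding sum_distrib_left by (rule sum_swap3)
      also have "\<dots> = (\<Sum>k<n. \<Sum>l<n. if l = k then u i k * cnj (u j l) else 0)"
        by (intro sum.cong refl) (subst orthonormal_rowsD[OF W], auto)
      also have "\<dots> = (\<Sum>k<n. u i k * cnj (u j k))" by simp
      also have "\<dots> = (if i = j then 1 else 0)" using orthonormal_rowsD[OF u that] .
      finally show ?thesis .
    qed
    show "(\<Sum>r<?n. U x r * cnj (U y r)) = (if x = y then 1 else 0)"
      using xy by (cases x; cases y) (auto simp: 00 01 10 11 simp del: sum.lessThan_Suc)
  qed
  moreover have "A $$ (r, s) = (\<Sum>k<?n. of_real (L k) * U k r * cnj (U k s))" if rs: "r < ?n" "s < ?n" for r s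
  proof -
    have "A $$ (r, s) = (\<Sum>i<?n. \<Sum>j<?n. W i r * A' i j * cnj (W j s))"
      using sum_change_basis[OF W rs, of "\<lambda>p q. A $$ (p, q)"] unfolding A'_def by simp
    also have "\<dots> = e * W 0 r * cnj (W 0 s) + (\<Sum>i<n. \<Sum>j<n. W (Suc i) r * A' (Suc i) (Suc j) * cnj (W (Suc j) s))"
      unfolding sum.lessThan_Suc_shift by (simp add: A'0 A'0')
    finally have 1: "A $$ (r, s) = e * W 0 r * cnj (W 0 s) + (\<Sum>i<n. \<Sum>j<n. W (Suc i) r * A' (Suc i) (Suc j) * cnj (W (Suc j) s))" .
    have "(\<Sum>i<n. \<Sum>j<n. W (Suc i) r * A' (Suc i) (Suc j) * cnj (W (Suc j) s))
      = (\<Sum>i<n. \<Sum>j<n. \<Sum>k<n. of_real (\<mu> k) * (u k i * W (Suc i) r) * cnj (u k j * W (Suc j) s))"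
    proof (intro sum.cong refl)
      fix i j assume "i \<in> {..<n}" "j \<in> {..<n}"
      then have ij: "i < n" "j < n" by auto
      have "A3 $$ (i, j) = A' (Suc i) (Suc j)" using ij unfolding A3_def by simp
      then have *: "A' (Suc i) (Suc j) = (\<Sum>k<n. of_real (\<mu> k) * u k i * cnj (u k j))"
        using lu[OF ij] by simp
      show "W (Suc i) r * A' (Suc i) (Suc j) * cnj (W (Suc j) s) =
          (\<Sum>k<n. of_real (\<mu> k) * (u k i * W (Suc i) r) * cnj (u k j * W (Suc j) s))"
        unfolding * sum_distrib_left sum_distrib_right
        by (intro sum.cong refl) (simp add: mult_ac)
    qed
    also have "\<dots> = (\<Sum>k<n. \<Sum>i<n. \<Sum>j<n. of_real (\<mu> k) * (u k i * W (Suc i) r) * cnj (u k j * W (Suc j) s))"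
      by (rule sum_swap3[symmetric])
    also have "\<dots> = (\<Sum>k<n. of_real (\<mu> k) * U (Suc k) r * cnj (U (Suc k) s))"
      unfolding U_def nat.case cnj_sum mult.assoc sum_product
      by (simp add: sum_distrib_left mult.assoc)
    finally have 2: "(\<Sum>i<n. \<Sum>j<n. W (Suc i) r * A' (Suc i) (Suc j) * cnj (W (Suc j) s))
      = (\<Sum>k<n. of_real (\<mu> k) * U (Suc k) r * cnj (U (Suc k) s))" .
    have 3: "e * W 0 r * cnj (W 0 s) = of_real (L 0) * U 0 r * cnj (U 0 s)"
      using er by (simp add: L_def U_def)
    show ?thesis
      unfolding sum.lessThan_Suc_shift 1 2 3 by (simp add: L_def)
  qed
  ultimately show ?case by blast
qed

section \<open>Quadratic forms and decompositions into rank-one terms\<close>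

definition qform :: "nat \<Rightarrow> (nat \<Rightarrow> nat \<Rightarrow> complex) \<Rightarrow> (nat \<Rightarrow> complex) \<Rightarrow> complex" where
  "qform n A v = (\<Sum>r<n. \<Sum>s<n. cnj (v r) * A r s * v s)"

lemma qform_cong:
  assumes "\<And>r s. r < n \<Longrightarrow> s < n \<Longrightarrow> A r s = B r s" "\<And>r. r < n \<Longrightarrow> v r = w r"
  shows "qform n A v = qform n B w"
  unfolding qform_def using assms by (intro sum.cong refl) simp

lemma coeff_sq_expand:
  "of_real (coeff_sq n w v j) = (\<Sum>r<n. \<Sum>s<n. cnj (v r) * (w j r * cnj (w j s)) * v s)"
proof -
  have "of_real (coeff_sq n w v j) = (\<Sum>s<n. cnj (w j s) * v s) * cnj (\<Sum>r<n. cnj (w j r) * v r)"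
    unfolding coeff_sq_def by (rule complex_norm_square)
  also have "\<dots> = (\<Sum>r<n. cnj (cnj (w j r) * v r)) * (\<Sum>s<n. cnj (w j s) * v s)"
    by (simp only: cnj_sum mult.commute)
  also have "\<dots> = (\<Sum>r<n. \<Sum>s<n. cnj (v r) * (w j r * cnj (w j s)) * v s)"
    unfolding sum_product by (intro sum.cong refl) simp
  finally show ?thesis .
qed

lemma coeff_sq_nonneg [simp]: "coeff_sq n w v j \<ge> 0"
  by (simp add: coeff_sq_def)

text \<open>Arbitrary weights and an arbitrary index set let one statement serve spectral
  decompositions, where \<open>c\<close> are the eigenvalues, and sums of rank-one operators with
  weight 1, including those over a product set that arise from a partial trace.\<close>

lemma qform_gram:
  assumes "\<And>r s. r < n \<Longrightarrow> s < n \<Longrightarrow> A r s = (\<Sum>j\<in>J. of_real (c j) * w j r * cnj (w j s))"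
  shows "qform n A v = of_real (\<Sum>j\<in>J. c j * coeff_sq n w v j)"
proof -
  have "qform n A v = (\<Sum>r<n. \<Sum>s<n. \<Sum>j\<in>J. of_real (c j) * (cnj (v r) * (w j r * cnj (w j s)) * v s))"
    unfolding qform_def using assms
    by (intro sum.cong refl) (simp add: sum_distrib_left sum_distrib_right mult_ac)
  also have "\<dots> = (\<Sum>j\<in>J. \<Sum>r<n. \<Sum>s<n. of_real (c j) * (cnj (v r) * (w j r * cnj (w j s)) * v s))"
    by (rule sym, rule sum_swap3)
  also have "\<dots> = (\<Sum>j\<in>J. of_real (c j) * of_real (coeff_sq n w v j))"
    unfolding coeff_sq_expand sum_distrib_left ..
  finally show ?thesis by simp
qed

lemma trace_gram:
  assumes "\<And>r s. r < n \<Longrightarrow> s < n \<Longrightarrow> A r s = (\<Sum>j\<in>J. of_real (c j) * w j r * cnj (w j s))"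
  shows "(\<Sum>r<n. \<Sum>s<n. A r s * B s r) = (\<Sum>j\<in>J. of_real (c j) * qform n B (w j))"
proof -
  have "(\<Sum>r<n. \<Sum>s<n. A r s * B s r) = (\<Sum>r<n. \<Sum>s<n. \<Sum>j\<in>J. of_real (c j) * (cnj (w j s) * B s r * w j r))"
    using assms by (intro sum.cong refl) (simp add: sum_distrib_left sum_distrib_right mult_ac)
  also have "\<dots> = (\<Sum>j\<in>J. \<Sum>r<n. \<Sum>s<n. of_real (c j) * (cnj (w j s) * B s r * w j r))"
    by (rule sym, rule sum_swap3)
  also have "\<dots> = (\<Sum>j\<in>J. of_real (c j) * qform n B (w j))"
    unfolding qform_def sum_distrib_left by (rule sum.cong[OF refl], rule sum.swap)
  finally show ?thesis .
qed

text \<open>With vectors as plain functions no carrier condition on \<open>v\<close> has to be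
  carried along; entries beyond \<open>n\<close> do not enter the form.\<close>

lemma psd_iff_qform:
  "psd n M \<longleftrightarrow> M \<in> carrier_mat n n \<and> (\<forall>v. 0 \<le> qform n (\<lambda>r s. M $$ (r, s)) v)"
proof -
  have q: "(M *\<^sub>v v) \<bullet>c v = qform n (\<lambda>r s. M $$ (r, s)) (\<lambda>r. v $ r)"
    if "M \<in> carrier_mat n n" "v \<in> carrier_vec n" for v
  proof -
    have "(M *\<^sub>v v) \<bullet>c v = (\<Sum>r<n. (M *\<^sub>v v) $ r * cnj (v $ r))"
      using that by (intro cscalar_prod_sum) auto
    also have "\<dots> = qform n (\<lambda>r s. M $$ (r, s)) (\<lambda>r. v $ r)"
      unfolding qform_def
    proof (intro sum.cong refl)
      fix r assume "r \<in> {..<n}"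
      then have "(M *\<^sub>v v) $ r = (\<Sum>s<n. M $$ (r, s) * v $ s)" using mult_mat_vec_sum[OF that] by simp
      then show "(M *\<^sub>v v) $ r * cnj (v $ r) = (\<Sum>s<n. cnj (v $ r) * M $$ (r, s) * v $ s)"
        unfolding sum_distrib_right by (simp only: sum_distrib_right) (intro sum.cong refl, simp only: mult_ac)
    qed
    finally show ?thesis .
  qed
  have "0 \<le> qform n (\<lambda>r s. M $$ (r, s)) v"
    if "M \<in> carrier_mat n n" "\<forall>v\<in>carrier_vec n. 0 \<le> (M *\<^sub>v v) \<bullet>c v" for v :: "nat \<Rightarrow> complex"
  proof -
    have "qform n (\<lambda>r s. M $$ (r, s)) v = qform n (\<lambda>r s. M $$ (r, s)) (\<lambda>r. vec n v $ r)"
      by (intro qform_cong) auto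
    also have "\<dots> = (M *\<^sub>v vec n v) \<bullet>c vec n v" using q[OF that(1), of "vec n v"] by simp
    finally show ?thesis using that(2) by simp
  qed
  moreover have "0 \<le> (M *\<^sub>v v) \<bullet>c v"
    if "M \<in> carrier_mat n n" "\<forall>v. 0 \<le> qform n (\<lambda>r s. M $$ (r, s)) v" "v \<in> carrier_vec n" for v
    unfolding q[OF that(1,3)] using that(2) by blast
  ultimately show ?thesis unfolding psd_def by blast
qed

lemma psd_gramI:
  assumes "M \<in> carrier_mat n n" and "\<And>j. j \<in> J \<Longrightarrow> 0 \<le> c j"
    and "\<And>r s. r < n \<Longrightarrow> s < n \<Longrightarrow> M $$ (r, s) = (\<Sum>j\<in>J. of_real (c j) * w j r * cnj (w j s))"
  shows "psd n M"
proof -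
  have "0 \<le> qform n (\<lambda>r s. M $$ (r, s)) v" for v
  proof -
    have "qform n (\<lambda>r s. M $$ (r, s)) v = of_real (\<Sum>j\<in>J. c j * coeff_sq n w v j)"
      using assms(3) by (rule qform_gram)
    moreover have "0 \<le> (\<Sum>j\<in>J. c j * coeff_sq n w v j)"
      using assms(2) by (intro sum_nonneg mult_nonneg_nonneg) auto
    ultimately show ?thesis by (simp add: less_eq_complex_def)
  qed
  with assms(1) show ?thesis by (simp add: psd_iff_qform)
qed

lemma psd_hermitian:
  assumes M: "psd n M" and rs: "r < n" "s < n"
  shows "M $$ (s, r) = cnj (M $$ (r, s))"
proof (cases "r = s")
  case True
  define v where "v = (\<lambda>k. if k = r then 1 else (0 :: complex))"
  have "qform n (\<lambda>r s. M $$ (r, s)) v = (\<Sum>k<n. \<Sum>l\<in>{r}. cnj (v k) * M $$ (k, l) * v l)"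
    unfolding qform_def using rs
    by (intro sum.cong refl sum.mono_neutral_right) (auto simp: v_def)
  also have "\<dots> = (\<Sum>k\<in>{r}. \<Sum>l\<in>{r}. cnj (v k) * M $$ (k, l) * v l)"
    using rs by (intro sum.mono_neutral_right) (auto simp: v_def)
  also have "\<dots> = M $$ (r, r)" by (simp add: v_def)
  finally have "0 \<le> M $$ (r, r)" using M by (metis psd_iff_qform)
  then show ?thesis using True by (simp add: less_eq_complex_def complex_eq_iff)
next
  case False
  have q: "qform n (\<lambda>r s. M $$ (r, s)) (\<lambda>k. if k = r then x else if k = s then y else 0) =
    cnj x * M $$ (r, r) * x + cnj x * M $$ (r, s) * y + (cnj y * M $$ (s, r) * x + cnj y * M $$ (s, s) * y)" for x y
  proof -
    define v where "v = (\<lambda>k. if k = r then x else if k = s then y else (0 :: complex))"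
    have "qform n (\<lambda>r s. M $$ (r, s)) v = (\<Sum>k<n. \<Sum>l\<in>{r, s}. cnj (v k) * M $$ (k, l) * v l)"
      unfolding qform_def using rs
      by (intro sum.cong refl sum.mono_neutral_right) (auto simp: v_def)
    also have "\<dots> = (\<Sum>k\<in>{r, s}. \<Sum>l\<in>{r, s}. cnj (v k) * M $$ (k, l) * v l)"
      using rs by (intro sum.mono_neutral_right) (auto simp: v_def)
    finally show ?thesis using False by (simp add: v_def)
  qed
  have im: "Im (qform n (\<lambda>r s. M $$ (r, s)) v) = 0" for v
  proof -
    have "0 \<le> qform n (\<lambda>r s. M $$ (r, s)) v" using M unfolding psd_iff_qform by blast
    then show ?thesis by (simp add: less_eq_complex_def)
  qed
  have d: "Im (M $$ (r, r)) = 0" "Im (M $$ (s, s)) = 0"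
    using im[of "\<lambda>k. if k = r then 1 else if k = s then 0 else 0"]
      im[of "\<lambda>k. if k = r then 0 else if k = s then 1 else 0"] unfolding q by simp_all
  \<comment> \<open>Polarisation: the form is real at the sum of the two unit vectors, which relates
    the imaginary parts, and at the first plus \<i> times the second, which relates the real
    parts.\<close>
  have "Im (M $$ (r, s)) + Im (M $$ (s, r)) = 0"
    using im[of "\<lambda>k. if k = r then 1 else if k = s then 1 else 0"] d unfolding q by simp
  moreover have "Re (M $$ (r, s)) = Re (M $$ (s, r))"
    using im[of "\<lambda>k. if k = r then 1 else if k = s then \<i> else 0"] d unfolding q by simp
  ultimately show ?thesis by (simp add: complex_eq_iff)
qed

lemma coeff_sq_orthonormal:
  assumes "orthonormal n u" "i < n" "j < n"
  shows "coeff_sq n u (u i) j = (if i = j then 1 else 0)"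
proof -
  have "(\<Sum>r<n. cnj (u j r) * u i r) = (if i = j then 1 else 0)"
    using orthonormal_rowsD[OF assms] by (simp add: mult.commute)
  then show ?thesis by (simp add: coeff_sq_def)
qed

lemma psd_spectral:
  assumes M: "psd n M"
  obtains \<mu> :: "nat \<Rightarrow> real" and u where "orthonormal n u" "\<And>i. i < n \<Longrightarrow> \<mu> i \<ge> 0"
    "\<And>r s. r < n \<Longrightarrow> s < n \<Longrightarrow> M $$ (r, s) = (\<Sum>i<n. of_real (\<mu> i) * u i r * cnj (u i s))"
proof -
  have M': "M \<in> carrier_mat n n" using M by (simp add: psd_def)
  obtain \<mu> :: "nat \<Rightarrow> real" and u where u: "orthonormal n u"
    and Mu: "\<forall>r<n. \<forall>s<n. M $$ (r, s) = (\<Sum>i<n. of_real (\<mu> i) * u i r * cnj (u i s))"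
    using hermitian_spectral[OF M' psd_hermitian[OF M]] by blast
  have "\<mu> i \<ge> 0" if "i < n" for i
  proof -
    have "qform n (\<lambda>r s. M $$ (r, s)) (u i) = of_real (\<Sum>j<n. \<mu> j * coeff_sq n u (u i) j)"
      using Mu by (intro qform_gram) auto
    also have "(\<Sum>j<n. \<mu> j * coeff_sq n u (u i) j) = (\<Sum>j<n. if i = j then \<mu> j else 0)"
      using coeff_sq_orthonormal[OF u that] by (intro sum.cong refl) simp
    also have "\<dots> = \<mu> i" using that by simp
    finally have "0 \<le> complex_of_real (\<mu> i)" using M by (metis psd_iff_qform)
    then show ?thesis by (simp add: less_eq_complex_def)
  qed
  with u Mu show ?thesis using that by blast
qed

text \<open>The square roots of the eigenvalues are absorbed into the vectors. The factor
  \<open>of_real 1\<close> keeps the shape in which \<open>qform_gram\<close> and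
  \<open>trace_gram\<close> expect a decomposition.\<close>

lemma psd_gram:
  assumes M: "psd n M"
  obtains w :: "nat \<Rightarrow> nat \<Rightarrow> complex" where
    "\<And>r s. r < n \<Longrightarrow> s < n \<Longrightarrow> M $$ (r, s) = (\<Sum>j<n. of_real 1 * w j r * cnj (w j s))"
proof -
  obtain \<mu> :: "nat \<Rightarrow> real" and u where u: "orthonormal n u" "\<And>i. i < n \<Longrightarrow> \<mu> i \<ge> 0"
    "\<And>r s. r < n \<Longrightarrow> s < n \<Longrightarrow> M $$ (r, s) = (\<Sum>i<n. of_real (\<mu> i) * u i r * cnj (u i s))"
    by (rule psd_spectral[OF M]) blast
  define w where "w = (\<lambda>j r. of_real (sqrt (\<mu> j)) * u j r)"
  have "M $$ (r, s) = (\<Sum>j<n. of_real 1 * w j r * cnj (w j s))" if "r < n" "s < n" for r s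
    unfolding u(3)[OF that]
  proof (intro sum.cong refl)
    fix i assume "i \<in> {..<n}"
    then have "complex_of_real (sqrt (\<mu> i)) * of_real (sqrt (\<mu> i)) = of_real (\<mu> i)"
      using u(2)[of i] unfolding of_real_mult[symmetric] by simp
    then show "of_real (\<mu> i) * u i r * cnj (u i s) = of_real 1 * w i r * cnj (w i s)"
      by (simp add: w_def mult_ac)
  qed
  then show ?thesis using that by blast
qed

lemma mat_trace_mult:
  assumes "A \<in> carrier_mat n n" "B \<in> carrier_mat n n"
  shows "mat_trace (A * B) = (\<Sum>r<n. \<Sum>s<n. A $$ (r, s) * B $$ (s, r))"
  using assms by (simp add: mat_trace_def scalar_prod_def lessThan_atLeast0)

lemma mat_trace_eq: "A \<in> carrier_mat n n \<Longrightarrow> mat_trace A = (\<Sum>r<n. A $$ (r, r))"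
  by (auto simp: mat_trace_def)

section \<open>Square roots and the trace norm\<close>

definition spectral :: "nat \<Rightarrow> (nat \<Rightarrow> real) \<Rightarrow> (nat \<Rightarrow> nat \<Rightarrow> complex) \<Rightarrow> complex mat" where
  "spectral n \<mu> u = mat n n (\<lambda>(r, s). \<Sum>i<n. of_real (\<mu> i) * u i r * cnj (u i s))"

lemma spectral_carrier [simp]: "spectral n \<mu> u \<in> carrier_mat n n"
  by (simp add: spectral_def)

lemma spectral_index:
  "r < n \<Longrightarrow> s < n \<Longrightarrow> spectral n \<mu> u $$ (r, s) = (\<Sum>i<n. of_real (\<mu> i) * u i r * cnj (u i s))"
  by (simp add: spectral_def)

lemma spectral_left:
  assumes u: "orthonormal n u" and "k < n" "s < n"
  shows "(\<Sum>r<n. cnj (u k r) * spectral n \<mu> u $$ (r, s)) = of_real (\<mu> k) * cnj (u k s)"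
proof -
  have "(\<Sum>r<n. cnj (u k r) * spectral n \<mu> u $$ (r, s))
    = (\<Sum>r<n. \<Sum>i<n. of_real (\<mu> i) * cnj (u i s) * (u i r * cnj (u k r)))"
    using assms by (intro sum.cong refl) (simp add: spectral_index sum_distrib_left mult_ac)
  also have "\<dots> = (\<Sum>i<n. of_real (\<mu> i) * cnj (u i s) * (\<Sum>r<n. u i r * cnj (u k r)))"
    unfolding sum_distrib_left by (rule sum.swap)
  also have "\<dots> = (\<Sum>i<n. if i = k then of_real (\<mu> i) * cnj (u i s) else 0)"
    using assms by (intro sum.cong refl) (simp add: orthonormal_rowsD[OF u])
  also have "\<dots> = of_real (\<mu> k) * cnj (u k s)" using assms by simp
  finally show ?thesis .
qed

lemma spectral_mult:
  assumes u: "orthonormal n u"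
  shows "spectral n \<mu> u * spectral n \<nu> u = spectral n (\<lambda>i. \<mu> i * \<nu> i) u"
proof (rule eq_matI)
  fix r s assume "r < dim_row (spectral n (\<lambda>i. \<mu> i * \<nu> i) u)" "s < dim_col (spectral n (\<lambda>i. \<mu> i * \<nu> i) u)"
  then have rs: "r < n" "s < n" by (auto simp: spectral_def)
  have "(spectral n \<mu> u * spectral n \<nu> u) $$ (r, s)
      = (\<Sum>t<n. (\<Sum>i<n. of_real (\<mu> i) * u i r * cnj (u i t)) * spectral n \<nu> u $$ (t, s))"
    using rs by (simp add: spectral_def scalar_prod_def lessThan_atLeast0)
  also have "\<dots> = (\<Sum>i<n. of_real (\<mu> i) * u i r * (\<Sum>t<n. cnj (u i t) * spectral n \<nu> u $$ (t, s)))"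
    unfolding sum_distrib_left sum_distrib_right by (subst sum.swap) (simp only: mult.assoc)
  also have "\<dots> = (\<Sum>i<n. of_real (\<mu> i * \<nu> i) * u i r * cnj (u i s))"
    using rs by (intro sum.cong refl) (simp add: spectral_left[OF u])
  finally show "(spectral n \<mu> u * spectral n \<nu> u) $$ (r, s) = spectral n (\<lambda>i. \<mu> i * \<nu> i) u $$ (r, s)"
    using rs by (simp add: spectral_index)
qed (auto simp: spectral_def)

text \<open>Evaluate the common square between an eigenvector \<open>u k\<close> and an eigenvector
  \<open>w l\<close> with inner product \<open>c k l\<close>: either \<open>c k l\<close> is 0 or
  the squares of the eigenvalues agree, and then so do the nonnegative eigenvalues. Hence
  multiplying \<open>c k l\<close> by either eigenvalue gives the same, and expanding in both bases
  identifies the two matrices.\<close>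

lemma spectral_sqrt_unique:
  assumes u: "orthonormal n u" and w: "orthonormal n w"
    and nonneg: "\<And>i. i < n \<Longrightarrow> \<mu> i \<ge> 0" "\<And>i. i < n \<Longrightarrow> \<nu> i \<ge> 0"
    and eq: "spectral n (\<lambda>i. \<mu> i * \<mu> i) u = spectral n (\<lambda>i. \<nu> i * \<nu> i) w"
  shows "spectral n \<mu> u = spectral n \<nu> w"
proof (rule eq_matI)
  define c where "c = (\<lambda>k l. \<Sum>r<n. cnj (u k r) * w l r)"
  have c: "of_real (\<mu> k) * c k l = of_real (\<nu> l) * c k l" if kl: "k < n" "l < n" for k l
  proof -
    have "(\<Sum>s<n. (\<Sum>r<n. cnj (u k r) * spectral n (\<lambda>i. \<mu> i * \<mu> i) u $$ (r, s)) * w l s)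
      = of_real (\<mu> k * \<mu> k) * c k l"
      unfolding c_def sum_distrib_left using kl
      by (intro sum.cong refl) (simp add: spectral_left[OF u] mult_ac)
    moreover have "(\<Sum>s<n. (\<Sum>r<n. cnj (u k r) * spectral n (\<lambda>i. \<nu> i * \<nu> i) w $$ (r, s)) * w l s)
      = of_real (\<nu> l * \<nu> l) * c k l"
    proof -
      have sw: "(\<Sum>s<n. spectral n (\<lambda>i. \<nu> i * \<nu> i) w $$ (r, s) * w l s) = of_real (\<nu> l * \<nu> l) * w l r"
        if r: "r < n" for r
      proof -
        have "(\<Sum>s<n. spectral n (\<lambda>i. \<nu> i * \<nu> i) w $$ (r, s) * w l s)
          = (\<Sum>s<n. \<Sum>i<n. of_real (\<nu> i * \<nu> i) * w i r * (w l s * cnj (w i s)))"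
          using r by (intro sum.cong refl) (simp add: spectral_index sum_distrib_right sum_distrib_left mult_ac)
        also have "\<dots> = (\<Sum>i<n. of_real (\<nu> i * \<nu> i) * w i r * (\<Sum>s<n. w l s * cnj (w i s)))"
          unfolding sum_distrib_left by (rule sum.swap)
        also have "\<dots> = (\<Sum>i<n. if l = i then of_real (\<nu> i * \<nu> i) * w i r else 0)"
          using kl by (intro sum.cong refl) (simp add: orthonormal_rowsD[OF w])
        also have "\<dots> = of_real (\<nu> l * \<nu> l) * w l r" using kl by simp
        finally show ?thesis .
      qed
      have "(\<Sum>s<n. (\<Sum>r<n. cnj (u k r) * spectral n (\<lambda>i. \<nu> i * \<nu> i) w $$ (r, s)) * w l s)
        = (\<Sum>r<n. cnj (u k r) * (\<Sum>s<n. spectral n (\<lambda>i. \<nu> i * \<nu> i) w $$ (r, s) * w l s))"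
        unfolding sum_distrib_left sum_distrib_right by (subst sum.swap) (simp only: mult.assoc)
      also have "\<dots> = (\<Sum>r<n. cnj (u k r) * (of_real (\<nu> l * \<nu> l) * w l r))"
        by (intro sum.cong refl) (simp only: sw lessThan_iff)
      also have "\<dots> = of_real (\<nu> l * \<nu> l) * c k l"
        unfolding c_def sum_distrib_left by (intro sum.cong refl) (simp only: mult_ac)
      finally show ?thesis .
    qed
    ultimately have "of_real (\<mu> k * \<mu> k) * c k l = of_real (\<nu> l * \<nu> l) * c k l" by (simp only: eq)
    then have "c k l = 0 \<or> \<mu> k * \<mu> k = \<nu> l * \<nu> l" by (simp only: mult_cancel_right of_real_eq_iff)
    then have "c k l = 0 \<or> \<mu> k = \<nu> l"
      using power2_eq_iff_nonneg[OF nonneg(1)[OF kl(1)] nonneg(2)[OF kl(2)]]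
      by (auto simp: power2_eq_square)
    then show ?thesis by auto
  qed
  fix r s assume "r < dim_row (spectral n \<nu> w)" "s < dim_col (spectral n \<nu> w)"
  then have rs: "r < n" "s < n" by (auto simp: spectral_def)
  have us: "cnj (u k s) = (\<Sum>l<n. c k l * cnj (w l s))" for k
  proof -
    have "(\<Sum>l<n. c k l * cnj (w l s)) = (\<Sum>t<n. cnj (u k t) * (\<Sum>l<n. w l t * cnj (w l s)))"
      unfolding c_def sum_distrib_left sum_distrib_right by (subst sum.swap) (simp only: mult.assoc)
    also have "\<dots> = (\<Sum>t<n. if t = s then cnj (u k t) else 0)"
      using rs by (intro sum.cong refl) (simp add: orthonormal_colsD[OF w])
    finally show ?thesis using rs by simp
  qed
  have wr: "w l r = (\<Sum>k<n. u k r * c k l)" for l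
  proof -
    have "(\<Sum>k<n. u k r * c k l) = (\<Sum>t<n. (\<Sum>k<n. u k r * cnj (u k t)) * w l t)"
      unfolding c_def sum_distrib_left sum_distrib_right by (subst sum.swap) (simp only: mult.assoc)
    also have "\<dots> = (\<Sum>t<n. if r = t then w l t else 0)"
      using rs by (intro sum.cong refl) (simp add: orthonormal_colsD[OF u])
    finally show ?thesis using rs by simp
  qed
  have "spectral n \<mu> u $$ (r, s) = (\<Sum>k<n. \<Sum>l<n. u k r * (of_real (\<mu> k) * c k l) * cnj (w l s))"
    using rs by (simp add: spectral_index us sum_distrib_left mult_ac)
  also have "\<dots> = (\<Sum>k<n. \<Sum>l<n. u k r * (of_real (\<nu> l) * c k l) * cnj (w l s))"
    using c by (intro sum.cong refl) simp
  also have "\<dots> = (\<Sum>l<n. of_real (\<nu> l) * (\<Sum>k<n. u k r * c k l) * cnj (w l s))"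
    unfolding sum_distrib_left sum_distrib_right by (subst sum.swap) (simp only: mult_ac)
  also have "\<dots> = spectral n \<nu> w $$ (r, s)"
    using rs by (simp add: spectral_index wr[symmetric])
  finally show "spectral n \<mu> u $$ (r, s) = spectral n \<nu> w $$ (r, s)" .
qed (auto simp: spectral_def)

lemma psd_spectral_nonneg: "(\<And>i. i < n \<Longrightarrow> \<mu> i \<ge> 0) \<Longrightarrow> psd n (spectral n \<mu> u)"
  by (rule psd_gramI[where J = "{..<n}" and c = \<mu> and w = u]) (auto simp: spectral_index)

text \<open>Any positive root of the matrix has a spectral decomposition of its own, so uniqueness
  for \<open>spectral\<close> settles the definite description in \<open>psd_sqrt\<close>.\<close>

lemma psd_sqrt_eqI:
  assumes u: "orthonormal n u" and \<mu>: "\<And>i. i < n \<Longrightarrow> \<mu> i \<ge> 0"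
  shows "psd_sqrt (spectral n (\<lambda>i. \<mu> i * \<mu> i) u) = spectral n \<mu> u"
  unfolding psd_sqrt_def
proof (rule the_equality)
  have dim: "dim_row (spectral n (\<lambda>i. \<mu> i * \<mu> i) u) = n" by (simp add: spectral_def)
  show "psd (dim_row (spectral n (\<lambda>i. \<mu> i * \<mu> i) u)) (spectral n \<mu> u) \<and>
      spectral n \<mu> u * spectral n \<mu> u = spectral n (\<lambda>i. \<mu> i * \<mu> i) u"
    unfolding dim using psd_spectral_nonneg[OF \<mu>] spectral_mult[OF u] by simp
  fix T assume T: "psd (dim_row (spectral n (\<lambda>i. \<mu> i * \<mu> i) u)) T \<and> T * T = spectral n (\<lambda>i. \<mu> i * \<mu> i) u"
  then have psdT: "psd n T" unfolding dim by blast
  obtain \<nu> w where w: "orthonormal n w" "\<And>i. i < n \<Longrightarrow> \<nu> i \<ge> (0::real)"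
    "\<And>r s. r < n \<Longrightarrow> s < n \<Longrightarrow> T $$ (r, s) = (\<Sum>i<n. of_real (\<nu> i) * w i r * cnj (w i s))"
    by (rule psd_spectral[OF psdT]) blast
  have "T \<in> carrier_mat n n" using psdT by (simp add: psd_def)
  then have Tw: "T = spectral n \<nu> w" using w(3) by (intro eq_matI) (auto simp: spectral_def)
  have "spectral n (\<lambda>i. \<nu> i * \<nu> i) w = spectral n (\<lambda>i. \<mu> i * \<mu> i) u"
    using T unfolding Tw spectral_mult[OF w(1)] by simp
  then show "T = spectral n \<mu> u"
    unfolding Tw by (intro spectral_sqrt_unique[OF w(1) u, where \<mu> = \<nu> and \<nu> = \<mu>] w(2) \<mu>)
qed

lemma mat_adjoint_index:
  assumes "A \<in> carrier_mat n m" "r < m" "s < n"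
  shows "mat_adjoint A $$ (r, s) = cnj (A $$ (s, r))"
  using assms by (simp add: mat_adjoint_def mat_of_rows_index)

lemma mat_adjoint_carrier: "A \<in> carrier_mat n m \<Longrightarrow> mat_adjoint A \<in> carrier_mat m n"
  by (auto simp: mat_adjoint_def)

lemma trace_norm_spectral:
  assumes u: "orthonormal n u"
  shows "trace_norm (spectral n \<mu> u) = (\<Sum>i<n. \<bar>\<mu> i\<bar>)"
proof -
  have "mat_adjoint (spectral n \<mu> u) = spectral n \<mu> u"
  proof (rule eq_matI)
    fix r s assume "r < dim_row (spectral n \<mu> u)" "s < dim_col (spectral n \<mu> u)"
    then have rs: "r < n" "s < n" by (auto simp: spectral_def)
    have "mat_adjoint (spectral n \<mu> u) $$ (r, s) = cnj (spectral n \<mu> u $$ (s, r))"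
      using rs by (intro mat_adjoint_index[OF spectral_carrier]) auto
    also have "\<dots> = spectral n \<mu> u $$ (r, s)"
      using rs by (simp add: spectral_index) (simp add: mult_ac)
    finally show "mat_adjoint (spectral n \<mu> u) $$ (r, s) = spectral n \<mu> u $$ (r, s)" .
  qed (use mat_adjoint_carrier[OF spectral_carrier, of n \<mu> u] in \<open>auto simp: spectral_def\<close>)
  then have "mat_adjoint (spectral n \<mu> u) * spectral n \<mu> u = spectral n (\<lambda>i. \<bar>\<mu> i\<bar> * \<bar>\<mu> i\<bar>) u"
    by (simp only: spectral_mult[OF u] abs_mult_self_eq)
  then have "trace_norm (spectral n \<mu> u) = Re (mat_trace (spectral n (\<lambda>i. \<bar>\<mu> i\<bar>) u))"
    unfolding trace_norm_def by (simp only: psd_sqrt_eqI[OF u] abs_ge_zero)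
  also have "mat_trace (spectral n (\<lambda>i. \<bar>\<mu> i\<bar>) u) = (\<Sum>r<n. \<Sum>i<n. of_real \<bar>\<mu> i\<bar> * (u i r * cnj (u i r)))"
    unfolding mat_trace_eq[OF spectral_carrier] by (intro sum.cong refl) (simp add: spectral_index mult_ac)
  also have "\<dots> = (\<Sum>i<n. of_real \<bar>\<mu> i\<bar> * (\<Sum>r<n. u i r * cnj (u i r)))"
    unfolding sum_distrib_left by (rule sum.swap)
  also have "\<dots> = of_real (\<Sum>i<n. \<bar>\<mu> i\<bar>)"
    unfolding of_real_sum by (intro sum.cong refl) (simp add: orthonormal_rowsD[OF u])
  finally show ?thesis by simp
qed

text \<open>Each eigenvalue of \<open>A\<close> enters the left-hand side with the squared norm of
  the projection of its eigenvector onto the span of the \<open>e k\<close> with k in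
  \<open>L\<close>; by Parseval this weight lies between 0 and 1.\<close>

lemma trace_norm_ge_projection:
  assumes A: "A \<in> carrier_mat n n" and herm: "\<And>r s. r < n \<Longrightarrow> s < n \<Longrightarrow> A $$ (s, r) = cnj (A $$ (r, s))"
    and e: "orthonormal n e" and L: "L \<subseteq> {..<n}"
  shows "Re (\<Sum>k\<in>L. qform n (\<lambda>r s. A $$ (r, s)) (e k)) \<le> trace_norm A"
proof -
  obtain \<mu> :: "nat \<Rightarrow> real" and u where u: "orthonormal n u"
    and Au: "\<forall>r<n. \<forall>s<n. A $$ (r, s) = (\<Sum>i<n. of_real (\<mu> i) * u i r * cnj (u i s))"
    using hermitian_spectral[OF A herm] by blast
  have "A = spectral n \<mu> u" using A Au by (intro eq_matI) (auto simp: spectral_def)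
  then have tn: "trace_norm A = (\<Sum>i<n. \<bar>\<mu> i\<bar>)" using trace_norm_spectral[OF u] by simp
  have "Re (\<Sum>k\<in>L. qform n (\<lambda>r s. A $$ (r, s)) (e k)) = (\<Sum>k\<in>L. \<Sum>i<n. \<mu> i * coeff_sq n u (e k) i)"
  proof -
    have "qform n (\<lambda>r s. A $$ (r, s)) (e k) = of_real (\<Sum>i<n. \<mu> i * coeff_sq n u (e k) i)" for k
      using Au by (intro qform_gram) auto
    then show ?thesis by simp
  qed
  also have "\<dots> = (\<Sum>i<n. \<mu> i * (\<Sum>k\<in>L. coeff_sq n u (e k) i))"
    unfolding sum_distrib_left by (rule sum.swap)
  also have "\<dots> \<le> (\<Sum>i<n. \<bar>\<mu> i\<bar> * 1)"
  proof (intro sum_mono)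
    fix i assume "i \<in> {..<n}"
    then have i: "i < n" by simp
    have "coeff_sq n u (e k) i = coeff_sq n e (u i) k" for k
    proof -
      have "(\<Sum>r<n. cnj (u i r) * e k r) = cnj (\<Sum>r<n. cnj (e k r) * u i r)"
        by (simp add: mult.commute)
      then show ?thesis unfolding coeff_sq_def by (simp only: complex_mod_cnj)
    qed
    then have "(\<Sum>k\<in>L. coeff_sq n u (e k) i) \<le> (\<Sum>k<n. coeff_sq n e (u i) k)"
      using L by (simp only:) (intro sum_mono2, auto)
    also have "\<dots> = (\<Sum>r<n. (cmod (u i r))\<^sup>2)" by (rule parseval[OF e])
    also have "\<dots> = 1"
    proof -
      have "complex_of_real (\<Sum>r<n. (cmod (u i r))\<^sup>2) = 1"
        using orthonormal_rowsD[OF u i i] by (simp add: complex_cmod_square)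
      then show ?thesis by (simp only: of_real_eq_1_iff)
    qed
    finally have le: "(\<Sum>k\<in>L. coeff_sq n u (e k) i) \<le> 1" .
    have ge: "0 \<le> (\<Sum>k\<in>L. coeff_sq n u (e k) i)" by (intro sum_nonneg) auto
    show "\<mu> i * (\<Sum>k\<in>L. coeff_sq n u (e k) i) \<le> \<bar>\<mu> i\<bar> * 1"
      using ge le by (intro mult_mono) auto
  qed
  finally show ?thesis by (simp add: tn)
qed

section \<open>Private codes\<close>

text \<open>Splitting a vector this way avoids cross terms; it is the origin of the factors 2 in
  \<open>decoder_gives_test\<close>.\<close>

lemma coeff_sq_add_le:
  "coeff_sq n w (\<lambda>r. a r + b r) j \<le> 2 * coeff_sq n w a j + 2 * coeff_sq n w b j"
proof -
  have par: "(cmod (x + y))\<^sup>2 \<le> 2 * (cmod x)\<^sup>2 + 2 * (cmod y)\<^sup>2" for x y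
  proof -
    have "(cmod (x + y))\<^sup>2 \<le> (cmod x + cmod y)\<^sup>2" by (intro power_mono norm_triangle_ineq) auto
    also have "\<dots> \<le> 2 * (cmod x)\<^sup>2 + 2 * (cmod y)\<^sup>2"
      using zero_le_power2[of "cmod x - cmod y"] by (simp add: power2_eq_square algebra_simps)
    finally show ?thesis .
  qed
  show ?thesis
    unfolding coeff_sq_def distrib_left sum.distrib by (rule par)
qed

lemma coeff_sq_cong: "(\<And>r. r < n \<Longrightarrow> v r = v' r) \<Longrightarrow> coeff_sq n w v j = coeff_sq n w v' j"
  unfolding coeff_sq_def by (intro arg_cong[where f = "\<lambda>z. (cmod z)\<^sup>2"] sum.cong refl) simp

lemma coeff_sq_swap: "coeff_sq n w (v k) j = coeff_sq n v (w j) k"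
proof -
  have "(\<Sum>r<n. cnj (w j r) * v k r) = cnj (\<Sum>r<n. cnj (v k r) * w j r)"
    by (simp add: mult.commute)
  then show ?thesis unfolding coeff_sq_def by (simp only: complex_mod_cnj)
qed

lemma orthonormal_combination_coeff:
  assumes e: "orthonormal n e" and M: "M \<subseteq> {..<n}" and l: "l < n"
  shows "(\<Sum>r<n. cnj (e l r) * (\<Sum>k\<in>M. c k * e k r)) = (if l \<in> M then c l else 0)"
proof -
  have fin: "finite M" using M finite_subset by blast
  have "(\<Sum>r<n. cnj (e l r) * (\<Sum>k\<in>M. c k * e k r)) = (\<Sum>r<n. \<Sum>k\<in>M. c k * (e k r * cnj (e l r)))"
    unfolding sum_distrib_left by (intro sum.cong refl) (simp only: mult_ac)
  also have "\<dots> = (\<Sum>k\<in>M. c k * (\<Sum>r<n. e k r * cnj (e l r)))"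
    unfolding sum_distrib_left by (rule sum.swap)
  also have "\<dots> = (\<Sum>k\<in>M. if k = l then c k else 0)"
  proof (intro sum.cong refl)
    fix k assume "k \<in> M"
    then have "k < n" using M by auto
    then show "c k * (\<Sum>r<n. e k r * cnj (e l r)) = (if k = l then c k else 0)"
      using orthonormal_rowsD[OF e _ l] by simp
  qed
  finally show ?thesis using fin by simp
qed

lemma orthonormal_expansion:
  assumes e: "orthonormal n e" and r: "r < n"
  shows "(\<Sum>k<n. (\<Sum>s<n. cnj (e k s) * v s) * e k r) = v r"
proof -
  have "(\<Sum>k<n. (\<Sum>s<n. cnj (e k s) * v s) * e k r) = (\<Sum>k<n. \<Sum>s<n. v s * (e k r * cnj (e k s)))"
    unfolding sum_distrib_right by (intro sum.cong refl) (simp only: mult_ac)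
  also have "\<dots> = (\<Sum>s<n. v s * (\<Sum>k<n. e k r * cnj (e k s)))"
    unfolding sum_distrib_left by (rule sum.swap)
  also have "\<dots> = (\<Sum>s<n. if s = r then v s else 0)"
    using r by (intro sum.cong refl) (simp add: orthonormal_colsD[OF e])
  finally show ?thesis using r by simp
qed

section \<open>Partial traces and the test extracted from a decoder\<close>

lemma trace_fst_carrier [simp]: "trace_fst a c M \<in> carrier_mat c c"
  by (simp add: trace_fst_def)

lemma trace_fst_index:
  "r < c \<Longrightarrow> s < c \<Longrightarrow> trace_fst a c M $$ (r, s) = (\<Sum>x<a. M $$ (x * c + r, x * c + s))"
  by (simp add: trace_fst_def)

lemma index_less: "x < a \<Longrightarrow> r < c \<Longrightarrow> x * c + r < a * (c :: nat)"
proof -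
  assume "x < a" "r < c"
  then have "x * c + r < Suc x * c" by simp
  also have "\<dots> \<le> a * c" using \<open>x < a\<close> by (intro mult_right_mono) auto
  finally show ?thesis .
qed

lemma trace_fst_gram:
  fixes w :: "nat \<Rightarrow> nat \<Rightarrow> complex"
  assumes M: "\<And>p q. p < a * c \<Longrightarrow> q < a * c \<Longrightarrow> M $$ (p, q) = (\<Sum>j\<in>J. of_real (1::real) * w j p * cnj (w j q))"
    and rs: "r < c" "s < c"
  shows "trace_fst a c M $$ (r, s) = (\<Sum>(x, j)\<in>{..<a} \<times> J.
    of_real (1::real) * w j (x * c + r) * cnj (w j (x * c + s)))"
proof -
  have "trace_fst a c M $$ (r, s) = (\<Sum>x<a. \<Sum>j\<in>J. of_real (1::real) * w j (x * c + r) * cnj (w j (x * c + s)))"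
    unfolding trace_fst_index[OF rs] using rs by (intro sum.cong refl M index_less) auto
  then show ?thesis by (simp add: sum.cartesian_product)
qed

lemma qform_trace_fst:
  fixes w :: "nat \<Rightarrow> nat \<Rightarrow> complex"
  assumes M: "\<And>p q. p < a * c \<Longrightarrow> q < a * c \<Longrightarrow> M $$ (p, q) = (\<Sum>j\<in>J. of_real (1::real) * w j p * cnj (w j q))"
  shows "qform c (\<lambda>r s. trace_fst a c M $$ (r, s)) u =
    of_real (\<Sum>(x, j)\<in>{..<a} \<times> J. coeff_sq c (\<lambda>(x, j) r. w j (x * c + r)) u (x, j))"
proof -
  have "trace_fst a c M $$ (r, s) = (\<Sum>i\<in>{..<a} \<times> J. of_real ((\<lambda>_. 1) i) *
      (\<lambda>(x, j) r. w j (x * c + r)) i r * cnj ((\<lambda>(x, j) r. w j (x * c + r)) i s))" if "r < c" "s < c" for r s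
  proof -
    have "trace_fst a c M $$ (r, s) = (\<Sum>(x, j)\<in>{..<a} \<times> J.
        of_real (1::real) * w j (x * c + r) * cnj (w j (x * c + s)))"
      by (rule trace_fst_gram[OF _ that]) (rule M)
    then show ?thesis by (simp add: case_prod_beta)
  qed
  then have "qform c (\<lambda>r s. trace_fst a c M $$ (r, s)) u =
    of_real (\<Sum>i\<in>{..<a} \<times> J. (\<lambda>_. 1) i * coeff_sq c (\<lambda>(x, j) r. w j (x * c + r)) u i)"
    by (rule qform_gram)
  then show ?thesis by (simp add: case_prod_beta)
qed

lemma psd_trace_fst:
  assumes "psd (a * c) M"
  shows "psd c (trace_fst a c M)"
proof -
  obtain w where w: "\<And>p q. p < a * c \<Longrightarrow> q < a * c \<Longrightarrow>
      M $$ (p, q) = (\<Sum>j<a * c. of_real 1 * w j p * cnj (w j q))"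
    by (rule psd_gram[OF assms]) blast
  show ?thesis
  proof (rule psd_gramI[where J = "{..<a} \<times> {..<a * c}" and c = "\<lambda>_. 1" and w = "\<lambda>(x, j) r. w j (x * c + r)"])
    fix r s assume rs: "r < c" "s < c"
    have "trace_fst a c M $$ (r, s) = (\<Sum>(x, j)\<in>{..<a} \<times> {..<a * c}.
        of_real 1 * w j (x * c + r) * cnj (w j (x * c + s)))"
      by (rule trace_fst_gram[OF _ rs]) (rule w)
    then show "trace_fst a c M $$ (r, s) = (\<Sum>i\<in>{..<a} \<times> {..<a * c}. of_real ((\<lambda>_. 1) i) *
        (\<lambda>(x, j) r. w j (x * c + r)) i r * cnj ((\<lambda>(x, j) r. w j (x * c + r)) i s))"
      by (simp add: case_prod_beta)
  qed auto
qed

text \<open>Discarding a system of dimension \<open>K\<close> costs a factor \<open>K\<close> in the operator order.\<close>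
lemma psd_le_trace_fst:
  fixes w :: "nat \<Rightarrow> nat \<Rightarrow> complex"
  shows "(\<Sum>j\<in>J. coeff_sq (K * B) w u j)
    \<le> real K * (\<Sum>x<K. \<Sum>(y, j)\<in>{..<K} \<times> J. coeff_sq B (\<lambda>(y, j) r. w j (y * B + r)) (\<lambda>r. u (x * B + r)) (y, j))"
proof -
  \<comment> \<open>\<open>c j y x\<close> is the inner product of slice \<open>y\<close> of
    \<open>w j\<close> with slice \<open>x\<close> of \<open>u\<close>. The left-hand side involves
    only y = x; Cauchy-Schwarz over the \<open>K\<close> slices gives the factor \<open>K\<close>,
    and the terms with y different from x are added for free.\<close>
  define c where "c = (\<lambda>j y x. \<Sum>r<B. cnj (w j (y * B + r)) * u (x * B + r))"
  have "(\<Sum>j\<in>J. coeff_sq (K * B) w u j) = (\<Sum>j\<in>J. (cmod (\<Sum>x<K. 1 * c j x x))\<^sup>2)"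
    by (simp add: coeff_sq_def sum_mult_index c_def)
  also have "\<dots> \<le> (\<Sum>j\<in>J. (\<Sum>x<K. (cmod 1)\<^sup>2) * (\<Sum>x<K. (cmod (c j x x))\<^sup>2))"
    by (intro sum_mono cmod_sum_mult_le)
  also have "\<dots> \<le> (\<Sum>j\<in>J. real K * (\<Sum>x<K. \<Sum>y<K. (cmod (c j y x))\<^sup>2))"
  proof (intro sum_mono mult_mono)
    fix j x assume "x \<in> {..<K}"
    then show "(cmod (c j x x))\<^sup>2 \<le> (\<Sum>y<K. (cmod (c j y x))\<^sup>2)"
      by (intro member_le_sum[where f = "\<lambda>y. (cmod (c j y x))\<^sup>2"]) auto
  qed (auto intro: sum_nonneg)
  also have "\<dots> = real K * (\<Sum>x<K. \<Sum>y<K. \<Sum>j\<in>J. (cmod (c j y x))\<^sup>2)"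
    unfolding sum_distrib_left[symmetric] by (rule arg_cong[where f = "(*) (real K)"], rule sum_swap3)
  finally show ?thesis
    by (simp add: sum.cartesian_product c_def coeff_sq_def)
qed

text \<open>The test projects onto the eigenvectors of the partial trace of \<open>D\<close> with eigenvalue above \<open>t\<close>.\<close>
lemma decoder_gives_test:
  assumes \<sigma>: "density_operator (K * B) \<sigma>" and D: "psd (K * B) D"
    and D1: "\<And>v. Re (qform (K * B) (\<lambda>r s. D $$ (r, s)) v) \<le> (\<Sum>p<K * B. (cmod (v p))\<^sup>2)"
    and t: "t > 0"
  obtains e :: "nat \<Rightarrow> nat \<Rightarrow> complex" and L where "orthonormal B e" "L \<subseteq> {..<B}"
    "Re (mat_trace (\<sigma> * D)) \<le> 2 * Re (\<Sum>k\<in>L. qform B (\<lambda>r s. trace_fst K B \<sigma> $$ (r, s)) (e k)) + 2 * real K * t"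
    "\<And>\<omega>. psd B \<omega> \<Longrightarrow>
      t * Re (\<Sum>k\<in>L. qform B (\<lambda>r s. \<omega> $$ (r, s)) (e k)) \<le> Re (mat_trace (trace_fst K B D * \<omega>))"
proof -
  have psd\<sigma>: "psd (K * B) \<sigma>" and tr\<sigma>: "mat_trace \<sigma> = 1" using \<sigma> by (auto simp: density_operator_def)
  have carr: "\<sigma> \<in> carrier_mat (K * B) (K * B)" "D \<in> carrier_mat (K * B) (K * B)"
    using psd\<sigma> D by (auto simp: psd_def)
  obtain w where w: "\<And>p q. p < K * B \<Longrightarrow> q < K * B \<Longrightarrow>
      D $$ (p, q) = (\<Sum>j<K * B. of_real 1 * w j p * cnj (w j q))"
    by (rule psd_gram[OF D]) blast
  obtain v where v: "\<And>p q. p < K * B \<Longrightarrow> q < K * B \<Longrightarrow>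
      \<sigma> $$ (p, q) = (\<Sum>j<K * B. of_real 1 * v j p * cnj (v j q))"
    by (rule psd_gram[OF psd\<sigma>]) blast
  obtain g :: "nat \<Rightarrow> real" and e where e: "orthonormal B e" and g: "\<And>k. k < B \<Longrightarrow> g k \<ge> 0"
    and Ge: "\<And>r s. r < B \<Longrightarrow> s < B \<Longrightarrow> trace_fst K B D $$ (r, s) = (\<Sum>k<B. of_real (g k) * e k r * cnj (e k s))"
    by (rule psd_spectral[OF psd_trace_fst[OF D]]) blast
  define L where "L = {k\<in>{..<B}. g k > t}"
  define L' where "L' = {k\<in>{..<B}. g k \<le> t}"
  have LL: "L \<subseteq> {..<B}" "L' \<subseteq> {..<B}" "L \<inter> L' = {}" "L \<union> L' = {..<B}" "finite L" "finite L'"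
    by (auto simp: L_def L'_def)
  \<comment> \<open>\<open>h i x k\<close> is the coefficient along \<open>e k\<close> of slice
    \<open>x\<close> of the vector \<open>v i\<close>. \<open>P M i\<close> is \<open>v i\<close>
    projected, on the second factor only, onto the span of the \<open>e k\<close> with k in
    \<open>M\<close>.\<close>
  define h where "h = (\<lambda>i x k. \<Sum>r<B. cnj (e k r) * v i (x * B + r))"
  define P where "P = (\<lambda>M i p. \<Sum>k\<in>M. h i (p div B) k * e k (p mod B))"
  define q where "q = (\<lambda>u. \<Sum>j<K * B. coeff_sq (K * B) w u j)"
  have Pblock: "(\<lambda>r. P M i (x * B + r)) r = (\<Sum>k\<in>M. h i x k * e k r)" if "r < B" for M i x r
    using that by (simp add: P_def)
  have Pcoeff: "coeff_sq B e (\<lambda>r. P M i (x * B + r)) l = (if l \<in> M then (cmod (h i x l))\<^sup>2 else 0)"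
    if "M \<subseteq> {..<B}" "l < B" for M i x l
  proof -
    have "coeff_sq B e (\<lambda>r. P M i (x * B + r)) l = (cmod (\<Sum>r<B. cnj (e l r) * (\<Sum>k\<in>M. h i x k * e k r)))\<^sup>2"
      unfolding coeff_sq_def by (intro arg_cong[where f = "\<lambda>z. (cmod z)\<^sup>2"] sum.cong refl) (simp add: P_def)
    then show ?thesis using orthonormal_combination_coeff[OF e that] by simp
  qed
  have qform_q: "Re (qform (K * B) (\<lambda>r s. D $$ (r, s)) u) = q u" for u
  proof -
    have "qform (K * B) (\<lambda>r s. D $$ (r, s)) u = of_real (\<Sum>j<K * B. 1 * coeff_sq (K * B) w u j)"
      using w by (rule qform_gram)
    then show ?thesis by (simp add: q_def)
  qed
  have hsum: "(\<Sum>i<K * B. \<Sum>x<K. \<Sum>k<B. (cmod (h i x k))\<^sup>2) = 1"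
  proof -
    have "(\<Sum>k<B. (cmod (h i x k))\<^sup>2) = (\<Sum>r<B. (cmod (v i (x * B + r)))\<^sup>2)" for i x
      using parseval[OF e, of "\<lambda>r. v i (x * B + r)"] by (simp add: coeff_sq_def h_def)
    then have "(\<Sum>i<K * B. \<Sum>x<K. \<Sum>k<B. (cmod (h i x k))\<^sup>2) = (\<Sum>i<K * B. \<Sum>p<K * B. (cmod (v i p))\<^sup>2)"
      by (simp add: sum_mult_index[of _ K B])
    also have "\<dots> = (\<Sum>p<K * B. \<Sum>i<K * B. (cmod (v i p))\<^sup>2)" by (rule sum.swap)
    also have "complex_of_real \<dots> = mat_trace \<sigma>"
      unfolding mat_trace_eq[OF carr(1)] of_real_sum
      by (intro sum.cong refl) (simp add: v complex_cmod_square)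
    finally show ?thesis unfolding tr\<sigma> by (simp only: of_real_eq_1_iff)
  qed
  \<comment> \<open>On the part seen by the test, \<open>D\<close> is bounded by the
    identity.\<close>
  have qL: "q (P L i) \<le> (\<Sum>x<K. \<Sum>k\<in>L. (cmod (h i x k))\<^sup>2)" for i
  proof -
    have "q (P L i) \<le> (\<Sum>p<K * B. (cmod (P L i p))\<^sup>2)" using D1[of "P L i"] unfolding qform_q .
    also have "\<dots> = (\<Sum>x<K. \<Sum>l<B. coeff_sq B e (\<lambda>r. P L i (x * B + r)) l)"
      unfolding sum_mult_index parseval[OF e] ..
    also have "\<dots> = (\<Sum>x<K. \<Sum>k\<in>L. (cmod (h i x k))\<^sup>2)"
    proof (rule sum.cong[OF refl])
      fix x
      have "(\<Sum>l<B. coeff_sq B e (\<lambda>r. P L i (x * B + r)) l) = (\<Sum>l<B. if l \<in> L then (cmod (h i x l))\<^sup>2 else 0)"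
        by (intro sum.cong refl) (simp add: Pcoeff[OF LL(1)])
      also have "\<dots> = (\<Sum>k\<in>L. (cmod (h i x k))\<^sup>2)"
        using LL(1) by (intro sum.mono_neutral_cong_right) auto
      finally show "(\<Sum>l<B. coeff_sq B e (\<lambda>r. P L i (x * B + r)) l) = (\<Sum>k\<in>L. (cmod (h i x k))\<^sup>2)" .
    qed
    finally show ?thesis .
  qed
  \<comment> \<open>On the rest, \<open>D\<close> is bounded by \<open>K\<close> times its partial
    trace, all of whose eigenvalues there are at most \<open>t\<close>.\<close>
  have qL': "q (P L' i) \<le> real K * t * (\<Sum>x<K. \<Sum>k<B. (cmod (h i x k))\<^sup>2)" for i
  proof -
    have "q (P L' i) \<le> real K * (\<Sum>x<K. \<Sum>(y, j)\<in>{..<K} \<times> {..<K * B}.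
        coeff_sq B (\<lambda>(y, j) r. w j (y * B + r)) (\<lambda>r. P L' i (x * B + r)) (y, j))"
      unfolding q_def by (rule psd_le_trace_fst)
    also have "\<dots> \<le> real K * (\<Sum>x<K. t * (\<Sum>k<B. (cmod (h i x k))\<^sup>2))"
    proof (intro mult_left_mono sum_mono)
      fix x
      define u where "u = (\<lambda>r. P L' i (x * B + r))"
      have "complex_of_real (\<Sum>(y, j)\<in>{..<K} \<times> {..<K * B}. coeff_sq B (\<lambda>(y, j) r. w j (y * B + r)) u (y, j))
        = qform B (\<lambda>r s. trace_fst K B D $$ (r, s)) u"
        using w by (rule qform_trace_fst[symmetric])
      also have "\<dots> = of_real (\<Sum>k<B. g k * coeff_sq B e u k)"
        using Ge by (rule qform_gram)
      finally have "(\<Sum>(y, j)\<in>{..<K} \<times> {..<K * B}.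
          coeff_sq B (\<lambda>(y, j) r. w j (y * B + r)) (\<lambda>r. P L' i (x * B + r)) (y, j))
        = (\<Sum>k<B. g k * coeff_sq B e (\<lambda>r. P L' i (x * B + r)) k)"
        unfolding of_real_eq_iff u_def .
      also have "\<dots> \<le> (\<Sum>k<B. t * (cmod (h i x k))\<^sup>2)"
      proof (intro sum_mono)
        fix k assume "k \<in> {..<B}"
        then have k: "k < B" by simp
        show "g k * coeff_sq B e (\<lambda>r. P L' i (x * B + r)) k \<le> t * (cmod (h i x k))\<^sup>2"
          unfolding Pcoeff[OF LL(2) k] using t by (auto simp: L'_def intro!: mult_right_mono)
      qed
      finally show "(\<Sum>(y, j)\<in>{..<K} \<times> {..<K * B}.
          coeff_sq B (\<lambda>(y, j) r. w j (y * B + r)) (\<lambda>r. P L' i (x * B + r)) (y, j))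
        \<le> t * (\<Sum>k<B. (cmod (h i x k))\<^sup>2)" by (simp only: sum_distrib_left)
    qed auto
    finally show ?thesis by (simp add: sum_distrib_left mult.assoc)
  qed
  have qv: "q (v i) \<le> 2 * q (P L i) + 2 * q (P L' i)" for i
  proof -
    have vP: "v i p = P L i p + P L' i p" if "p < K * B" for p
    proof -
      have B: "B > 0" using that by (cases B) auto
      have "P L i p + P L' i p = (\<Sum>k<B. h i (p div B) k * e k (p mod B))"
        unfolding P_def using LL by (simp add: sum.union_disjoint[symmetric])
      also have "\<dots> = v i (p div B * B + p mod B)"
        unfolding h_def using orthonormal_expansion[OF e, of "p mod B" "\<lambda>r. v i (p div B * B + r)"] B by simp
      finally show ?thesis by simp
    qed
    have "q (v i) = q (\<lambda>p. P L i p + P L' i p)"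
      unfolding q_def by (intro sum.cong refl coeff_sq_cong vP)
    also have "\<dots> \<le> (\<Sum>j<K * B. 2 * coeff_sq (K * B) w (P L i) j + 2 * coeff_sq (K * B) w (P L' i) j)"
      unfolding q_def by (intro sum_mono coeff_sq_add_le)
    finally show ?thesis by (simp add: q_def sum.distrib sum_distrib_left)
  qed
  have \<omega>L: "Re (\<Sum>k\<in>L. qform B (\<lambda>r s. trace_fst K B \<sigma> $$ (r, s)) (e k)) =
      (\<Sum>i<K * B. \<Sum>x<K. \<Sum>k\<in>L. (cmod (h i x k))\<^sup>2)"
  proof -
    have "qform B (\<lambda>r s. trace_fst K B \<sigma> $$ (r, s)) (e k) = of_real (\<Sum>x<K. \<Sum>i<K * B. (cmod (h i x k))\<^sup>2)" for k
    proof -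
      have "qform B (\<lambda>r s. trace_fst K B \<sigma> $$ (r, s)) (e k) =
        of_real (\<Sum>(x, i)\<in>{..<K} \<times> {..<K * B}. coeff_sq B (\<lambda>(x, i) r. v i (x * B + r)) (e k) (x, i))"
        using v by (rule qform_trace_fst)
      also have "(\<Sum>(x, i)\<in>{..<K} \<times> {..<K * B}. coeff_sq B (\<lambda>(x, i) r. v i (x * B + r)) (e k) (x, i))
        = (\<Sum>(x, i)\<in>{..<K} \<times> {..<K * B}. (cmod (h i x k))\<^sup>2)"
        unfolding coeff_sq_swap[of _ _ e] by (simp add: coeff_sq_def h_def)
      finally show ?thesis by (simp add: sum.cartesian_product)
    qed
    then have "Re (\<Sum>k\<in>L. qform B (\<lambda>r s. trace_fst K B \<sigma> $$ (r, s)) (e k))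
        = (\<Sum>k\<in>L. \<Sum>x<K. \<Sum>i<K * B. (cmod (h i x k))\<^sup>2)" by simp
    also have "\<dots> = (\<Sum>x<K. \<Sum>i<K * B. \<Sum>k\<in>L. (cmod (h i x k))\<^sup>2)" by (rule sum_swap3)
    also have "\<dots> = (\<Sum>i<K * B. \<Sum>x<K. \<Sum>k\<in>L. (cmod (h i x k))\<^sup>2)" by (rule sum.swap)
    finally show ?thesis .
  qed
  have "Re (mat_trace (\<sigma> * D)) = (\<Sum>i<K * B. q (v i))"
  proof -
    have "mat_trace (\<sigma> * D) = (\<Sum>i<K * B. of_real 1 * qform (K * B) (\<lambda>r s. D $$ (r, s)) (v i))"
      unfolding mat_trace_mult[OF carr] using v by (rule trace_gram)
    then show ?thesis by (simp add: qform_q)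
  qed
  also have "\<dots> \<le> (\<Sum>i<K * B. 2 * (\<Sum>x<K. \<Sum>k\<in>L. (cmod (h i x k))\<^sup>2) +
      2 * (real K * t * (\<Sum>x<K. \<Sum>k<B. (cmod (h i x k))\<^sup>2)))"
    using qv qL qL' by (intro sum_mono) (smt (verit))
  also have "\<dots> = 2 * Re (\<Sum>k\<in>L. qform B (\<lambda>r s. trace_fst K B \<sigma> $$ (r, s)) (e k)) + 2 * real K * t"
    unfolding \<omega>L sum.distrib sum_distrib_left[symmetric] hsum by simp
  finally have main: "Re (mat_trace (\<sigma> * D)) \<le>
    2 * Re (\<Sum>k\<in>L. qform B (\<lambda>r s. trace_fst K B \<sigma> $$ (r, s)) (e k)) + 2 * real K * t" .
  have test: "t * Re (\<Sum>k\<in>L. qform B (\<lambda>r s. \<omega> $$ (r, s)) (e k)) \<le> Re (mat_trace (trace_fst K B D * \<omega>))"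
    if \<omega>: "psd B \<omega>" for \<omega>
  proof -
    have \<omega>c: "\<omega> \<in> carrier_mat B B" using \<omega> by (simp add: psd_def)
    have pos: "0 \<le> Re (qform B (\<lambda>r s. \<omega> $$ (r, s)) u)" for u
    proof -
      have "0 \<le> qform B (\<lambda>r s. \<omega> $$ (r, s)) u" using \<omega> unfolding psd_iff_qform by blast
      then show ?thesis by (simp add: less_eq_complex_def)
    qed
    have "mat_trace (trace_fst K B D * \<omega>) = (\<Sum>k<B. of_real (g k) * qform B (\<lambda>r s. \<omega> $$ (r, s)) (e k))"
      unfolding mat_trace_mult[OF trace_fst_carrier \<omega>c] using Ge by (rule trace_gram)
    then have "Re (mat_trace (trace_fst K B D * \<omega>)) = (\<Sum>k<B. g k * Re (qform B (\<lambda>r s. \<omega> $$ (r, s)) (e k)))"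
      by simp
    also have "\<dots> \<ge> (\<Sum>k\<in>L. g k * Re (qform B (\<lambda>r s. \<omega> $$ (r, s)) (e k)))"
      using LL(1) g pos by (intro sum_mono2) auto
    also have "(\<Sum>k\<in>L. t * Re (qform B (\<lambda>r s. \<omega> $$ (r, s)) (e k)))
        \<le> (\<Sum>k\<in>L. g k * Re (qform B (\<lambda>r s. \<omega> $$ (r, s)) (e k)))"
      using pos by (intro sum_mono mult_right_mono) (auto simp: L_def)
    finally show ?thesis by (simp add: sum_distrib_left)
  qed
  show ?thesis using that[OF e LL(1) main test] .
qed

section \<open>The bound that every private code obeys\<close>

lemma povm_qform_sum:
  assumes "povm n J Q"
  shows "(\<Sum>j<J. qform n (\<lambda>r s. Q j $$ (r, s)) v) = of_real (\<Sum>r<n. (cmod (v r))\<^sup>2)"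
proof -
  have Q: "(\<Sum>j<J. Q j $$ (r, s)) = (if r = s then 1 else 0)" if "r < n" "s < n" for r s
  proof -
    have "mat n n (\<lambda>rs. \<Sum>j<J. Q j $$ rs) $$ (r, s) = 1\<^sub>m n $$ (r, s)"
      using assms by (simp add: povm_def)
    then show ?thesis using that by simp
  qed
  have "(\<Sum>j<J. qform n (\<lambda>r s. Q j $$ (r, s)) v) = (\<Sum>r<n. \<Sum>s<n. cnj (v r) * (\<Sum>j<J. Q j $$ (r, s)) * v s)"
    unfolding qform_def sum_distrib_left sum_distrib_right by (rule sum_swap3)
  also have "\<dots> = (\<Sum>r<n. \<Sum>s<n. if s = r then cnj (v r) * v s else 0)"
    by (intro sum.cong refl) (simp add: Q)
  also have "\<dots> = of_real (\<Sum>r<n. (cmod (v r))\<^sup>2)"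
    by (simp add: complex_cmod_square mult.commute)
  finally show ?thesis .
qed

lemma psd_qform_nonneg: "psd n M \<Longrightarrow> 0 \<le> Re (qform n (\<lambda>r s. M $$ (r, s)) v)"
  unfolding psd_iff_qform less_eq_complex_def by simp

lemma povm_le_one:
  assumes "povm n J Q" "j < J"
  shows "Re (qform n (\<lambda>r s. Q j $$ (r, s)) v) \<le> (\<Sum>r<n. (cmod (v r))\<^sup>2)"
proof -
  have "Re (qform n (\<lambda>r s. Q j $$ (r, s)) v) \<le> (\<Sum>j<J. Re (qform n (\<lambda>r s. Q j $$ (r, s)) v))"
    using assms by (intro member_le_sum psd_qform_nonneg) (auto simp: povm_def)
  also have "\<dots> = (\<Sum>r<n. (cmod (v r))\<^sup>2)"
    using arg_cong[OF povm_qform_sum[OF assms(1), of v], of Re] by simp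
  finally show ?thesis .
qed

text \<open>Each decoder yields a test on Eve's system. Passing from Eve's state to \<omega>0
  changes its probability by at most the trace norm of the difference. On \<omega>0 the
  probabilities add up to at most K / t over all messages, because the partial traces of the
  decoders sum to \<open>K\<close> times the identity; divided by \<open>N\<close> this leaves 8 * K
  ^ 2 / N.\<close>

lemma private_code_bound:
  assumes N: "N \<ge> 1" and K: "K \<ge> 1"
    and \<sigma>: "\<And>m. m < N \<Longrightarrow> density_operator (K * B) (\<sigma> m)"
    and D: "povm (K * B) N D"
    and err: "1 / real N * (\<Sum>m<N. Re (mat_trace (\<sigma> m * (1\<^sub>m (K * B) - D m)))) \<le> \<epsilon>"
    and \<omega>0: "density_operator B \<omega>0"
    and priv: "1 / real N * (\<Sum>m<N. trace_norm (trace_fst K B (\<sigma> m) - \<omega>0)) \<le> \<delta>"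
  shows "3 / 4 - \<epsilon> \<le> 2 * \<delta> + 16 * (real K)\<^sup>2 / real N"
proof -
  \<comment> \<open>Makes the error term \<open>2 * real K * t\<close> of the test equal to 1 / 4,
    which leaves 3 / 4 of the success probability to be accounted for.\<close>
  define t where "t = 1 / (8 * real K)"
  have t: "t > 0" using K by (simp add: t_def)
  have psd\<omega>0: "psd B \<omega>0" and tr\<omega>0: "mat_trace \<omega>0 = 1" using \<omega>0 by (auto simp: density_operator_def)
  have c\<omega>0: "\<omega>0 \<in> carrier_mat B B" using psd\<omega>0 by (simp add: psd_def)
  have one: "1 - Re (mat_trace (\<sigma> m * (1\<^sub>m (K * B) - D m)))
      \<le> 2 * trace_norm (trace_fst K B (\<sigma> m) - \<omega>0) + 2 * (Re (mat_trace (trace_fst K B (D m) * \<omega>0)) / t) + 1 / 4"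
    if m: "m < N" for m
  proof -
    have psd\<sigma>: "psd (K * B) (\<sigma> m)" and tr: "mat_trace (\<sigma> m) = 1"
      using \<sigma>[OF m] by (auto simp: density_operator_def)
    have psdD: "psd (K * B) (D m)" using D m by (auto simp: povm_def)
    have carr: "\<sigma> m \<in> carrier_mat (K * B) (K * B)" "D m \<in> carrier_mat (K * B) (K * B)"
      using psd\<sigma> psdD by (auto simp: psd_def)
    obtain e L where e: "orthonormal B e" "L \<subseteq> {..<B}"
      and main: "Re (mat_trace (\<sigma> m * D m)) \<le> 2 * Re (\<Sum>k\<in>L. qform B (\<lambda>r s. trace_fst K B (\<sigma> m) $$ (r, s)) (e k)) + 2 * real K * t"
      and test: "\<And>\<omega>. psd B \<omega> \<Longrightarrow>
        t * Re (\<Sum>k\<in>L. qform B (\<lambda>r s. \<omega> $$ (r, s)) (e k)) \<le> Re (mat_trace (trace_fst K B (D m) * \<omega>))"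
      by (rule decoder_gives_test[OF \<sigma>[OF m] psdD povm_le_one[OF D m] t]) blast
    have "mat_trace (\<sigma> m * (1\<^sub>m (K * B) - D m)) = mat_trace (\<sigma> m) - mat_trace (\<sigma> m * D m)"
    proof -
      have "\<sigma> m * (1\<^sub>m (K * B) - D m) = \<sigma> m - \<sigma> m * D m"
        using carr by (subst mult_minus_distrib_mat[of _ "K * B" "K * B"]) auto
      then show ?thesis using carr by (auto simp: mat_trace_def sum_subtractf)
    qed
    then have a: "1 - Re (mat_trace (\<sigma> m * (1\<^sub>m (K * B) - D m))) = Re (mat_trace (\<sigma> m * D m))"
      by (simp add: tr)
    define \<Delta> where "\<Delta> = trace_fst K B (\<sigma> m) - \<omega>0"
    have \<Delta>c: "\<Delta> \<in> carrier_mat B B" unfolding \<Delta>_def by (rule minus_carrier_mat[OF c\<omega>0])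
    have \<Delta>i: "\<Delta> $$ (r, s) = trace_fst K B (\<sigma> m) $$ (r, s) - \<omega>0 $$ (r, s)" if "r < B" "s < B" for r s
      unfolding \<Delta>_def using that c\<omega>0 by (intro index_minus_mat(1)) auto
    have herm: "\<Delta> $$ (s, r) = cnj (\<Delta> $$ (r, s))" if "r < B" "s < B" for r s
      unfolding \<Delta>i[OF that] \<Delta>i[OF that(2,1)] complex_cnj_diff
      by (rule arg_cong2[where f = "(-)", OF psd_hermitian[OF psd_trace_fst[OF psd\<sigma>] that] psd_hermitian[OF psd\<omega>0 that]])
    have "Re (\<Sum>k\<in>L. qform B (\<lambda>r s. \<Delta> $$ (r, s)) (e k)) \<le> trace_norm \<Delta>"
      by (rule trace_norm_ge_projection[OF \<Delta>c _ e]) (rule herm)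
    moreover have "qform B (\<lambda>r s. \<Delta> $$ (r, s)) u = qform B (\<lambda>r s. trace_fst K B (\<sigma> m) $$ (r, s)) u
        - qform B (\<lambda>r s. \<omega>0 $$ (r, s)) u" for u
      unfolding qform_def sum_subtractf[symmetric]
      by (intro sum.cong refl) (simp add: \<Delta>i algebra_simps)
    ultimately have b: "Re (\<Sum>k\<in>L. qform B (\<lambda>r s. trace_fst K B (\<sigma> m) $$ (r, s)) (e k))
      \<le> Re (\<Sum>k\<in>L. qform B (\<lambda>r s. \<omega>0 $$ (r, s)) (e k)) + trace_norm \<Delta>"
      by (simp add: sum_subtractf)
    have "Re (\<Sum>k\<in>L. qform B (\<lambda>r s. \<omega>0 $$ (r, s)) (e k)) \<le> Re (mat_trace (trace_fst K B (D m) * \<omega>0)) / t"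
      using test[OF psd\<omega>0] t by (simp add: pos_le_divide_eq mult.commute)
    moreover have "2 * real K * t = 1 / 4" using K by (simp add: t_def)
    ultimately show ?thesis using a b main unfolding \<Delta>_def by linarith
  qed
  have Dsum: "(\<Sum>m<N. Re (mat_trace (trace_fst K B (D m) * \<omega>0))) = real K"
  proof -
    have Q: "(\<Sum>m<N. D m $$ (p, q)) = (if p = q then 1 else 0)" if "p < K * B" "q < K * B" for p q
    proof -
      have "mat (K * B) (K * B) (\<lambda>rs. \<Sum>m<N. D m $$ rs) $$ (p, q) = 1\<^sub>m (K * B) $$ (p, q)"
        using D by (simp add: povm_def)
      then show ?thesis using that by simp
    qed
    have G: "(\<Sum>m<N. trace_fst K B (D m) $$ (r, s)) = (if s = r then of_nat K else 0)" if "r < B" "s < B" for r s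
    proof -
      have "(\<Sum>m<N. trace_fst K B (D m) $$ (r, s)) = (\<Sum>x<K. \<Sum>m<N. D m $$ (x * B + r, x * B + s))"
        unfolding trace_fst_index[OF that] by (rule sum.swap)
      also have "\<dots> = (\<Sum>x<K. if s = r then 1 else 0)"
        using that by (intro sum.cong refl) (auto simp: Q index_less)
      finally show ?thesis by simp
    qed
    have "(\<Sum>m<N. mat_trace (trace_fst K B (D m) * \<omega>0)) =
        (\<Sum>r<B. \<Sum>s<B. (\<Sum>m<N. trace_fst K B (D m) $$ (r, s)) * \<omega>0 $$ (s, r))"
      unfolding mat_trace_mult[OF trace_fst_carrier c\<omega>0] sum_distrib_right by (rule sum_swap3)
    also have "\<dots> = (\<Sum>r<B. \<Sum>s<B. if s = r then of_nat K * \<omega>0 $$ (s, r) else 0)"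
      by (intro sum.cong refl) (simp add: G)
    also have "\<dots> = of_nat K * mat_trace \<omega>0"
      by (simp add: mat_trace_eq[OF c\<omega>0] sum_distrib_left)
    finally show ?thesis unfolding tr\<omega>0 by (simp flip: Re_sum)
  qed
  have N0: "real N > 0" using N by simp
  have "(\<Sum>m<N. 1 - Re (mat_trace (\<sigma> m * (1\<^sub>m (K * B) - D m))))
    \<le> (\<Sum>m<N. 2 * trace_norm (trace_fst K B (\<sigma> m) - \<omega>0) + 2 * (Re (mat_trace (trace_fst K B (D m) * \<omega>0)) / t) + 1 / 4)"
    using one by (intro sum_mono) auto
  also have "\<dots> = 2 * (\<Sum>m<N. trace_norm (trace_fst K B (\<sigma> m) - \<omega>0)) + 2 * (real K / t) + real N / 4"
    by (simp add: sum.distrib sum_distrib_left[symmetric] sum_divide_distrib[symmetric] Dsum)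
  finally have "real N - (\<Sum>m<N. Re (mat_trace (\<sigma> m * (1\<^sub>m (K * B) - D m))))
    \<le> 2 * (\<Sum>m<N. trace_norm (trace_fst K B (\<sigma> m) - \<omega>0)) + 2 * (real K / t) + real N / 4"
    by (simp add: sum_subtractf)
  moreover have "(\<Sum>m<N. Re (mat_trace (\<sigma> m * (1\<^sub>m (K * B) - D m)))) \<le> \<epsilon> * real N"
    using err N0 by (simp add: field_simps)
  moreover have "(\<Sum>m<N. trace_norm (trace_fst K B (\<sigma> m) - \<omega>0)) \<le> \<delta> * real N"
    using priv N0 by (simp add: field_simps)
  moreover have "real K / t = 8 * (real K)\<^sup>2" by (simp add: t_def power2_eq_square)
  ultimately have "real N * (3 / 4 - \<epsilon>) \<le> real N * (2 * \<delta>) + 16 * (real K)\<^sup>2"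
    by (simp add: algebra_simps)
  then have "real N * (3 / 4 - \<epsilon>) \<le> real N * (2 * \<delta> + 16 * (real K)\<^sup>2 / real N)"
    using N0 by (simp add: distrib_left)
  then show ?thesis using N0 by simp
qed

section \<open>Tensor powers of channels\<close>

lemma matrix_unit_carrier [simp]: "matrix_unit a i i' \<in> carrier_mat a a"
  by (simp add: matrix_unit_def)

lemma matrix_unit_index:
  "r < a \<Longrightarrow> s < a \<Longrightarrow> matrix_unit a i i' $$ (r, s) = (if r = i \<and> s = i' then 1 else 0)"
  by (simp add: matrix_unit_def)

lemma sum_matrix_unit:
  assumes "p < a" "q < a"
  shows "(\<Sum>i<a. \<Sum>i'<a. matrix_unit a p q $$ (i, i') * f i i') = f p q"
proof -
  have "(\<Sum>i<a. \<Sum>i'<a. matrix_unit a p q $$ (i, i') * f i i')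
    = (\<Sum>i<a. \<Sum>i'<a. if i' = q then if i = p then f i i' else 0 else 0)"
    by (intro sum.cong refl) (simp add: matrix_unit_index)
  then show ?thesis using assms by simp
qed

lemma tensor_map_index:
  assumes \<Phi>: "\<And>i i'. i < a \<Longrightarrow> i' < a \<Longrightarrow> \<Phi> (matrix_unit a i i') \<in> carrier_mat b b"
    and \<Psi>: "\<And>j j'. j < c \<Longrightarrow> j' < c \<Longrightarrow> \<Psi> (matrix_unit c j j') \<in> carrier_mat e e"
    and rs: "r < b" "s < b" "r' < e" "s' < e"
  shows "tensor_map a b c e \<Phi> \<Psi> X $$ (r * e + r', s * e + s') =
    (\<Sum>i<a. \<Sum>i'<a. \<Sum>j<c. \<Sum>j'<c. X $$ (i * c + j, i' * c + j') *
      (\<Phi> (matrix_unit a i i') $$ (r, s) * \<Psi> (matrix_unit c j j') $$ (r', s')))"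
proof -
  have lt: "r * e + r' < b * e" "s * e + s' < b * e" using rs by (auto intro: index_less)
  have "kronecker (\<Phi> (matrix_unit a i i')) (\<Psi> (matrix_unit c j j')) $$ (r * e + r', s * e + s') =
      \<Phi> (matrix_unit a i i') $$ (r, s) * \<Psi> (matrix_unit c j j') $$ (r', s')"
    if "i < a" "i' < a" "j < c" "j' < c" for i i' j j'
    using \<Phi>[OF that(1,2)] \<Psi>[OF that(3,4)] lt rs by (simp add: kronecker_def)
  then show ?thesis using lt by (simp add: tensor_map_def)
qed

lemma tensor_map_carrier [simp]: "tensor_map a b c e \<Phi> \<Psi> X \<in> carrier_mat (b * e) (b * e)"
  by (simp add: tensor_map_def)

lemma tensor_power_map_carrier:
  assumes "X \<in> carrier_mat (a ^ n) (a ^ n)"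
  shows "tensor_power_map a b \<Phi> n X \<in> carrier_mat (b ^ n) (b ^ n)"
  using assms by (cases n) auto

text \<open>A matrix unit of the product space is a product of matrix units, so the linear extension
  in \<open>tensor_map\<close> collapses to a single term and the power becomes
  multiplicative.\<close>

lemma tensor_power_map_unit:
  assumes \<Phi>: "\<And>i i'. i < a \<Longrightarrow> i' < a \<Longrightarrow> \<Phi> (matrix_unit a i i') \<in> carrier_mat b b"
    and p: "i < a" "i' < a" "j < a ^ n" "j' < a ^ n"
    and rs: "r < b" "s < b" "r' < b ^ n" "s' < b ^ n"
  shows "tensor_power_map a b \<Phi> (Suc n) (matrix_unit (a ^ Suc n) (i * a ^ n + j) (i' * a ^ n + j'))
      $$ (r * b ^ n + r', s * b ^ n + s') =
    \<Phi> (matrix_unit a i i') $$ (r, s) * tensor_power_map a b \<Phi> n (matrix_unit (a ^ n) j j') $$ (r', s')"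
proof -
  define f where "f = (\<lambda>i i' j j'. \<Phi> (matrix_unit a i i') $$ (r, s) *
      tensor_power_map a b \<Phi> n (matrix_unit (a ^ n) j j') $$ (r', s'))"
  define E where "E = matrix_unit (a * a ^ n) (i * a ^ n + j) (i' * a ^ n + j')"
  have lt: "i * a ^ n + j < a * a ^ n" "i' * a ^ n + j' < a * a ^ n" using p by (auto intro: index_less)
  have an: "a ^ n > 0" using order.strict_trans1[OF le0 p(3)] .
  have "tensor_power_map a b \<Phi> (Suc n) E $$ (r * b ^ n + r', s * b ^ n + s') =
    (\<Sum>k<a. \<Sum>k'<a. \<Sum>l<a ^ n. \<Sum>l'<a ^ n. E $$ (k * a ^ n + l, k' * a ^ n + l') * f k k' l l')"
    unfolding tensor_power_map.simps f_def
    by (rule tensor_map_index[OF _ _ rs]) (auto intro: \<Phi> tensor_power_map_carrier)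
  also have "\<dots> = (\<Sum>k<a. \<Sum>l<a ^ n. \<Sum>k'<a. \<Sum>l'<a ^ n. E $$ (k * a ^ n + l, k' * a ^ n + l') * f k k' l l')"
    by (rule sum.cong[OF refl], rule sum.swap)
  also have "\<dots> = (\<Sum>x<a * a ^ n. \<Sum>x'<a * a ^ n. E $$ (x, x') * f (x div a ^ n) (x' div a ^ n) (x mod a ^ n) (x' mod a ^ n))"
    unfolding sum_mult_index using an by (intro sum.cong refl) simp
  also have "\<dots> = f i i' j j'"
    unfolding E_def using an p by (simp only: sum_matrix_unit[OF lt]) simp
  finally show ?thesis unfolding f_def E_def by simp
qed

text \<open>\<open>tensor_map\<close> reads its two arguments on matrix units only and extends
  linearly, so the power is determined by its values there.\<close>

lemma tensor_power_map_linear: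
  assumes \<Phi>: "\<And>i i'. i < a \<Longrightarrow> i' < a \<Longrightarrow> \<Phi> (matrix_unit a i i') \<in> carrier_mat b b"
    and X: "X \<in> carrier_mat (a ^ n) (a ^ n)" and rs: "r < b ^ n" "s < b ^ n"
  shows "tensor_power_map a b \<Phi> n X $$ (r, s) =
    (\<Sum>p<a ^ n. \<Sum>q<a ^ n. X $$ (p, q) * tensor_power_map a b \<Phi> n (matrix_unit (a ^ n) p q) $$ (r, s))"
proof (cases n)
  case 0
  then show ?thesis using X rs by (simp add: matrix_unit_index)
next
  case (Suc k)
  have bk: "b ^ k > 0" using rs Suc by (cases "b = 0") auto
  have rs': "r div b ^ k < b" "s div b ^ k < b" "r mod b ^ k < b ^ k" "s mod b ^ k < b ^ k"
    using rs bk unfolding Suc by (auto simp: less_mult_imp_div_less)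
  note r = div_mult_mod_eq[of r "b ^ k"] and s = div_mult_mod_eq[of s "b ^ k"]
  have "tensor_power_map a b \<Phi> (Suc k) X $$ (r div b ^ k * b ^ k + r mod b ^ k, s div b ^ k * b ^ k + s mod b ^ k) =
    (\<Sum>i<a. \<Sum>i'<a. \<Sum>j<a ^ k. \<Sum>j'<a ^ k. X $$ (i * a ^ k + j, i' * a ^ k + j') *
      (\<Phi> (matrix_unit a i i') $$ (r div b ^ k, s div b ^ k) *
       tensor_power_map a b \<Phi> k (matrix_unit (a ^ k) j j') $$ (r mod b ^ k, s mod b ^ k)))"
    unfolding tensor_power_map.simps
    by (rule tensor_map_index[OF _ _ rs']) (auto intro: \<Phi> tensor_power_map_carrier)
  also have "\<dots> = (\<Sum>i<a. \<Sum>j<a ^ k. \<Sum>i'<a. \<Sum>j'<a ^ k. X $$ (i * a ^ k + j, i' * a ^ k + j') *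
      (\<Phi> (matrix_unit a i i') $$ (r div b ^ k, s div b ^ k) *
       tensor_power_map a b \<Phi> k (matrix_unit (a ^ k) j j') $$ (r mod b ^ k, s mod b ^ k)))"
    by (rule sum.cong[OF refl], rule sum.swap)
  also have "\<dots> = (\<Sum>i<a. \<Sum>j<a ^ k. \<Sum>i'<a. \<Sum>j'<a ^ k. X $$ (i * a ^ k + j, i' * a ^ k + j') *
      tensor_power_map a b \<Phi> (Suc k) (matrix_unit (a ^ Suc k) (i * a ^ k + j) (i' * a ^ k + j'))
        $$ (r div b ^ k * b ^ k + r mod b ^ k, s div b ^ k * b ^ k + s mod b ^ k))"
    by (intro sum.cong refl arg_cong2[where f = "(*)"] tensor_power_map_unit[symmetric] \<Phi> rs') auto
  also have "\<dots> = (\<Sum>p<a * a ^ k. \<Sum>q<a * a ^ k. X $$ (p, q) *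
      tensor_power_map a b \<Phi> (Suc k) (matrix_unit (a ^ Suc k) p q)
        $$ (r div b ^ k * b ^ k + r mod b ^ k, s div b ^ k * b ^ k + s mod b ^ k))"
    unfolding sum_mult_index ..
  finally show ?thesis unfolding r s Suc power_Suc .
qed

text \<open>\<open>k \<alpha> r i\<close> is the entry (r, i) of Kraus operator number \<alpha>. The
  second clause is the completeness relation, that is, trace preservation.\<close>

definition kraus :: "nat \<Rightarrow> nat \<Rightarrow> nat \<Rightarrow> (nat \<Rightarrow> nat \<Rightarrow> nat \<Rightarrow> complex) \<Rightarrow> (complex mat \<Rightarrow> complex mat) \<Rightarrow> bool" where
  "kraus a b A k \<Phi> \<longleftrightarrow>
    (\<forall>i<a. \<forall>i'<a. \<forall>r<b. \<forall>s<b. \<Phi> (matrix_unit a i i') $$ (r, s) = (\<Sum>\<alpha><A. k \<alpha> r i * cnj (k \<alpha> s i'))) \<and>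
    (\<forall>i<a. \<forall>i'<a. (\<Sum>\<alpha><A. \<Sum>r<b. k \<alpha> r i * cnj (k \<alpha> r i')) = (if i = i' then 1 else 0))"

text \<open>Products of Kraus operators, numbered by \<open>\<alpha> * A' + \<beta>\<close>, are
  Kraus operators of the product. This provides positivity and trace preservation for all powers of
  a channel at once.\<close>

lemma kraus_tensor_power:
  assumes \<Phi>: "\<And>i i'. i < a \<Longrightarrow> i' < a \<Longrightarrow> \<Phi> (matrix_unit a i i') \<in> carrier_mat b b"
    and k: "kraus a b A k \<Phi>"
  shows "\<exists>A' k'. kraus (a ^ n) (b ^ n) A' k' (tensor_power_map a b \<Phi> n)"
proof (induction n)
  case 0
  have "kraus 1 1 1 (\<lambda>_ _ _. 1) (\<lambda>X. X)"
    by (auto simp: kraus_def matrix_unit_index)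
  then show ?case by (intro exI) simp
next
  case (Suc n)
  then obtain A' k' where k': "kraus (a ^ n) (b ^ n) A' k' (tensor_power_map a b \<Phi> n)" by blast
  define kk where "kk = (\<lambda>\<alpha> r p. k (\<alpha> div A') (r div b ^ n) (p div a ^ n) * k' (\<alpha> mod A') (r mod b ^ n) (p mod a ^ n))"
  have "kraus (a * a ^ n) (b * b ^ n) (A * A') kk (tensor_power_map a b \<Phi> (Suc n))"
    unfolding kraus_def
  proof (intro conjI allI impI)
    fix p p' assume p: "p < a * a ^ n" "p' < a * a ^ n"
    have an: "a ^ n > 0" using p by (cases "a = 0") auto
    have pp: "p div a ^ n < a" "p' div a ^ n < a" "p mod a ^ n < a ^ n" "p' mod a ^ n < a ^ n"
      using p an by (auto simp: less_mult_imp_div_less)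
    note pe = div_mult_mod_eq[of p "a ^ n"] div_mult_mod_eq[of p' "a ^ n"]
    {
      fix r s assume rs: "r < b * b ^ n" "s < b * b ^ n"
      have bn: "b ^ n > 0" using rs by (cases "b = 0") auto
      have rr: "r div b ^ n < b" "s div b ^ n < b" "r mod b ^ n < b ^ n" "s mod b ^ n < b ^ n"
        using rs bn by (auto simp: less_mult_imp_div_less)
      note re = div_mult_mod_eq[of r "b ^ n"] div_mult_mod_eq[of s "b ^ n"]
      have "tensor_power_map a b \<Phi> (Suc n) (matrix_unit (a ^ Suc n) p p') $$ (r, s) =
        \<Phi> (matrix_unit a (p div a ^ n) (p' div a ^ n)) $$ (r div b ^ n, s div b ^ n) *
        tensor_power_map a b \<Phi> n (matrix_unit (a ^ n) (p mod a ^ n) (p' mod a ^ n)) $$ (r mod b ^ n, s mod b ^ n)"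
        by (rule tensor_power_map_unit[where a = a and b = b and n = n and \<Phi> = \<Phi>, OF _ pp rr, unfolded pe re])
          (rule \<Phi>)
      also have "\<dots> = (\<Sum>\<alpha><A. k \<alpha> (r div b ^ n) (p div a ^ n) * cnj (k \<alpha> (s div b ^ n) (p' div a ^ n))) *
          (\<Sum>\<beta><A'. k' \<beta> (r mod b ^ n) (p mod a ^ n) * cnj (k' \<beta> (s mod b ^ n) (p' mod a ^ n)))"
        using k k' pp rr unfolding kraus_def by simp
      also have "\<dots> = (\<Sum>\<alpha><A * A'. kk \<alpha> r p * cnj (kk \<alpha> s p'))"
        unfolding sum_mult_index sum_product
        by (intro sum.cong refl) (simp add: kk_def mult_ac)
      finally show "tensor_power_map a b \<Phi> (Suc n) (matrix_unit (a * a ^ n) p p') $$ (r, s) =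
        (\<Sum>\<alpha><A * A'. kk \<alpha> r p * cnj (kk \<alpha> s p'))" by simp
    }
    have "(\<Sum>\<alpha><A * A'. \<Sum>r<b * b ^ n. kk \<alpha> r p * cnj (kk \<alpha> r p')) =
      (\<Sum>\<alpha><A. \<Sum>\<beta><A'. \<Sum>r<b. \<Sum>r'<b ^ n.
        (k \<alpha> r (p div a ^ n) * cnj (k \<alpha> r (p' div a ^ n))) * (k' \<beta> r' (p mod a ^ n) * cnj (k' \<beta> r' (p' mod a ^ n))))"
      unfolding sum_mult_index by (intro sum.cong refl) (simp add: kk_def)
    also have "\<dots> = (\<Sum>\<alpha><A. \<Sum>r<b. k \<alpha> r (p div a ^ n) * cnj (k \<alpha> r (p' div a ^ n))) *
        (\<Sum>\<beta><A'. \<Sum>r'<b ^ n. k' \<beta> r' (p mod a ^ n) * cnj (k' \<beta> r' (p' mod a ^ n)))"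
      unfolding sum_product ..
    also have "\<dots> = (if p div a ^ n = p' div a ^ n then 1 else 0) * (if p mod a ^ n = p' mod a ^ n then 1 else 0)"
      using k k' pp unfolding kraus_def by simp
    also have "\<dots> = (if p = p' then 1 else 0)"
    proof -
      have "p = p' \<longleftrightarrow> p div a ^ n = p' div a ^ n \<and> p mod a ^ n = p' mod a ^ n"
        using pe by metis
      then show ?thesis by simp
    qed
    finally show "(\<Sum>\<alpha><A * A'. \<Sum>r<b * b ^ n. kk \<alpha> r p * cnj (kk \<alpha> r p')) = (if p = p' then 1 else 0)" .
  qed
  then show ?case by (intro exI) simp
qed

section \<open>The symmetric subspace channel\<close>

lemma mult_mat_index:
  assumes "A \<in> carrier_mat n m" "B \<in> carrier_mat m k" "i < n" "j < k"
  shows "(A * B) $$ (i, j) = (\<Sum>y<m. A $$ (i, y) * B $$ (y, j))"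
  using assms by (simp add: scalar_prod_def lessThan_atLeast0)

lemma channel_matrix_unit:
  assumes V: "V \<in> carrier_mat (b * e) a" and ii: "i < a" "i' < a" and rs: "r < b" "s < b"
  shows "channel b e V (matrix_unit a i i') $$ (r, s) = (\<Sum>\<alpha><e. V $$ (r * e + \<alpha>, i) * cnj (V $$ (s * e + \<alpha>, i')))"
proof -
  have "(V * matrix_unit a i i' * mat_adjoint V) $$ (p, q) = V $$ (p, i) * cnj (V $$ (q, i'))"
    if pq: "p < b * e" "q < b * e" for p q
  proof -
    have VE: "(V * matrix_unit a i i') $$ (p, y) = (if y = i' then V $$ (p, i) else 0)" if "y < a" for y
    proof -
      have "(V * matrix_unit a i i') $$ (p, y) = (\<Sum>x<a. V $$ (p, x) * matrix_unit a i i' $$ (x, y))"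
        using pq that by (intro mult_mat_index[OF V]) auto
      also have "\<dots> = (\<Sum>x<a. if x = i then if y = i' then V $$ (p, x) else 0 else 0)"
        using that by (intro sum.cong refl) (simp add: matrix_unit_index)
      finally show ?thesis using ii by simp
    qed
    have "(V * matrix_unit a i i' * mat_adjoint V) $$ (p, q) =
        (\<Sum>y<a. (V * matrix_unit a i i') $$ (p, y) * mat_adjoint V $$ (y, q))"
      using pq V by (intro mult_mat_index[OF _ mat_adjoint_carrier[OF V]]) auto
    also have "\<dots> = (\<Sum>y<a. if y = i' then V $$ (p, i) * cnj (V $$ (q, y)) else 0)"
      using pq by (intro sum.cong refl) (simp add: VE mat_adjoint_index[OF V])
    finally show ?thesis using ii by simp
  qed
  then show ?thesis
    unfolding channel_def trace_snd_def using rs by (simp add: index_less)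
qed

lemma complementary_channel_matrix_unit:
  assumes V: "V \<in> carrier_mat (b * e) a" and ii: "i < a" "i' < a" and rs: "r < e" "s < e"
  shows "complementary_channel b e V (matrix_unit a i i') $$ (r, s) = (\<Sum>\<alpha><b. V $$ (\<alpha> * e + r, i) * cnj (V $$ (\<alpha> * e + s, i')))"
proof -
  \<comment> \<open>With an environment of dimension 1 nothing is traced out, so the earlier
    computation, read for output dimension b * e, gives the entries of the conjugation by
    \<open>V\<close>.\<close>
  have "(V * matrix_unit a i i' * mat_adjoint V) $$ (p, q) = V $$ (p, i) * cnj (V $$ (q, i'))"
    if pq: "p < b * e" "q < b * e" for p q
    using channel_matrix_unit[of V "b * e" 1 a i i' p q] V ii pq
    by (simp add: channel_def trace_snd_def)
  then show ?thesis
    unfolding complementary_channel_def trace_fst_def using rs by (simp add: index_less)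
qed

lemma channel_carrier [simp]: "channel b e V X \<in> carrier_mat b b"
  by (simp add: channel_def trace_snd_def)

lemma kraus_channel:
  assumes V: "isometry a (b * e) V"
  shows "kraus a b e (\<lambda>\<alpha> r i. V $$ (r * e + \<alpha>, i)) (channel b e V)"
proof -
  have c: "V \<in> carrier_mat (b * e) a" and inv: "mat_adjoint V * V = 1\<^sub>m a" using V by (auto simp: isometry_def)
  have "(\<Sum>\<alpha><e. \<Sum>r<b. V $$ (r * e + \<alpha>, i) * cnj (V $$ (r * e + \<alpha>, i'))) = (if i = i' then 1 else 0)"
    if ii: "i < a" "i' < a" for i i'
  proof -
    have "(\<Sum>\<alpha><e. \<Sum>r<b. V $$ (r * e + \<alpha>, i) * cnj (V $$ (r * e + \<alpha>, i')))
      = (\<Sum>p<b * e. V $$ (p, i) * cnj (V $$ (p, i')))"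
      unfolding sum_mult_index by (rule sum.swap)
    also have "\<dots> = (\<Sum>p<b * e. mat_adjoint V $$ (i', p) * V $$ (p, i))"
      using ii by (intro sum.cong refl) (simp add: mat_adjoint_index[OF c])
    also have "\<dots> = (mat_adjoint V * V) $$ (i', i)"
      using ii by (intro mult_mat_index[symmetric, OF mat_adjoint_carrier[OF c] c])
    finally show ?thesis using ii by (simp add: inv)
  qed
  then show ?thesis using channel_matrix_unit[OF c] by (simp add: kraus_def)
qed

lemma sym2_embedding_symmetric:
  assumes "sym2_embedding d a V" "i < d" "j < d" "k < a"
  shows "V $$ (i * d + j, k) = V $$ (j * d + i, k)"
proof -
  have c: "V \<in> carrier_mat (d * d) a" using assms by (simp add: sym2_embedding_def isometry_def)
  have "V *\<^sub>v unit_vec a k \<in> sym2 d" using assms by (auto simp: sym2_embedding_def)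
  then have sym: "(V *\<^sub>v unit_vec a k) $ (i * d + j) = (V *\<^sub>v unit_vec a k) $ (j * d + i)"
    using assms unfolding sym2_def by blast
  have col: "(V *\<^sub>v unit_vec a k) $ p = V $$ (p, k)" if "p < d * d" for p
  proof -
    have "(V *\<^sub>v unit_vec a k) $ p = (\<Sum>y<a. V $$ (p, y) * unit_vec a k $ y)"
      by (rule mult_mat_vec_sum[OF c _ that]) simp
    also have "\<dots> = (\<Sum>y<a. if y = k then V $$ (p, y) else 0)"
      using assms by (intro sum.cong refl) (simp add: unit_vec_def)
    finally show ?thesis using assms by simp
  qed
  show ?thesis
    using sym unfolding col[OF index_less[OF assms(2,3)]] col[OF index_less[OF assms(3,2)]] .
qed

text \<open>The range of \<open>V\<close> is fixed pointwise by the exchange of the two factors, so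
  tracing out either one gives the same operator.\<close>

lemma complementary_channel_sym2:
  assumes V: "sym2_embedding d a V" and "i < a" "i' < a"
  shows "complementary_channel d d V (matrix_unit a i i') = channel d d V (matrix_unit a i i')"
proof (rule eq_matI)
  have c: "V \<in> carrier_mat (d * d) a" using V by (simp add: sym2_embedding_def isometry_def)
  fix r s assume "r < dim_row (channel d d V (matrix_unit a i i'))" "s < dim_col (channel d d V (matrix_unit a i i'))"
  then have rs: "r < d" "s < d" by (auto simp: channel_def trace_snd_def)
  show "complementary_channel d d V (matrix_unit a i i') $$ (r, s) = channel d d V (matrix_unit a i i') $$ (r, s)"
    unfolding complementary_channel_matrix_unit[OF c assms(2,3) rs] channel_matrix_unit[OF c assms(2,3) rs]
    using assms rs by (intro sum.cong refl) (simp add: sym2_embedding_symmetric[OF V, of _ r] sym2_embedding_symmetric[OF V, of _ s])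
qed (auto simp: channel_def complementary_channel_def trace_fst_def trace_snd_def)

section \<open>The states that reach Bob and Eve\<close>

lemma tensor_power_map_cong:
  assumes "\<And>i i'. i < a \<Longrightarrow> i' < a \<Longrightarrow> \<Phi> (matrix_unit a i i') = \<Phi>' (matrix_unit a i i')"
  shows "tensor_power_map a b \<Phi> n = tensor_power_map a b \<Phi>' n"
proof (induction n)
  case (Suc n)
  show ?case
    unfolding tensor_power_map.simps Suc tensor_map_def
    by (intro ext cong_mat sum.cong refl) (simp add: assms)
qed simp

lemma assisted_channel_index:
  assumes r: "x < 2 ^ \<kappa>" "x' < 2 ^ \<kappa>" "r < b ^ n" "s < b ^ n"
  shows "assisted_channel a b e V n \<kappa> \<rho> $$ (x * b ^ n + r, x' * b ^ n + s) =
    (\<Sum>j<a ^ n. \<Sum>j'<a ^ n. \<rho> $$ (x * a ^ n + j, x' * a ^ n + j') *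
      tensor_power_map a b (channel b e V) n (matrix_unit (a ^ n) j j') $$ (r, s))"
proof -
  define G where "G = (\<lambda>j j'. tensor_power_map a b (channel b e V) n (matrix_unit (a ^ n) j j') $$ (r, s))"
  have "assisted_channel a b e V n \<kappa> \<rho> $$ (x * b ^ n + r, x' * b ^ n + s) =
    (\<Sum>i<2 ^ \<kappa>. \<Sum>i'<2 ^ \<kappa>. \<Sum>j<a ^ n. \<Sum>j'<a ^ n. \<rho> $$ (i * a ^ n + j, i' * a ^ n + j') *
      (matrix_unit (2 ^ \<kappa>) i i' $$ (x, x') * G j j'))"
    unfolding assisted_channel_def G_def
    by (rule tensor_map_index[OF _ _ r]) (auto intro: tensor_power_map_carrier)
  also have "\<dots> = (\<Sum>i<2 ^ \<kappa>. \<Sum>i'<2 ^ \<kappa>. if i' = x' then if i = x then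
      \<Sum>j<a ^ n. \<Sum>j'<a ^ n. \<rho> $$ (i * a ^ n + j, i' * a ^ n + j') * G j j' else 0 else 0)"
    using r by (intro sum.cong refl) (auto simp: matrix_unit_index intro!: sum.neutral)
  finally show ?thesis using r by (simp add: G_def)
qed

lemma assisted_channel_carrier [simp]:
  "assisted_channel a b e V n \<kappa> \<rho> \<in> carrier_mat (2 ^ \<kappa> * b ^ n) (2 ^ \<kappa> * b ^ n)"
  by (simp add: assisted_channel_def)

text \<open>Discarding the auxiliary qubits commutes with the channel uses on the other systems.
  Together with the equality of the two channels on matrix units this expresses Eve's state through
  Bob's, the form in which \<open>private_code_bound\<close> needs it.\<close>

lemma eve_state_sym2:
  assumes V: "sym2_embedding d a V"
  shows "eve_state a d d V n \<kappa> \<rho> = trace_fst (2 ^ \<kappa>) (d ^ n) (assisted_channel a d d V n \<kappa> \<rho>)"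
proof (rule eq_matI)
  fix r s assume "r < dim_row (trace_fst (2 ^ \<kappa>) (d ^ n) (assisted_channel a d d V n \<kappa> \<rho>))"
    "s < dim_col (trace_fst (2 ^ \<kappa>) (d ^ n) (assisted_channel a d d V n \<kappa> \<rho>))"
  then have rs: "r < d ^ n" "s < d ^ n" by (auto simp: trace_fst_def)
  define G where "G = (\<lambda>p q. tensor_power_map a d (channel d d V) n (matrix_unit (a ^ n) p q) $$ (r, s))"
  have "eve_state a d d V n \<kappa> \<rho> = tensor_power_map a d (channel d d V) n (trace_fst (2 ^ \<kappa>) (a ^ n) \<rho>)"
  proof -
    have "tensor_power_map a d (complementary_channel d d V) n = tensor_power_map a d (channel d d V) n"
      by (rule tensor_power_map_cong) (rule complementary_channel_sym2[OF V])
    then show ?thesis by (simp only: eve_state_def)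
  qed
  then have "eve_state a d d V n \<kappa> \<rho> $$ (r, s) = tensor_power_map a d (channel d d V) n (trace_fst (2 ^ \<kappa>) (a ^ n) \<rho>) $$ (r, s)"
    by simp
  also have "\<dots> = (\<Sum>p<a ^ n. \<Sum>q<a ^ n. trace_fst (2 ^ \<kappa>) (a ^ n) \<rho> $$ (p, q) * G p q)"
    unfolding G_def by (rule tensor_power_map_linear[OF _ _ rs]) auto
  also have "\<dots> = (\<Sum>p<a ^ n. \<Sum>q<a ^ n. \<Sum>x<2 ^ \<kappa>. \<rho> $$ (x * a ^ n + p, x * a ^ n + q) * G p q)"
    by (intro sum.cong refl) (simp add: trace_fst_index sum_distrib_right)
  also have "\<dots> = (\<Sum>x<2 ^ \<kappa>. \<Sum>p<a ^ n. \<Sum>q<a ^ n. \<rho> $$ (x * a ^ n + p, x * a ^ n + q) * G p q)"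
    by (rule sum_swap3[symmetric])
  also have "\<dots> = trace_fst (2 ^ \<kappa>) (d ^ n) (assisted_channel a d d V n \<kappa> \<rho>) $$ (r, s)"
    unfolding trace_fst_index[OF rs] G_def using rs
    by (intro sum.cong refl assisted_channel_index[symmetric]) auto
  finally show "eve_state a d d V n \<kappa> \<rho> $$ (r, s) = \<dots>" .
next
  have "eve_state a d d V n \<kappa> \<rho> \<in> carrier_mat (d ^ n) (d ^ n)"
    unfolding eve_state_def by (intro tensor_power_map_carrier) simp
  then show "dim_row (eve_state a d d V n \<kappa> \<rho>) = dim_row (trace_fst (2 ^ \<kappa>) (d ^ n) (assisted_channel a d d V n \<kappa> \<rho>))"
    "dim_col (eve_state a d d V n \<kappa> \<rho>) = dim_col (trace_fst (2 ^ \<kappa>) (d ^ n) (assisted_channel a d d V n \<kappa> \<rho>))"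
    by (auto simp: trace_fst_def)
qed

lemma density_operator_assisted_channel:
  assumes V: "isometry a (b * e) V" and \<rho>: "density_operator (2 ^ \<kappa> * a ^ n) \<rho>"
  shows "density_operator (2 ^ \<kappa> * b ^ n) (assisted_channel a b e V n \<kappa> \<rho>)"
proof -
  define K where "K = (2::nat) ^ \<kappa>"
  define A where "A = a ^ n"
  define B where "B = b ^ n"
  define \<sigma> where "\<sigma> = assisted_channel a b e V n \<kappa> \<rho>"
  have psd\<rho>: "psd (K * A) \<rho>" and tr: "mat_trace \<rho> = 1" using \<rho> by (auto simp: density_operator_def K_def A_def)
  have \<rho>c: "\<rho> \<in> carrier_mat (K * A) (K * A)" using psd\<rho> by (simp add: psd_def)
  have \<sigma>c: "\<sigma> \<in> carrier_mat (K * B) (K * B)" by (simp add: \<sigma>_def K_def B_def)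
  obtain w where w: "\<And>p q. p < K * A \<Longrightarrow> q < K * A \<Longrightarrow>
      \<rho> $$ (p, q) = (\<Sum>j<K * A. of_real 1 * w j p * cnj (w j q))"
    by (rule psd_gram[OF psd\<rho>]) blast
  define G where "G = (\<lambda>j j' r s. tensor_power_map a b (channel b e V) n (matrix_unit A j j') $$ (r, s))"
  obtain T k where "kraus A B T k (tensor_power_map a b (channel b e V) n)"
    using kraus_tensor_power[OF channel_carrier kraus_channel[OF V], of n] unfolding A_def B_def by blast
  then have kG: "\<And>j j' r s. j < A \<Longrightarrow> j' < A \<Longrightarrow> r < B \<Longrightarrow> s < B \<Longrightarrow> G j j' r s = (\<Sum>\<alpha><T. k \<alpha> r j * cnj (k \<alpha> s j'))"
    and kT: "\<And>j j'. j < A \<Longrightarrow> j' < A \<Longrightarrow> (\<Sum>\<alpha><T. \<Sum>r<B. k \<alpha> r j * cnj (k \<alpha> r j')) = (if j = j' then 1 else 0)"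
    by (auto simp: kraus_def G_def)
  have \<sigma>i: "\<sigma> $$ (x * B + r, x' * B + s) = (\<Sum>j<A. \<Sum>j'<A. \<rho> $$ (x * A + j, x' * A + j') * G j j' r s)"
    if "x < K" "x' < K" "r < B" "s < B" for x x' r s
    unfolding \<sigma>_def A_def B_def G_def by (rule assisted_channel_index) (use that in \<open>auto simp: K_def B_def\<close>)
  \<comment> \<open>Kraus operator number \<alpha>, tensored with the identity on the qubits,
    applied to the component \<open>w l\<close> of the input. The output is the sum of the rank-one
    operators of these vectors.\<close>
  define u where "u = (\<lambda>(l, \<alpha>) p. \<Sum>j<A. k \<alpha> (p mod B) j * w l (p div B * A + j))"
  have "psd (K * B) \<sigma>"
  proof (rule psd_gramI[where J = "{..<K * A} \<times> {..<T}" and c = "\<lambda>_. 1" and w = u, OF \<sigma>c])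
    fix p q assume pq: "p < K * B" "q < K * B"
    then have B: "B > 0" by (cases "B = 0") auto
    have pq': "p div B < K" "q div B < K" "p mod B < B" "q mod B < B"
      using pq B by (auto simp: less_mult_imp_div_less)
    have "\<sigma> $$ (p, q) = (\<Sum>j<A. \<Sum>j'<A. \<rho> $$ (p div B * A + j, q div B * A + j') * G j j' (p mod B) (q mod B))"
      using \<sigma>i[OF pq'] by simp
    also have "\<dots> = (\<Sum>j<A. \<Sum>j'<A. \<Sum>l<K * A. \<Sum>\<alpha><T.
        (k \<alpha> (p mod B) j * w l (p div B * A + j)) * cnj (k \<alpha> (q mod B) j' * w l (q div B * A + j')))"
    proof (intro sum.cong refl)
      fix j j' assume "j \<in> {..<A}" "j' \<in> {..<A}"
      then have jj: "j < A" "j' < A" by auto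
      show "\<rho> $$ (p div B * A + j, q div B * A + j') * G j j' (p mod B) (q mod B) = (\<Sum>l<K * A. \<Sum>\<alpha><T.
        (k \<alpha> (p mod B) j * w l (p div B * A + j)) * cnj (k \<alpha> (q mod B) j' * w l (q div B * A + j')))"
        unfolding w[OF index_less[OF pq'(1) jj(1)] index_less[OF pq'(2) jj(2)]] kG[OF jj pq'(3,4)] sum_product
        by (intro sum.cong refl) (simp add: mult_ac)
    qed
    also have "\<dots> = (\<Sum>j<A. \<Sum>l<K * A. \<Sum>\<alpha><T. \<Sum>j'<A.
        (k \<alpha> (p mod B) j * w l (p div B * A + j)) * cnj (k \<alpha> (q mod B) j' * w l (q div B * A + j')))"
      by (rule sum.cong[OF refl], rule sum_swap3)
    also have "\<dots> = (\<Sum>l<K * A. \<Sum>\<alpha><T. \<Sum>j<A. \<Sum>j'<A.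
        (k \<alpha> (p mod B) j * w l (p div B * A + j)) * cnj (k \<alpha> (q mod B) j' * w l (q div B * A + j')))"
      by (rule sum_swap3)
    also have "\<dots> = (\<Sum>l<K * A. \<Sum>\<alpha><T. u (l, \<alpha>) p * cnj (u (l, \<alpha>) q))"
      unfolding u_def prod.case cnj_sum sum_product ..
    finally show "\<sigma> $$ (p, q) = (\<Sum>i\<in>{..<K * A} \<times> {..<T}. of_real ((\<lambda>_. 1) i) * u i p * cnj (u i q))"
      by (simp add: sum.cartesian_product case_prod_beta)
  qed auto
  moreover have "mat_trace \<sigma> = 1"
  proof -
    have "mat_trace \<sigma> = (\<Sum>x<K. \<Sum>r<B. \<Sum>j<A. \<Sum>j'<A. \<rho> $$ (x * A + j, x * A + j') * G j j' r r)"
      unfolding mat_trace_eq[OF \<sigma>c] sum_mult_index by (intro sum.cong refl \<sigma>i) auto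
    also have "\<dots> = (\<Sum>x<K. \<Sum>j<A. \<Sum>j'<A. \<Sum>r<B. \<rho> $$ (x * A + j, x * A + j') * G j j' r r)"
      by (rule sum.cong[OF refl], rule sum_swap3)
    also have "\<dots> = (\<Sum>x<K. \<Sum>j<A. \<Sum>j'<A. if j' = j then \<rho> $$ (x * A + j, x * A + j') else 0)"
    proof (intro sum.cong refl)
      fix x j j' assume "j \<in> {..<A}" "j' \<in> {..<A}"
      then have jj: "j < A" "j' < A" by auto
      have "(\<Sum>r<B. G j j' r r) = (\<Sum>r<B. \<Sum>\<alpha><T. k \<alpha> r j * cnj (k \<alpha> r j'))"
        by (intro sum.cong refl kG jj) auto
      also have "\<dots> = (if j = j' then 1 else 0)" using kT[OF jj] by (subst sum.swap)
      finally show "(\<Sum>r<B. \<rho> $$ (x * A + j, x * A + j') * G j j' r r) = (if j' = j then \<rho> $$ (x * A + j, x * A + j') else 0)"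
        unfolding sum_distrib_left[symmetric] by simp
    qed
    also have "\<dots> = mat_trace \<rho>"
      unfolding mat_trace_eq[OF \<rho>c] sum_mult_index by simp
    finally show ?thesis using tr by simp
  qed
  ultimately show ?thesis by (simp add: density_operator_def \<sigma>_def K_def B_def)
qed

lemma achievable_private_rate_le_0:
  assumes V: "sym2_embedding d a V" and ach: "achievable_rate private_states a d d V R"
  shows "R \<le> 0"
proof (rule ccontr)
  assume "\<not> R \<le> 0"
  then have R: "R > 0" by simp
  have iso: "isometry a (d * d) V" using V by (simp add: sym2_embedding_def)
  obtain \<kappa> \<epsilon> \<delta> where \<kappa>: "(\<lambda>n. real (\<kappa> n)) \<in> o(\<lambda>n. real n)" and lim: "\<epsilon> \<longlonglongrightarrow> 0" "\<delta> \<longlonglongrightarrow> 0"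
    and ev: "\<forall>\<^sub>F n in sequentially. \<exists>N \<rho> D. real N \<ge> 2 powr (real n * R) \<and>
          is_code a d d V n (\<epsilon> n) (\<kappa> n) N \<rho> D \<and>
          private_states (d ^ n) N (\<lambda>m. eve_state a d d V n (\<kappa> n) (\<rho> m)) (\<delta> n)"
    using ach unfolding achievable_rate_def by blast
  \<comment> \<open>With \<kappa> at most R * n / 4 the square of \<open>K\<close> is at most 2 powr
    (R * n / 2), and 8 < R * n / 2 then brings 16 * K ^ 2 / N below 1 / 16. The general bound
    becomes 5 / 8 < 1 / 8 + 1 / 16.\<close>
  have e1: "\<forall>\<^sub>F n in sequentially. real (\<kappa> n) \<le> R / 4 * real n"
    using landau_o.smallD[OF \<kappa>, of "R / 4"] R by simp
  have e2: "\<forall>\<^sub>F n in sequentially. \<epsilon> n < 1 / 8"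
    using order_tendstoD(2)[OF lim(1), of "1 / 8"] by simp
  have e3: "\<forall>\<^sub>F n in sequentially. \<delta> n < 1 / 16"
    using order_tendstoD(2)[OF lim(2), of "1 / 16"] by simp
  have e4: "\<forall>\<^sub>F n in sequentially. 8 < R / 2 * real n"
  proof -
    have "filterlim (\<lambda>n. R / 2 * real n) at_top sequentially"
      using R by (intro filterlim_tendsto_pos_mult_at_top[OF tendsto_const]) (auto intro: filterlim_real_sequentially)
    then show ?thesis unfolding filterlim_at_top_dense by blast
  qed
  have "\<forall>\<^sub>F n in sequentially. False"
    using ev e1 e2 e3 e4
  proof eventually_elim
    case (elim n)
    then obtain N \<rho> D where N: "real N \<ge> 2 powr (real n * R)"
      and code: "is_code a d d V n (\<epsilon> n) (\<kappa> n) N \<rho> D"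
      and priv: "private_states (d ^ n) N (\<lambda>m. eve_state a d d V n (\<kappa> n) (\<rho> m)) (\<delta> n)" by blast
    define K where "K = (2::nat) ^ \<kappa> n"
    define \<sigma> where "\<sigma> = (\<lambda>m. assisted_channel a d d V n (\<kappa> n) (\<rho> m))"
    have N0: "real N > 0" by (rule less_le_trans[OF _ N]) simp
    obtain \<omega>0 where \<omega>0: "density_operator (d ^ n) \<omega>0"
      and p: "1 / real N * (\<Sum>m<N. trace_norm (trace_fst K (d ^ n) (\<sigma> m) - \<omega>0)) \<le> \<delta> n"
      using priv unfolding private_states_def eve_state_sym2[OF V] \<sigma>_def K_def by blast
    have "3 / 4 - \<epsilon> n \<le> 2 * \<delta> n + 16 * (real K)\<^sup>2 / real N"
    proof (rule private_code_bound[where \<sigma> = \<sigma> and D = D])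
      show "N \<ge> 1" "K \<ge> 1" using N0 by (auto simp: K_def)
      show "density_operator (K * d ^ n) (\<sigma> m)" if "m < N" for m
        unfolding K_def \<sigma>_def using density_operator_assisted_channel[OF iso] code that
        by (simp add: is_code_def)
      show "povm (K * d ^ n) N D" using code by (simp add: is_code_def K_def)
      show "1 / real N * (\<Sum>m<N. Re (mat_trace (\<sigma> m * (1\<^sub>m (K * d ^ n) - D m)))) \<le> \<epsilon> n"
        using code by (simp add: is_code_def K_def \<sigma>_def)
    qed (rule \<omega>0, rule p)
    moreover have "16 * (real K)\<^sup>2 / real N \<le> 1 / 16"
    proof -
      have "(real K)\<^sup>2 = 2 powr (2 * real (\<kappa> n))"
        by (simp add: K_def powr_realpow[symmetric] powr_powr mult.commute flip: powr_numeral)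
      also have "\<dots> \<le> 2 powr (R / 2 * real n)" using elim(2) by (intro powr_mono) auto
      finally have "16 * (real K)\<^sup>2 \<le> 16 * 2 powr (R / 2 * real n)" by simp
      also have "16 * 2 powr (R / 2 * real n) = 2 powr (4 + R / 2 * real n)"
        by (simp add: powr_add)
      also have "\<dots> \<le> 2 powr (real n * R - 4)"
        using elim(5) by (intro powr_mono) (auto simp: algebra_simps)
      also have "\<dots> = 2 powr (real n * R) / 16" by (simp add: powr_diff)
      also have "\<dots> \<le> real N / 16" using N by simp
      finally show ?thesis using N0 by (simp add: field_simps)
    qed
    ultimately show False using elim(3,4) by simp
  qed
  then show False by simp
qed

section \<open>Codes with a single message\<close>

lemma orthonormal_identity: "orthonormal n (\<lambda>x r. if x = r then 1 else 0)"
proof (rule orthonormalI_rows)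
  fix x y assume "x < n" "y < n"
  have "(\<Sum>r<n. (if x = r then 1 else 0) * cnj (if y = r then 1 else (0 :: complex)))
    = (\<Sum>r<n. if x = r then (if y = x then 1 else 0) else 0)"
    by (intro sum.cong refl) auto
  then show "(\<Sum>r<n. (if x = r then 1 else 0) * cnj (if y = r then 1 else (0 :: complex))) = (if x = y then 1 else 0)"
    using \<open>x < n\<close> by simp
qed

lemma trace_norm_zero: "trace_norm (0\<^sub>m n n) = 0"
proof -
  have "0\<^sub>m n n = spectral n (\<lambda>_. 0) (\<lambda>x r. if x = r then 1 else 0)"
    by (intro eq_matI) (auto simp: spectral_def)
  then show ?thesis using trace_norm_spectral[OF orthonormal_identity] by simp
qed

lemma density_povm_probability:
  assumes \<omega>: "density_operator n \<omega>" and Q: "povm n J Q"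
  shows "\<And>j. j < J \<Longrightarrow> 0 \<le> Re (mat_trace (\<omega> * Q j)) \<and> Im (mat_trace (\<omega> * Q j)) = 0"
    and "(\<Sum>j<J. Re (mat_trace (\<omega> * Q j))) = 1"
proof -
  have psd\<omega>: "psd n \<omega>" and tr: "mat_trace \<omega> = 1" using \<omega> by (auto simp: density_operator_def)
  have \<omega>c: "\<omega> \<in> carrier_mat n n" using psd\<omega> by (simp add: psd_def)
  obtain w where w: "\<And>p q. p < n \<Longrightarrow> q < n \<Longrightarrow> \<omega> $$ (p, q) = (\<Sum>j<n. of_real 1 * w j p * cnj (w j q))"
    by (rule psd_gram[OF psd\<omega>]) blast
  have t: "mat_trace (\<omega> * Q j) = (\<Sum>i<n. qform n (\<lambda>r s. Q j $$ (r, s)) (w i))" if "j < J" for j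
  proof -
    have Qc: "Q j \<in> carrier_mat n n" using Q that by (auto simp: povm_def psd_def)
    have "mat_trace (\<omega> * Q j) = (\<Sum>i<n. of_real 1 * qform n (\<lambda>r s. Q j $$ (r, s)) (w i))"
      unfolding mat_trace_mult[OF \<omega>c Qc] using w by (rule trace_gram)
    then show ?thesis by simp
  qed
  show "0 \<le> Re (mat_trace (\<omega> * Q j)) \<and> Im (mat_trace (\<omega> * Q j)) = 0" if "j < J" for j
  proof -
    have "0 \<le> qform n (\<lambda>r s. Q j $$ (r, s)) v" for v
      using Q that unfolding povm_def psd_iff_qform by blast
    then have "0 \<le> Re (qform n (\<lambda>r s. Q j $$ (r, s)) v)" "Im (qform n (\<lambda>r s. Q j $$ (r, s)) v) = 0" for v
      by (auto simp: less_eq_complex_def)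
    then show ?thesis unfolding t[OF that] by (auto intro: sum_nonneg)
  qed
  have "(\<Sum>j<J. mat_trace (\<omega> * Q j)) = (\<Sum>j<J. \<Sum>i<n. qform n (\<lambda>r s. Q j $$ (r, s)) (w i))"
    by (intro sum.cong refl t) auto
  also have "\<dots> = (\<Sum>i<n. \<Sum>j<J. qform n (\<lambda>r s. Q j $$ (r, s)) (w i))" by (rule sum.swap)
  also have "\<dots> = (\<Sum>i<n. \<Sum>r<n. of_real ((cmod (w i r))\<^sup>2))"
    by (simp add: povm_qform_sum[OF Q])
  also have "\<dots> = (\<Sum>r<n. \<Sum>i<n. of_real 1 * w i r * cnj (w i r))"
    by (subst sum.swap) (simp add: complex_cmod_square)
  also have "\<dots> = mat_trace \<omega>"
    unfolding mat_trace_eq[OF \<omega>c] by (intro sum.cong refl w[symmetric]) auto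
  finally have "Re (\<Sum>j<J. mat_trace (\<omega> * Q j)) = 1" by (simp only: tr one_complex.sel)
  then show "(\<Sum>j<J. Re (mat_trace (\<omega> * Q j))) = 1" by simp
qed

lemma psd_one: "psd n (1\<^sub>m n)"
proof (rule psd_gramI[where J = "{..<n}" and c = "\<lambda>_. 1" and w = "\<lambda>x r. if x = r then 1 else 0"])
  fix r s assume "r < n" "s < n"
  have "(\<Sum>j<n. of_real 1 * (if j = r then 1 else 0) * cnj (if j = s then 1 else 0))
    = (\<Sum>j<n. if j = r then if r = s then 1 else 0 else (0 :: complex))"
    by (intro sum.cong refl) auto
  then show "1\<^sub>m n $$ (r, s) = (\<Sum>j<n. of_real 1 * (if j = r then 1 else 0) * cnj (if j = s then 1 else 0))"
    using \<open>r < n\<close> \<open>s < n\<close> by simp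
qed auto

text \<open>An input space of dimension 0 would make the range of \<open>V\<close> trivial, while
  the all-ones vector is symmetric.\<close>

lemma sym2_embedding_dim_pos:
  assumes "d \<ge> 1" "sym2_embedding d a V"
  shows "a \<ge> 1"
proof (rule ccontr)
  assume "\<not> a \<ge> 1"
  then have a: "a = 0" by simp
  have c: "V \<in> carrier_mat (d * d) a" using assms by (simp add: sym2_embedding_def isometry_def)
  have "vec (d * d) (\<lambda>_. 1) \<in> sym2 d"
    using index_less by (auto simp: sym2_def)
  then obtain x where x: "vec (d * d) (\<lambda>_. 1) = V *\<^sub>v x" "x \<in> carrier_vec a"
    using assms unfolding sym2_embedding_def by blast
  have "vec (d * d) (\<lambda>_. 1) $ 0 = (1 :: complex)" using assms by (intro index_vec) simp
  then have "(V *\<^sub>v x) $ 0 = 1" unfolding x(1) .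
  moreover have "(V *\<^sub>v x) $ 0 = 0"
    using mult_mat_vec_sum[OF c x(2), of 0] assms a by simp
  ultimately show False by simp
qed

text \<open>The supremum of an empty set of rates would be -\<infinity>. A code with one message has
  nothing to betray and makes no error, so both capacities are at least 0.\<close>

lemma achievable_rate_0:
  assumes d: "d \<ge> 1" and V: "sym2_embedding d a V"
    and secret: "\<And>k \<omega>. density_operator k (\<omega> 0) \<Longrightarrow> secret k 1 \<omega> 0"
  shows "achievable_rate secret a d d V 0"
  unfolding achievable_rate_def
proof (intro exI conjI)
  show "(\<lambda>n. real ((\<lambda>_. 0) n)) \<in> o(\<lambda>n. real n)" by simp
  show "(\<lambda>_. 0 :: real) \<longlonglongrightarrow> 0" "(\<lambda>_. 0 :: real) \<longlonglongrightarrow> 0" by simp_all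
  have iso: "isometry a (d * d) V" using V by (simp add: sym2_embedding_def)
  show "\<forall>\<^sub>F n in sequentially. \<exists>N \<rho> D. real N \<ge> 2 powr (real n * 0) \<and>
      is_code a d d V n 0 0 N \<rho> D \<and> secret (d ^ n) N (\<lambda>m. eve_state a d d V n 0 (\<rho> m)) 0"
  proof (intro always_eventually allI exI conjI)
    fix n
    define \<rho> where "\<rho> = matrix_unit (a ^ n) 0 0"
    have a0: "a ^ n > 0" using sym2_embedding_dim_pos[OF d V] by simp
    have tr: "mat_trace \<rho> = 1"
    proof -
      have "mat_trace \<rho> = (\<Sum>r<a ^ n. if r = 0 then 1 else 0)"
        unfolding \<rho>_def mat_trace_eq[OF matrix_unit_carrier] by (intro sum.cong refl) (simp add: matrix_unit_index)
      then show ?thesis using a0 by simp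
    qed
    have "psd (a ^ n) \<rho>"
      by (rule psd_gramI[where J = "{0::nat}" and c = "\<lambda>_. 1" and w = "\<lambda>_ r. if r = 0 then 1 else 0"])
        (auto simp: \<rho>_def matrix_unit_index)
    with tr have dens: "density_operator (2 ^ 0 * a ^ n) \<rho>" by (simp add: density_operator_def)
    note dens\<sigma> = density_operator_assisted_channel[OF iso dens]
    show "2 powr (real n * 0) \<le> real 1" by simp
    have povm1: "povm k 1 (\<lambda>_. 1\<^sub>m k)" for k
    proof -
      have "mat k k (\<lambda>rs. \<Sum>j<1::nat. 1\<^sub>m k $$ rs) = (1\<^sub>m k :: complex mat)"
        by (intro eq_matI) auto
      then show ?thesis by (simp add: povm_def psd_one)
    qed
    have zero: "mat_trace (M * (1\<^sub>m k - 1\<^sub>m k)) = 0" if "M \<in> carrier_mat k k" for M k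
    proof -
      have "1\<^sub>m k - 1\<^sub>m k = (0\<^sub>m k k :: complex mat)" by (intro eq_matI) auto
      then have "M * (1\<^sub>m k - 1\<^sub>m k) = M * 0\<^sub>m k k" by (rule arg_cong)
      also have "\<dots> = 0\<^sub>m k k" using that by (rule right_mult_zero_mat)
      finally show ?thesis by (simp add: mat_trace_def)
    qed
    show "is_code a d d V n 0 0 1 (\<lambda>_. \<rho>) (\<lambda>_. 1\<^sub>m (2 ^ 0 * d ^ n))"
      unfolding is_code_def using dens povm1 zero[OF assisted_channel_carrier[of a d d V n 0 \<rho>]] by simp
    have "density_operator (d ^ n) (eve_state a d d V n 0 \<rho>)"
    proof -
      define \<sigma> where "\<sigma> = assisted_channel a d d V n 0 \<rho>"
      have \<sigma>: "psd (2 ^ 0 * d ^ n) \<sigma>" "mat_trace \<sigma> = 1" using dens\<sigma> by (auto simp: density_operator_def \<sigma>_def)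
      have "trace_fst (2 ^ 0) (d ^ n) \<sigma> = \<sigma>"
        using \<sigma>(1) by (intro eq_matI) (auto simp: trace_fst_def psd_def)
      then show ?thesis using \<sigma> unfolding eve_state_sym2[OF V] \<sigma>_def[symmetric] by (simp add: density_operator_def)
    qed
    then show "secret (d ^ n) 1 (\<lambda>m. eve_state a d d V n 0 ((\<lambda>_. \<rho>) m)) 0"
      by (rule secret[of _ "\<lambda>m. eve_state a d d V n 0 ((\<lambda>_. \<rho>) m)"])
  qed
qed

lemma private_states_single: "density_operator k (\<omega> 0) \<Longrightarrow> private_states k 1 \<omega> 0"
proof -
  assume \<omega>: "density_operator k (\<omega> 0)"
  then have "\<omega> 0 - \<omega> 0 = 0\<^sub>m k k"
    by (intro eq_matI) (auto simp: density_operator_def psd_def)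
  then show ?thesis using \<omega> unfolding private_states_def by (intro exI[of _ "\<omega> 0"]) (simp add: trace_norm_zero)
qed

lemma weakly_locked_states_single: "density_operator k (\<omega> 0) \<Longrightarrow> weakly_locked_states k 1 \<omega> 0"
  unfolding weakly_locked_states_def
proof (intro allI impI)
  fix J Q assume \<omega>: "density_operator k (\<omega> 0)" and Q: "povm k J Q"
  note pr = density_povm_probability[OF \<omega> Q]
  have "mat_trace (\<omega> 0 * Q j) - of_real (Re (mat_trace (\<omega> 0 * Q j))) = 0" if "j < J" for j
    using pr(1)[OF that] by (simp add: complex_eq_iff)
  then show "\<exists>\<Omega> :: nat \<Rightarrow> real. (\<forall>j<J. 0 \<le> \<Omega> j) \<and> (\<Sum>j<J. \<Omega> j) = 1 \<and>
      1 / real 1 * (\<Sum>m<1. \<Sum>j<J. cmod (mat_trace (\<omega> m * Q j) - of_real (\<Omega> j))) \<le> 0"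
    using pr by (intro exI[of _ "\<lambda>j. Re (mat_trace (\<omega> 0 * Q j))"]) auto
qed

theorem private_capacity_sym2:
  assumes d: "d \<ge> 1" and V: "sym2_embedding d a V"
  shows "private_capacity a d d V = 0"
proof (rule antisym)
  show "private_capacity a d d V \<le> 0"
    unfolding private_capacity_def using achievable_private_rate_le_0[OF V]
    by (intro SUP_least) simp
  have "achievable_rate private_states a d d V 0"
    by (rule achievable_rate_0[OF d V]) (rule private_states_single)
  then have "ereal 0 \<le> private_capacity a d d V"
    unfolding private_capacity_def by (intro SUP_upper) simp
  then show "0 \<le> private_capacity a d d V" by (simp only: zero_ereal_def)
qed

section \<open>Locking codes\<close>

lemma sum_product4:
  fixes f g :: "nat \<Rightarrow> nat \<Rightarrow> 'a :: comm_semiring_0"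
  shows "(\<Sum>i\<in>A. \<Sum>i'\<in>A'. f i i') * (\<Sum>j\<in>B. \<Sum>j'\<in>B'. g j j') =
    (\<Sum>i\<in>A. \<Sum>i'\<in>A'. \<Sum>j\<in>B. \<Sum>j'\<in>B'. f i i' * g j j')"
  unfolding sum_distrib_right unfolding sum_distrib_left ..

text \<open>In operator terms: \<open>n\<close> uses of the channel take the rank-one operator of
  \<psi> to that of \<phi>.\<close>

definition sendable :: "nat \<Rightarrow> nat \<Rightarrow> complex mat \<Rightarrow> nat \<Rightarrow> (nat \<Rightarrow> complex) \<Rightarrow> (nat \<Rightarrow> complex) \<Rightarrow> bool" where
  "sendable a d V n \<psi> \<phi> \<longleftrightarrow> (\<forall>r<d ^ n. \<forall>s<d ^ n.
     (\<Sum>p<a ^ n. \<Sum>q<a ^ n. \<psi> p * cnj (\<psi> q) *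
       tensor_power_map a d (channel d d V) n (matrix_unit (a ^ n) p q) $$ (r, s)) = \<phi> r * cnj (\<phi> s))"

text \<open>The product of \<phi> with itself is symmetric, hence in the range of \<open>V\<close>;
  tracing out one factor of this product leaves the rank-one operator of \<phi>, because \<phi> has
  norm 1.\<close>

lemma double_vector_preimage:
  assumes V: "sym2_embedding d a V" and \<phi>: "(\<Sum>\<alpha><d. \<phi> \<alpha> * cnj (\<phi> \<alpha>)) = 1"
  obtains \<psi> where "\<And>r s. r < d \<Longrightarrow> s < d \<Longrightarrow>
    (\<Sum>i<a. \<Sum>i'<a. \<psi> i * cnj (\<psi> i') * channel d d V (matrix_unit a i i') $$ (r, s)) = \<phi> r * cnj (\<phi> s)"
proof -
  have c: "V \<in> carrier_mat (d * d) a" using V by (simp add: sym2_embedding_def isometry_def)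
  define u where "u = vec (d * d) (\<lambda>p. \<phi> (p div d) * \<phi> (p mod d))"
  have ui: "u $ (i * d + j) = \<phi> i * \<phi> j" if "i < d" "j < d" for i j
    using that index_less[OF that] by (simp add: u_def)
  have "u \<in> sym2 d"
    unfolding sym2_def using ui by (simp add: mult.commute) (simp add: u_def)
  then obtain x where x: "u = V *\<^sub>v x" "x \<in> carrier_vec a"
    using V unfolding sym2_embedding_def by blast
  have Vx: "(\<Sum>i<a. V $$ (r * d + \<alpha>, i) * x $ i) = \<phi> r * \<phi> \<alpha>" if "r < d" "\<alpha> < d" for r \<alpha>
    using mult_mat_vec_sum[OF c x(2) index_less[OF that]] ui[OF that] unfolding x(1) by simp
  show ?thesis
  proof (rule that)
    fix r s assume rs: "r < d" "s < d"
    have "(\<Sum>i<a. \<Sum>i'<a. x $ i * cnj (x $ i') * channel d d V (matrix_unit a i i') $$ (r, s))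
      = (\<Sum>i<a. \<Sum>i'<a. \<Sum>\<alpha><d. (V $$ (r * d + \<alpha>, i) * x $ i) * cnj (V $$ (s * d + \<alpha>, i') * x $ i'))"
    proof (intro sum.cong refl)
      fix i i' assume "i \<in> {..<a}" "i' \<in> {..<a}"
      then have ii: "i < a" "i' < a" by auto
      show "x $ i * cnj (x $ i') * channel d d V (matrix_unit a i i') $$ (r, s) =
          (\<Sum>\<alpha><d. (V $$ (r * d + \<alpha>, i) * x $ i) * cnj (V $$ (s * d + \<alpha>, i') * x $ i'))"
        unfolding channel_matrix_unit[OF c ii rs] sum_distrib_left
        by (intro sum.cong refl) (simp add: mult_ac)
    qed
    also have "\<dots> = (\<Sum>\<alpha><d. \<Sum>i<a. \<Sum>i'<a. (V $$ (r * d + \<alpha>, i) * x $ i) * cnj (V $$ (s * d + \<alpha>, i') * x $ i'))"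
      by (rule sum_swap3[symmetric])
    also have "\<dots> = (\<Sum>\<alpha><d. (\<Sum>i<a. V $$ (r * d + \<alpha>, i) * x $ i) * cnj (\<Sum>i'<a. V $$ (s * d + \<alpha>, i') * x $ i'))"
      unfolding cnj_sum sum_product ..
    also have "\<dots> = (\<Sum>\<alpha><d. \<phi> r * cnj (\<phi> s) * (\<phi> \<alpha> * cnj (\<phi> \<alpha>)))"
      using rs by (intro sum.cong refl) (simp add: Vx)
    also have "\<dots> = \<phi> r * cnj (\<phi> s)" unfolding sum_distrib_left[symmetric] \<phi> by simp
    finally show "(\<Sum>i<a. \<Sum>i'<a. x $ i * cnj (x $ i') * channel d d V (matrix_unit a i i') $$ (r, s)) = \<phi> r * cnj (\<phi> s)" .
  qed
qed

lemma sendable_product_basis: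
  assumes V: "sym2_embedding d a V" and x: "x < d ^ length \<beta>s"
  shows "\<exists>\<psi>. sendable a d V (length \<beta>s) \<psi> (product_basis d \<beta>s x)"
  using x
proof (induction \<beta>s arbitrary: x)
  case Nil
  show ?case by (intro exI[of _ "\<lambda>_. 1"]) (simp add: sendable_def matrix_unit_index)
next
  case (Cons \<beta> \<beta>s)
  define n where "n = length \<beta>s"
  define y where "y = x div d ^ n"
  define z where "z = x mod d ^ n"
  define \<phi> where "\<phi> = qudit_basis d \<beta> y"
  define \<phi>' where "\<phi>' = product_basis d \<beta>s z"
  have dn: "d ^ n > 0" using Cons.prems by (cases "d = 0") (auto simp: n_def)
  have yz: "y < d" "z < d ^ n" using Cons.prems dn by (auto simp: y_def z_def n_def less_mult_imp_div_less)
  have "(\<Sum>\<alpha><d. \<phi> \<alpha> * cnj (\<phi> \<alpha>)) = 1"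
    using orthonormal_rowsD[OF orthonormal_qudit_basis yz(1) yz(1)] by (simp add: \<phi>_def)
  then obtain \<psi> where \<psi>: "\<And>r s. r < d \<Longrightarrow> s < d \<Longrightarrow>
    (\<Sum>i<a. \<Sum>i'<a. \<psi> i * cnj (\<psi> i') * channel d d V (matrix_unit a i i') $$ (r, s)) = \<phi> r * cnj (\<phi> s)"
    by (rule double_vector_preimage[OF V]) blast
  obtain \<psi>' where \<psi>': "sendable a d V n \<psi>' \<phi>'" using Cons.IH yz by (auto simp: n_def \<phi>'_def)
  define \<psi>2 where "\<psi>2 = (\<lambda>p. \<psi> (p div a ^ n) * \<psi>' (p mod a ^ n))"
  have "sendable a d V (Suc n) \<psi>2 (product_basis d (\<beta> # \<beta>s) x)"
    unfolding sendable_def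
  proof (intro allI impI)
    fix r s assume rs: "r < d ^ Suc n" "s < d ^ Suc n"
    have rr: "r div d ^ n < d" "s div d ^ n < d" "r mod d ^ n < d ^ n" "s mod d ^ n < d ^ n"
      using rs dn by (auto simp: less_mult_imp_div_less)
    note re = div_mult_mod_eq[of r "d ^ n"] div_mult_mod_eq[of s "d ^ n"]
    define F where "F = (\<lambda>i i'. channel d d V (matrix_unit a i i') $$ (r div d ^ n, s div d ^ n))"
    define G where "G = (\<lambda>j j'. tensor_power_map a d (channel d d V) n (matrix_unit (a ^ n) j j') $$ (r mod d ^ n, s mod d ^ n))"
    have "(\<Sum>p<a ^ Suc n. \<Sum>q<a ^ Suc n. \<psi>2 p * cnj (\<psi>2 q) *
        tensor_power_map a d (channel d d V) (Suc n) (matrix_unit (a ^ Suc n) p q) $$ (r, s))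
      = (\<Sum>i<a. \<Sum>j<a ^ n. \<Sum>i'<a. \<Sum>j'<a ^ n. (\<psi> i * cnj (\<psi> i') * F i i') * (\<psi>' j * cnj (\<psi>' j') * G j j'))"
      unfolding power_Suc[of a] sum_mult_index
    proof (intro sum.cong refl)
      fix i j i' j' assume ij: "i \<in> {..<a}" "j \<in> {..<a ^ n}" "i' \<in> {..<a}" "j' \<in> {..<a ^ n}"
      then have lt: "i < a" "i' < a" "j < a ^ n" "j' < a ^ n" by auto
      have T: "tensor_power_map a d (channel d d V) (Suc n) (matrix_unit (a ^ Suc n) (i * a ^ n + j) (i' * a ^ n + j')) $$ (r, s)
        = F i i' * G j j'"
        unfolding F_def G_def
        by (rule tensor_power_map_unit[where a = a and b = d and n = n and \<Phi> = "channel d d V", OF _ lt rr, unfolded re]) simp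
      show "\<psi>2 (i * a ^ n + j) * cnj (\<psi>2 (i' * a ^ n + j')) *
          tensor_power_map a d (channel d d V) (Suc n) (matrix_unit (a * a ^ n) (i * a ^ n + j) (i' * a ^ n + j')) $$ (r, s) =
          (\<psi> i * cnj (\<psi> i') * F i i') * (\<psi>' j * cnj (\<psi>' j') * G j j')"
        unfolding T[unfolded power_Suc[of a]] using lt by (simp add: \<psi>2_def mult_ac)
    qed
    also have "\<dots> = (\<Sum>i<a. \<Sum>i'<a. \<Sum>j<a ^ n. \<Sum>j'<a ^ n. (\<psi> i * cnj (\<psi> i') * F i i') * (\<psi>' j * cnj (\<psi>' j') * G j j'))"
      by (rule sum.cong[OF refl], rule sum.swap)
    also have "\<dots> = (\<Sum>i<a. \<Sum>i'<a. \<psi> i * cnj (\<psi> i') * F i i') * (\<Sum>j<a ^ n. \<Sum>j'<a ^ n. \<psi>' j * cnj (\<psi>' j') * G j j')"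
      by (rule sum_product4[symmetric])
    also have "\<dots> = (\<phi> (r div d ^ n) * cnj (\<phi> (s div d ^ n))) * (\<phi>' (r mod d ^ n) * cnj (\<phi>' (s mod d ^ n)))"
    proof -
      have 1: "(\<Sum>i<a. \<Sum>i'<a. \<psi> i * cnj (\<psi> i') * F i i') = \<phi> (r div d ^ n) * cnj (\<phi> (s div d ^ n))"
        unfolding F_def by (rule \<psi>[OF rr(1,2)])
      have 2: "(\<Sum>j<a ^ n. \<Sum>j'<a ^ n. \<psi>' j * cnj (\<psi>' j') * G j j') = \<phi>' (r mod d ^ n) * cnj (\<phi>' (s mod d ^ n))"
        using \<psi>' rr(3,4) unfolding G_def sendable_def by blast
      show ?thesis unfolding 1 2 ..
    qed
    also have "\<dots> = product_basis d (\<beta> # \<beta>s) x r * cnj (product_basis d (\<beta> # \<beta>s) x s)"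
      by (simp add: \<phi>_def \<phi>'_def y_def z_def n_def mult_ac)
    finally show "(\<Sum>p<a ^ Suc n. \<Sum>q<a ^ Suc n. \<psi>2 p * cnj (\<psi>2 q) *
        tensor_power_map a d (channel d d V) (Suc n) (matrix_unit (a ^ Suc n) p q) $$ (r, s)) =
      product_basis d (\<beta> # \<beta>s) x r * cnj (product_basis d (\<beta> # \<beta>s) x s)" .
  qed
  then show ?case unfolding n_def length_Cons[of \<beta> \<beta>s, symmetric] by (intro exI[of _ \<psi>2]) assumption
qed

text \<open>Trace preservation, read off the Kraus operators, carries the norm of the output back to
  the input. It shows that preimages of basis vectors are unit vectors and so define states.\<close>

lemma sendable_norm:
  assumes V: "isometry a (d * d) V" and s: "sendable a d V n \<psi> \<phi>"
  shows "(\<Sum>p<a ^ n. \<psi> p * cnj (\<psi> p)) = (\<Sum>r<d ^ n. \<phi> r * cnj (\<phi> r))"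
proof -
  obtain T k where k: "kraus (a ^ n) (d ^ n) T k (tensor_power_map a d (channel d d V) n)"
    using kraus_tensor_power[OF channel_carrier kraus_channel[OF V], of n] by blast
  define G where "G = (\<lambda>p q r. tensor_power_map a d (channel d d V) n (matrix_unit (a ^ n) p q) $$ (r, r))"
  have G: "(\<Sum>r<d ^ n. G p q r) = (if p = q then 1 else 0)" if pq: "p < a ^ n" "q < a ^ n" for p q
  proof -
    have "(\<Sum>r<d ^ n. G p q r) = (\<Sum>r<d ^ n. \<Sum>\<alpha><T. k \<alpha> r p * cnj (k \<alpha> r q))"
      using k pq unfolding kraus_def G_def by (intro sum.cong refl) auto
    also have "\<dots> = (\<Sum>\<alpha><T. \<Sum>r<d ^ n. k \<alpha> r p * cnj (k \<alpha> r q))" by (rule sum.swap)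
    also have "\<dots> = (if p = q then 1 else 0)" using k pq unfolding kraus_def by simp
    finally show ?thesis .
  qed
  have "(\<Sum>r<d ^ n. \<phi> r * cnj (\<phi> r)) = (\<Sum>r<d ^ n. \<Sum>p<a ^ n. \<Sum>q<a ^ n. \<psi> p * cnj (\<psi> q) * G p q r)"
    using s unfolding sendable_def G_def by (intro sum.cong refl) auto
  also have "\<dots> = (\<Sum>p<a ^ n. \<Sum>q<a ^ n. \<psi> p * cnj (\<psi> q) * (\<Sum>r<d ^ n. G p q r))"
    unfolding sum_distrib_left by (rule sum_swap3)
  also have "\<dots> = (\<Sum>p<a ^ n. \<Sum>q<a ^ n. if q = p then \<psi> p * cnj (\<psi> q) else 0)"
    by (intro sum.cong refl) (simp add: G)
  finally show ?thesis by simp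
qed

text \<open>For i = (k, x) this is the basis vector number \<open>k\<close> of the auxiliary system
  tensored with the vector \<open>f k x\<close>; \<open>c\<close> is the dimension of the second
  factor.\<close>

definition keyed :: "nat \<Rightarrow> (nat \<Rightarrow> nat \<Rightarrow> nat \<Rightarrow> complex) \<Rightarrow> nat \<times> nat \<Rightarrow> nat \<Rightarrow> complex" where
  "keyed c f i p = (if p div c = fst i then f (fst i) (snd i) (p mod c) else 0)"

lemma keyed_index: "r < c \<Longrightarrow> keyed c f i (k * c + r) = (if k = fst i then f (fst i) (snd i) r else 0)"
  by (simp add: keyed_def)

lemma keyed_inner:
  assumes "fst i < K"
  shows "(\<Sum>p<K * c. keyed c f i p * cnj (keyed c g j p)) =
    (if fst i = fst j then \<Sum>r<c. f (fst i) (snd i) r * cnj (g (fst j) (snd j) r) else 0)"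
proof -
  have "(\<Sum>p<K * c. keyed c f i p * cnj (keyed c g j p)) =
    (\<Sum>k<K. if k = fst i then (\<Sum>r<c. if fst i = fst j then f (fst i) (snd i) r * cnj (g (fst j) (snd j) r) else 0) else 0)"
    unfolding sum_mult_index by (intro sum.cong refl) (auto simp: keyed_index intro!: sum.neutral sum.cong)
  then show ?thesis using assms by simp
qed

lemma keyed_complete:
  assumes \<phi>: "\<And>k. k < K \<Longrightarrow> orthonormal B (\<phi> k)" and pq: "p < K * B" "q < K * B"
  shows "(\<Sum>i\<in>{..<K} \<times> {..<B}. keyed B \<phi> i p * cnj (keyed B \<phi> i q)) = (if p = q then 1 else 0)"
proof -
  have B: "B > 0" using pq by (cases "B = 0") auto
  have pp: "p div B < K" "p mod B < B" "q mod B < B" using pq B by (auto simp: less_mult_imp_div_less)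
  have "(\<Sum>i\<in>{..<K} \<times> {..<B}. keyed B \<phi> i p * cnj (keyed B \<phi> i q))
    = (\<Sum>k<K. \<Sum>x<B. keyed B \<phi> (k, x) p * cnj (keyed B \<phi> (k, x) q))"
    by (simp add: sum.cartesian_product case_prod_beta)
  also have "\<dots> = (\<Sum>k<K. if k = p div B then if q div B = k then \<Sum>x<B. \<phi> k x (p mod B) * cnj (\<phi> k x (q mod B)) else 0 else 0)"
    by (intro sum.cong refl) (auto simp: keyed_def intro!: sum.neutral)
  also have "\<dots> = (if q div B = p div B then \<Sum>x<B. \<phi> (p div B) x (p mod B) * cnj (\<phi> (p div B) x (q mod B)) else 0)"
    using pp by simp
  also have "\<dots> = (if q div B = p div B \<and> p mod B = q mod B then 1 else 0)"
    unfolding orthonormal_colsD[OF \<phi>[OF pp(1)] pp(2,3)] by simp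
  also have "\<dots> = (if p = q then 1 else 0)"
  proof -
    have "p = q \<longleftrightarrow> q div B = p div B \<and> p mod B = q mod B" by (metis div_mult_mod_eq)
    then show ?thesis by simp
  qed
  finally show ?thesis .
qed

lemma coeff_sq_keyed:
  assumes \<phi>: "\<And>k. k < K \<Longrightarrow> orthonormal B (\<phi> k)" and i: "i \<in> {..<K} \<times> {..<B}" and j: "j \<in> {..<K} \<times> {..<B}"
  shows "coeff_sq (K * B) (keyed B \<phi>) (keyed B \<phi> i) j = (if j = i then 1 else 0)"
proof -
  have ij: "fst i < K" "snd i < B" "snd j < B" using i j by auto
  have "(\<Sum>p<K * B. cnj (keyed B \<phi> j p) * keyed B \<phi> i p) = (\<Sum>p<K * B. keyed B \<phi> i p * cnj (keyed B \<phi> j p))"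
    by (intro sum.cong refl mult.commute)
  also have "\<dots> = (if fst i = fst j then \<Sum>r<B. \<phi> (fst i) (snd i) r * cnj (\<phi> (fst j) (snd j) r) else 0)"
    using ij(1) by (rule keyed_inner)
  also have "\<dots> = (if fst i = fst j then \<Sum>r<B. \<phi> (fst i) (snd i) r * cnj (\<phi> (fst i) (snd j) r) else 0)"
    by simp
  also have "\<dots> = (if j = i then 1 else 0)"
    unfolding orthonormal_rowsD[OF \<phi>[OF ij(1)] ij(2,3)] by (auto simp: prod_eq_iff)
  finally show ?thesis by (simp add: coeff_sq_def)
qed

text \<open>Bob reads the key off the auxiliary system and then measures in the basis that it selects; Eve,
  who lacks the key, holds the mixture over all keys.\<close>
lemma locking_code:
  fixes \<beta>s :: "nat \<Rightarrow> bool list" and H :: "nat \<Rightarrow> nat \<Rightarrow> nat"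
  assumes V: "sym2_embedding d a V" and N: "N \<ge> 1"
    and \<beta>s: "\<And>k. k < 2 ^ \<kappa> \<Longrightarrow> length (\<beta>s k) = n"
    and H: "\<And>k x. k < 2 ^ \<kappa> \<Longrightarrow> x < d ^ n \<Longrightarrow> H k x < N"
    and surj: "\<And>m. m < N \<Longrightarrow> \<exists>k<2 ^ \<kappa>. \<exists>x<d ^ n. H k x = m"
    and unif: "\<And>w :: nat \<Rightarrow> complex. (\<Sum>m<N. \<bar>(\<Sum>k<2 ^ \<kappa>. \<Sum>x<d ^ n. if H k x = m
        then coeff_sq (d ^ n) (product_basis d (\<beta>s k)) w x else 0) / 2 ^ \<kappa> - (\<Sum>r<d ^ n. (cmod (w r))\<^sup>2) / real N\<bar>)
      \<le> \<eta> * (\<Sum>r<d ^ n. (cmod (w r))\<^sup>2)"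
  shows "\<exists>\<rho> D. is_code a d d V n 0 \<kappa> N \<rho> D \<and>
    weakly_locked_states (d ^ n) N (\<lambda>m. eve_state a d d V n \<kappa> (\<rho> m)) (2 * \<eta>)"
proof -
  define K where "K = (2::nat) ^ \<kappa>"
  define A where "A = a ^ n"
  define B where "B = d ^ n"
  have iso: "isometry a (d * d) V" using V by (simp add: sym2_embedding_def)
  define \<phi> where "\<phi> = (\<lambda>k. product_basis d (\<beta>s k))"
  have on: "orthonormal B (\<phi> k)" if "k < K" for k
    using orthonormal_product_basis[of d "\<beta>s k"] \<beta>s[of k] that by (simp add: \<phi>_def B_def K_def)
  have "\<forall>k x. \<exists>\<psi>. k < K \<longrightarrow> x < B \<longrightarrow> sendable a d V n \<psi> (\<phi> k x)"
    using sendable_product_basis[OF V] \<beta>s by (metis K_def B_def \<phi>_def)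
  then obtain \<psi> where \<psi>: "\<And>k x. k < K \<Longrightarrow> x < B \<Longrightarrow> sendable a d V n (\<psi> k x) (\<phi> k x)" by metis
  have \<psi>norm: "(\<Sum>p<A. \<psi> k x p * cnj (\<psi> k x p)) = 1" if "k < K" "x < B" for k x
    using sendable_norm[OF iso \<psi>[OF that]] orthonormal_rowsD[OF on[OF that(1)] that(2,2)]
    by (simp add: A_def B_def)
  \<comment> \<open>For a given message the pair of key and label is drawn uniformly from
    \<open>I m\<close>. Since the sets \<open>I m\<close> differ in size, a uniform message does not
    give a uniform pair; the discrepancy is accounted for by \<open>P\<close> below.\<close>
  define I where "I = (\<lambda>m. {i\<in>{..<K} \<times> {..<B}. H (fst i) (snd i) = m})"
  have I: "finite (I m)" "I m \<subseteq> {..<K} \<times> {..<B}" for m by (auto simp: I_def)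
  have Ipos: "card (I m) > 0" if m: "m < N" for m
  proof -
    obtain k x where "k < K" "x < B" "H k x = m" using surj[OF m] by (auto simp: K_def B_def)
    then have "(k, x) \<in> I m" by (auto simp: I_def)
    then show ?thesis using I(1) card_gt_0_iff by blast
  qed
  define z where "z = (\<lambda>m. 1 / real (card (I m)))"
  have z: "z m \<ge> 0" "m < N \<Longrightarrow> z m * real (card (I m)) = 1" for m
    using Ipos[of m] by (auto simp: z_def)
  define \<rho> where "\<rho> = (\<lambda>m. mat (K * A) (K * A) (\<lambda>(p, q). \<Sum>i\<in>I m. of_real (z m) * keyed A \<psi> i p * cnj (keyed A \<psi> i q)))"
  define D where "D = (\<lambda>m. mat (K * B) (K * B) (\<lambda>(p, q). \<Sum>i\<in>I m. of_real (1::real) * keyed B \<phi> i p * cnj (keyed B \<phi> i q)))"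
  define \<sigma> where "\<sigma> = (\<lambda>m. assisted_channel a d d V n \<kappa> (\<rho> m))"
  have dens: "density_operator (K * A) (\<rho> m)" if m: "m < N" for m
  proof -
    have "psd (K * A) (\<rho> m)"
      by (rule psd_gramI[where J = "I m" and c = "\<lambda>_. z m" and w = "keyed A \<psi>"]) (auto simp: \<rho>_def z)
    moreover have "mat_trace (\<rho> m) = 1"
    proof -
      have "mat_trace (\<rho> m) = (\<Sum>p<K * A. \<Sum>i\<in>I m. of_real (z m) * (keyed A \<psi> i p * cnj (keyed A \<psi> i p)))"
        by (simp add: \<rho>_def mat_trace_def mult.assoc)
      also have "\<dots> = (\<Sum>i\<in>I m. of_real (z m) * (\<Sum>p<K * A. keyed A \<psi> i p * cnj (keyed A \<psi> i p)))"
        unfolding sum_distrib_left by (rule sum.swap)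
      also have "\<dots> = (\<Sum>i\<in>I m. of_real (z m))"
      proof (rule sum.cong[OF refl])
        fix i assume "i \<in> I m"
        then have "fst i < K" "snd i < B" by (auto simp: I_def)
        then show "of_real (z m) * (\<Sum>p<K * A. keyed A \<psi> i p * cnj (keyed A \<psi> i p)) = of_real (z m)"
          using \<psi>norm by (simp add: keyed_inner)
      qed
      also have "\<dots> = of_real (z m * real (card (I m)))" by simp
      finally show ?thesis by (simp only: z(2)[OF m] of_real_1)
    qed
    ultimately show ?thesis by (simp add: density_operator_def)
  qed
  have dens\<sigma>: "density_operator (K * B) (\<sigma> m)" if "m < N" for m
    using density_operator_assisted_channel[OF iso, of \<kappa> n "\<rho> m"] dens[OF that]
    by (simp add: K_def A_def B_def \<sigma>_def)
  have \<sigma>i: "\<sigma> m $$ (x * B + r, x' * B + s) = (\<Sum>i\<in>I m. of_real (z m) * keyed B \<phi> i (x * B + r) * cnj (keyed B \<phi> i (x' * B + s)))"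
    if xr: "x < K" "x' < K" "r < B" "s < B" for m x x' r s
  proof -
    define G where "G = (\<lambda>j j'. tensor_power_map a d (channel d d V) n (matrix_unit A j j') $$ (r, s))"
    have "\<sigma> m $$ (x * B + r, x' * B + s) = (\<Sum>j<A. \<Sum>j'<A. \<rho> m $$ (x * A + j, x' * A + j') * G j j')"
      unfolding \<sigma>_def A_def B_def G_def by (rule assisted_channel_index) (use xr in \<open>auto simp: K_def B_def\<close>)
    also have "\<dots> = (\<Sum>j<A. \<Sum>j'<A. \<Sum>i\<in>I m. of_real (z m) * ((if x = fst i \<and> x' = fst i then 1 else 0) *
        (\<psi> (fst i) (snd i) j * cnj (\<psi> (fst i) (snd i) j') * G j j')))"
      using xr by (intro sum.cong refl)
        (auto simp: \<rho>_def index_less keyed_index sum_distrib_right mult.assoc intro!: sum.cong)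
    also have "\<dots> = (\<Sum>i\<in>I m. \<Sum>j<A. \<Sum>j'<A. of_real (z m) * ((if x = fst i \<and> x' = fst i then 1 else 0) *
        (\<psi> (fst i) (snd i) j * cnj (\<psi> (fst i) (snd i) j') * G j j')))"
      by (rule sum_swap3[symmetric])
    also have "\<dots> = (\<Sum>i\<in>I m. of_real (z m) * ((if x = fst i \<and> x' = fst i then 1 else 0) *
        (\<Sum>j<A. \<Sum>j'<A. \<psi> (fst i) (snd i) j * cnj (\<psi> (fst i) (snd i) j') * G j j')))"
      by (simp only: sum_distrib_left)
    also have "\<dots> = (\<Sum>i\<in>I m. of_real (z m) * keyed B \<phi> i (x * B + r) * cnj (keyed B \<phi> i (x' * B + s)))"
    proof (rule sum.cong[OF refl])
      fix i assume "i \<in> I m"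
      then have "fst i < K" "snd i < B" by (auto simp: I_def)
      then have "(\<Sum>j<A. \<Sum>j'<A. \<psi> (fst i) (snd i) j * cnj (\<psi> (fst i) (snd i) j') * G j j') =
          \<phi> (fst i) (snd i) r * cnj (\<phi> (fst i) (snd i) s)"
        using \<psi> xr unfolding sendable_def G_def A_def B_def by blast
      then show "of_real (z m) * ((if x = fst i \<and> x' = fst i then 1 else 0) *
        (\<Sum>j<A. \<Sum>j'<A. \<psi> (fst i) (snd i) j * cnj (\<psi> (fst i) (snd i) j') * G j j')) =
        of_real (z m) * keyed B \<phi> i (x * B + r) * cnj (keyed B \<phi> i (x' * B + s))"
        using xr by (simp add: keyed_index)
    qed
    finally show ?thesis .
  qed
  have \<sigma>pq: "\<sigma> m $$ (p, q) = (\<Sum>i\<in>I m. of_real (z m) * keyed B \<phi> i p * cnj (keyed B \<phi> i q))"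
    if "p < K * B" "q < K * B" for m p q
  proof -
    have "B > 0" using that by (cases "B = 0") auto
    then show ?thesis using \<sigma>i[of "p div B" "q div B" "p mod B" "q mod B" m] that
      by (simp add: less_mult_imp_div_less)
  qed
  have \<sigma>c: "\<sigma> m \<in> carrier_mat (K * B) (K * B)" and Dc: "D m \<in> carrier_mat (K * B) (K * B)" for m
    by (simp_all add: \<sigma>_def K_def B_def D_def)
  have groups: "(\<Sum>m<N. \<Sum>i\<in>I m. f i) = (\<Sum>i\<in>{..<K} \<times> {..<B}. f i)" for f :: "nat \<times> nat \<Rightarrow> 'c :: comm_monoid_add"
    unfolding I_def using H by (intro sum.group) (auto simp: K_def B_def)
  have povmD: "povm (K * B) N D"
    unfolding povm_def
  proof (intro conjI allI impI)
    show "psd (K * B) (D m)" for m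
      by (rule psd_gramI[where J = "I m" and c = "\<lambda>_. 1" and w = "keyed B \<phi>"]) (auto simp: D_def)
    show "mat (K * B) (K * B) (\<lambda>rs. \<Sum>m<N. D m $$ rs) = 1\<^sub>m (K * B)"
    proof (rule eq_matI)
      fix p q assume "p < dim_row (1\<^sub>m (K * B) :: complex mat)" "q < dim_col (1\<^sub>m (K * B) :: complex mat)"
      then have pq: "p < K * B" "q < K * B" by auto
      have "mat (K * B) (K * B) (\<lambda>rs. \<Sum>m<N. D m $$ rs) $$ (p, q) = (\<Sum>m<N. \<Sum>i\<in>I m. keyed B \<phi> i p * cnj (keyed B \<phi> i q))"
        using pq by (simp add: D_def)
      also have "\<dots> = (if p = q then 1 else 0)"
        unfolding groups by (rule keyed_complete[OF on pq])
      finally show "mat (K * B) (K * B) (\<lambda>rs. \<Sum>m<N. D m $$ rs) $$ (p, q) = 1\<^sub>m (K * B) $$ (p, q)"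
        using pq by simp
    qed auto
  qed
  have err: "mat_trace (\<sigma> m * (1\<^sub>m (K * B) - D m)) = 0" if m: "m < N" for m
  proof -
    have "\<sigma> m * (1\<^sub>m (K * B) - D m) = \<sigma> m - \<sigma> m * D m"
      by (subst mult_minus_distrib_mat[OF \<sigma>c one_carrier_mat Dc]) (simp only: right_mult_one_mat[OF \<sigma>c])
    then have "mat_trace (\<sigma> m * (1\<^sub>m (K * B) - D m)) = mat_trace (\<sigma> m) - mat_trace (\<sigma> m * D m)"
      using \<sigma>c[of m] Dc[of m] by (auto simp: mat_trace_def sum_subtractf)
    moreover have "mat_trace (\<sigma> m * D m) = 1"
    proof -
      have "mat_trace (\<sigma> m * D m) = (\<Sum>i\<in>I m. of_real (z m) * qform (K * B) (\<lambda>p q. D m $$ (p, q)) (keyed B \<phi> i))"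
        unfolding mat_trace_mult[OF \<sigma>c Dc] using \<sigma>pq by (rule trace_gram)
      also have "\<dots> = (\<Sum>i\<in>I m. of_real (z m))"
      proof (rule sum.cong[OF refl])
        fix i assume i: "i \<in> I m"
        have "qform (K * B) (\<lambda>p q. D m $$ (p, q)) (keyed B \<phi> i) = of_real (\<Sum>j\<in>I m. 1 * coeff_sq (K * B) (keyed B \<phi>) (keyed B \<phi> i) j)"
          by (rule qform_gram) (simp add: D_def)
        also have "(\<Sum>j\<in>I m. 1 * coeff_sq (K * B) (keyed B \<phi>) (keyed B \<phi> i) j) = (\<Sum>j\<in>I m. if j = i then 1 else 0)"
          unfolding mult_1 using i I(2) by (intro sum.cong refl coeff_sq_keyed[OF on]) blast+
        also have "\<dots> = 1" using i I(1) by simp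
        finally show "of_real (z m) * qform (K * B) (\<lambda>p q. D m $$ (p, q)) (keyed B \<phi> i) = of_real (z m)" by simp
      qed
      also have "\<dots> = of_real (z m * real (card (I m)))" by simp
      finally show ?thesis by (simp only: z(2)[OF m] of_real_1)
    qed
    ultimately show ?thesis using dens\<sigma>[OF m] by (simp add: density_operator_def)
  qed
  have code: "is_code a d d V n 0 \<kappa> N \<rho> D"
    unfolding is_code_def K_def[symmetric] A_def[symmetric] B_def[symmetric] \<sigma>_def[symmetric]
    using dens povmD err[unfolded \<sigma>_def] by (simp add: err)
  define \<omega> where "\<omega> = (\<lambda>m. eve_state a d d V n \<kappa> (\<rho> m))"
  have \<omega>eq: "\<omega> m = trace_fst K B (\<sigma> m)" for m
    unfolding \<omega>_def \<sigma>_def K_def B_def by (rule eve_state_sym2[OF V])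
  have \<omega>i: "\<omega> m $$ (r, s) = (\<Sum>i\<in>I m. of_real (z m) * \<phi> (fst i) (snd i) r * cnj (\<phi> (fst i) (snd i) s))"
    if rs: "r < B" "s < B" for m r s
  proof -
    have "\<omega> m $$ (r, s) = (\<Sum>x<K. \<Sum>i\<in>I m. if x = fst i then of_real (z m) * \<phi> (fst i) (snd i) r * cnj (\<phi> (fst i) (snd i) s) else 0)"
      unfolding \<omega>eq trace_fst_index[OF rs]
    proof (rule sum.cong[OF refl])
      fix x assume "x \<in> {..<K}"
      then show "\<sigma> m $$ (x * B + r, x * B + s) = (\<Sum>i\<in>I m. if x = fst i then of_real (z m) * \<phi> (fst i) (snd i) r * cnj (\<phi> (fst i) (snd i) s) else 0)"
        using rs by (simp add: \<sigma>i keyed_index) (intro sum.cong refl, auto)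
    qed
    also have "\<dots> = (\<Sum>i\<in>I m. \<Sum>x<K. if x = fst i then of_real (z m) * \<phi> (fst i) (snd i) r * cnj (\<phi> (fst i) (snd i) s) else 0)"
      by (rule sum.swap)
    also have "\<dots> = (\<Sum>i\<in>I m. of_real (z m) * \<phi> (fst i) (snd i) r * cnj (\<phi> (fst i) (snd i) s))"
      by (rule sum.cong[OF refl]) (auto simp: I_def)
    finally show ?thesis .
  qed
  define S where "S = (\<lambda>Q m. \<Sum>i\<in>I m. Re (qform B (\<lambda>r s. Q $$ (r, s)) (\<phi> (fst i) (snd i))))"
  \<comment> \<open>The hypothesis \<open>unif\<close> covers rank-one \<open>Q\<close>. A positive
    \<open>Q\<close> is a sum of such operators, and the bound passes to the sum by the triangle
    inequality because its right-hand side is additive.\<close>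
  have unifQ: "(\<Sum>m<N. \<bar>S Q m / real K - Re (mat_trace Q) / real N\<bar>) \<le> \<eta> * Re (mat_trace Q)"
    if Q: "psd B Q" for Q
  proof -
    have Qc: "Q \<in> carrier_mat B B" using Q by (simp add: psd_def)
    obtain w where w: "\<And>p q. p < B \<Longrightarrow> q < B \<Longrightarrow> Q $$ (p, q) = (\<Sum>g<B. of_real 1 * w g p * cnj (w g q))"
      by (rule psd_gram[OF Q]) blast
    define e where "e = (\<lambda>g. \<Sum>r<B. (cmod (w g r))\<^sup>2)"
    define c where "c = (\<lambda>g m. \<Sum>i\<in>I m. coeff_sq B (\<phi> (fst i)) (w g) (snd i))"
    have trQ: "Re (mat_trace Q) = (\<Sum>g<B. e g)"
    proof -
      have "mat_trace Q = (\<Sum>r<B. \<Sum>g<B. of_real ((cmod (w g r))\<^sup>2))"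
        unfolding mat_trace_eq[OF Qc] by (intro sum.cong refl) (simp add: w complex_cmod_square)
      also have "\<dots> = of_real (\<Sum>g<B. e g)"
        unfolding e_def of_real_sum by (rule sum.swap)
      finally show ?thesis by simp
    qed
    have Sc: "S Q m = (\<Sum>g<B. c g m)" for m
    proof -
      have "Re (qform B (\<lambda>r s. Q $$ (r, s)) (\<phi> k x)) = (\<Sum>g<B. coeff_sq B (\<phi> k) (w g) x)" for k x
      proof -
        have "qform B (\<lambda>r s. Q $$ (r, s)) (\<phi> k x) = of_real (\<Sum>g<B. 1 * coeff_sq B w (\<phi> k x) g)"
          using w by (rule qform_gram)
        also have "(\<Sum>g<B. 1 * coeff_sq B w (\<phi> k x) g) = (\<Sum>g<B. coeff_sq B (\<phi> k) (w g) x)"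
          by (intro sum.cong refl) (simp add: coeff_sq_swap[of B w "\<phi> k" x])
        finally show ?thesis by simp
      qed
      then show ?thesis unfolding S_def c_def by (simp only:) (rule sum.swap)
    qed
    have cg: "(\<Sum>m<N. \<bar>c g m / real K - e g / real N\<bar>) \<le> \<eta> * e g" for g
    proof -
      have rK: "real K = 2 ^ \<kappa>" by (simp add: K_def)
      have cc: "c g m = (\<Sum>k<K. \<Sum>x<B. if H k x = m then coeff_sq B (\<phi> k) (w g) x else 0)" for m
      proof -
        have "c g m = (\<Sum>i\<in>{..<K} \<times> {..<B}. if H (fst i) (snd i) = m then coeff_sq B (\<phi> (fst i)) (w g) (snd i) else 0)"
          unfolding c_def I_def by (rule sum.inter_filter) simp
        then show ?thesis by (simp add: sum.cartesian_product case_prod_beta)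
      qed
      show ?thesis unfolding cc rK e_def unfolding K_def B_def \<phi>_def by (rule unif)
    qed
    have "(\<Sum>m<N. \<bar>S Q m / real K - Re (mat_trace Q) / real N\<bar>) = (\<Sum>m<N. \<bar>\<Sum>g<B. c g m / real K - e g / real N\<bar>)"
      unfolding Sc trQ by (simp add: sum_subtractf sum_divide_distrib)
    also have "\<dots> \<le> (\<Sum>m<N. \<Sum>g<B. \<bar>c g m / real K - e g / real N\<bar>)"
      by (intro sum_mono sum_abs)
    also have "\<dots> = (\<Sum>g<B. \<Sum>m<N. \<bar>c g m / real K - e g / real N\<bar>)" by (rule sum.swap)
    also have "\<dots> \<le> (\<Sum>g<B. \<eta> * e g)" by (intro sum_mono cg)
    finally show ?thesis by (simp add: trQ sum_distrib_left)
  qed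
  have trS: "mat_trace (\<omega> m * Q) = of_real (z m * S Q m)" if Q: "psd B Q" for Q m
  proof -
    have Qc: "Q \<in> carrier_mat B B" using Q by (simp add: psd_def)
    have \<omega>c: "\<omega> m \<in> carrier_mat B B" by (simp add: \<omega>eq)
    have "mat_trace (\<omega> m * Q) = (\<Sum>i\<in>I m. of_real (z m) * qform B (\<lambda>r s. Q $$ (r, s)) (\<phi> (fst i) (snd i)))"
      unfolding mat_trace_mult[OF \<omega>c Qc]
      by (rule trace_gram[where w = "\<lambda>i. \<phi> (fst i) (snd i)" and c = "\<lambda>_. z m"]) (rule \<omega>i)
    moreover have "qform B (\<lambda>r s. Q $$ (r, s)) v = of_real (Re (qform B (\<lambda>r s. Q $$ (r, s)) v))" for v
    proof -
      have "0 \<le> qform B (\<lambda>r s. Q $$ (r, s)) v" using Q unfolding psd_iff_qform by blast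
      then show ?thesis by (simp add: less_eq_complex_def complex_eq_iff)
    qed
    ultimately have "mat_trace (\<omega> m * Q) = (\<Sum>i\<in>I m. of_real (z m) * of_real (Re (qform B (\<lambda>r s. Q $$ (r, s)) (\<phi> (fst i) (snd i)))))"
      by simp
    then show ?thesis by (simp add: S_def sum_distrib_left)
  qed
  have locked: "weakly_locked_states B N \<omega> (2 * \<eta>)"
    unfolding weakly_locked_states_def
  proof (intro allI impI)
    fix J Q assume Q: "povm B J Q"
    have "B > 0"
    proof -
      obtain k x where "x < B" using surj[of 0] N unfolding B_def by auto
      then show ?thesis by linarith
    qed
    then have B0: "real B > 0" by simp
    have K0: "real K > 0" and N0: "real N > 0" using N by (auto simp: K_def)
    have Qpsd: "psd B (Q j)" if "j < J" for j using Q that by (simp add: povm_def)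
    \<comment> \<open>The outcome distribution of the maximally mixed state. \<open>P m\<close> is
      the probability that a uniformly drawn key and label hash to \<open>m\<close>.\<close>
    define \<Omega> where "\<Omega> = (\<lambda>j. Re (mat_trace (Q j)) / real B)"
    define P where "P = (\<lambda>m. real (card (I m)) / (real K * real B))"
    have one: "psd B (1\<^sub>m B)" by (rule psd_one)
    have trone: "Re (mat_trace (1\<^sub>m B)) = real B" by (simp add: mat_trace_def)
    have Sone: "S (1\<^sub>m B) m = real (card (I m))" for m
    proof -
      have "Re (qform B (\<lambda>r s. 1\<^sub>m B $$ (r, s)) (\<phi> (fst i) (snd i))) = 1" if "i \<in> I m" for i
      proof -
        have i: "fst i < K" "snd i < B" using that by (auto simp: I_def)
        have "qform B (\<lambda>r s. 1\<^sub>m B $$ (r, s)) (\<phi> (fst i) (snd i)) =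
          (\<Sum>r<B. \<Sum>s<B. if s = r then \<phi> (fst i) (snd i) r * cnj (\<phi> (fst i) (snd i) r) else 0)"
          unfolding qform_def by (intro sum.cong refl) (auto simp: mult.commute)
        also have "\<dots> = (\<Sum>r<B. \<phi> (fst i) (snd i) r * cnj (\<phi> (fst i) (snd i) r))" by simp
        also have "\<dots> = 1" unfolding orthonormal_rowsD[OF on[OF i(1)] i(2,2)] by simp
        finally show ?thesis by simp
      qed
      then show ?thesis by (simp add: S_def)
    qed
    have sumtr: "(\<Sum>j<J. Re (mat_trace (Q j))) = real B"
    proof -
      have "(\<Sum>j<J. mat_trace (Q j)) = (\<Sum>j<J. \<Sum>r<B. Q j $$ (r, r))"
        using Qpsd by (intro sum.cong refl mat_trace_eq) (auto simp: psd_def)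
      also have "\<dots> = (\<Sum>r<B. \<Sum>j<J. Q j $$ (r, r))" by (rule sum.swap)
      also have "\<dots> = (\<Sum>r<B. mat B B (\<lambda>rs. \<Sum>j<J. Q j $$ rs) $$ (r, r))" by simp
      also have "\<dots> = of_nat B" using Q by (simp add: povm_def)
      finally have "Re (\<Sum>j<J. mat_trace (Q j)) = real B" by simp
      then show ?thesis by simp
    qed
    have trpos: "Re (mat_trace (Q j)) \<ge> 0" if j: "j < J" for j
    proof -
      obtain w where w: "\<And>p q. p < B \<Longrightarrow> q < B \<Longrightarrow> Q j $$ (p, q) = (\<Sum>g<B. of_real 1 * w g p * cnj (w g q))"
        by (rule psd_gram[OF Qpsd[OF j]]) blast
      have "mat_trace (Q j) = (\<Sum>r<B. \<Sum>g<B. of_real ((cmod (w g r))\<^sup>2))"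
        using Qpsd[OF j] by (subst mat_trace_eq[of _ B]) (auto simp: psd_def w complex_cmod_square intro!: sum.cong)
      then have "Re (mat_trace (Q j)) = (\<Sum>r<B. \<Sum>g<B. (cmod (w g r))\<^sup>2)" by simp
      then show ?thesis by (simp add: sum_nonneg)
    qed
    have dens\<omega>: "density_operator B (\<omega> m)" if m: "m < N" for m
    proof -
      have p: "psd (K * B) (\<sigma> m)" and t: "mat_trace (\<sigma> m) = 1" using dens\<sigma>[OF m] by (auto simp: density_operator_def)
      have "mat_trace (\<omega> m) = (\<Sum>r<B. \<Sum>x<K. \<sigma> m $$ (x * B + r, x * B + r))"
        unfolding \<omega>eq mat_trace_eq[OF trace_fst_carrier] by (intro sum.cong refl trace_fst_index) auto
      also have "\<dots> = mat_trace (\<sigma> m)"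
        unfolding mat_trace_eq[OF \<sigma>c] sum_mult_index by (rule sum.swap)
      finally show ?thesis using psd_trace_fst[OF p] t by (simp add: density_operator_def \<omega>eq)
    qed
    have zS: "0 \<le> z m * S (Q j) m" "(\<Sum>j<J. z m * S (Q j) m) = 1" if "m < N" "j < J" for m j
    proof -
      show "0 \<le> z m * S (Q j) m"
        using density_povm_probability(1)[OF dens\<omega>[OF that(1)] Q that(2)] trS[OF Qpsd[OF that(2)], of m] by simp
      have "(\<Sum>j<J. z m * S (Q j) m) = (\<Sum>j<J. Re (mat_trace (\<omega> m * Q j)))"
        using Qpsd by (intro sum.cong refl) (simp add: trS)
      then show "(\<Sum>j<J. z m * S (Q j) m) = 1"
        using density_povm_probability(2)[OF dens\<omega>[OF that(1)] Q] by simp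
    qed
    have Pz: "P m * (z m * s) = s / (real K * real B)" if "m < N" for m s
      using Ipos[OF that] by (simp add: P_def z_def)
    \<comment> \<open>The uniformity bound for Q = 1: every key and label then has weight 1, so that
      it counts the elements of \<open>I m\<close>.\<close>
    have Pdev: "(\<Sum>m<N. \<bar>P m - 1 / real N\<bar>) \<le> \<eta>"
    proof -
      have "(\<Sum>m<N. \<bar>P m - 1 / real N\<bar>) = (\<Sum>m<N. \<bar>S (1\<^sub>m B) m / real K - Re (mat_trace (1\<^sub>m B)) / real N\<bar> / real B)"
      proof (rule sum.cong[OF refl])
        fix m
        have "P m - 1 / real N = (real (card (I m)) / real K - real B / real N) / real B"
          using B0 K0 N0 by (simp add: P_def field_simps)
        then show "\<bar>P m - 1 / real N\<bar> = \<bar>S (1\<^sub>m B) m / real K - Re (mat_trace (1\<^sub>m B)) / real N\<bar> / real B"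
          using B0 unfolding Sone trone by (simp only: abs_divide abs_of_nonneg)
      qed
      also have "\<dots> \<le> \<eta> * real B / real B"
        unfolding sum_divide_distrib[symmetric] using unifQ[OF one] B0 unfolding trone
        by (intro divide_right_mono) auto
      finally show ?thesis using B0 by simp
    qed
    \<comment> \<open>First replace the prior 1 / N by \<open>P m\<close>, then compare the joint
      law of message and outcome, which is now linear in \<open>Q j\<close>, with the product law.
      Each replacement costs \<eta> in total, whence the bound 2 * \<eta>.\<close>
    have term1: "\<bar>1 / real N * (z m * S (Q j) m - \<Omega> j)\<bar> \<le>
        \<bar>P m - 1 / real N\<bar> * (z m * S (Q j) m) + \<bar>S (Q j) m / real K - Re (mat_trace (Q j)) / real N\<bar> / real B"
      if mj: "m < N" "j < J" for m j
    proof -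
      have "1 / real N * (z m * S (Q j) m - \<Omega> j) =
        (1 / real N - P m) * (z m * S (Q j) m) + (P m * (z m * S (Q j) m) - \<Omega> j / real N)"
        by (simp add: algebra_simps)
      also have "P m * (z m * S (Q j) m) - \<Omega> j / real N = (S (Q j) m / real K - Re (mat_trace (Q j)) / real N) / real B"
        unfolding Pz[OF mj(1)] \<Omega>_def using B0 K0 N0 by (simp add: field_simps)
      finally have "\<bar>1 / real N * (z m * S (Q j) m - \<Omega> j)\<bar> \<le>
        \<bar>(1 / real N - P m) * (z m * S (Q j) m)\<bar> + \<bar>(S (Q j) m / real K - Re (mat_trace (Q j)) / real N) / real B\<bar>"
        by (simp only: abs_triangle_ineq)
      also have "\<bar>(1 / real N - P m) * (z m * S (Q j) m)\<bar> = \<bar>P m - 1 / real N\<bar> * (z m * S (Q j) m)"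
        unfolding abs_mult[of "1 / real N - P m"] abs_minus_commute[of "1 / real N"] abs_of_nonneg[OF zS(1)[OF mj]] ..
      also have "\<bar>(S (Q j) m / real K - Re (mat_trace (Q j)) / real N) / real B\<bar> =
          \<bar>S (Q j) m / real K - Re (mat_trace (Q j)) / real N\<bar> / real B"
        using B0 by (simp only: abs_divide abs_of_nonneg)
      finally show ?thesis .
    qed
    have J: "J > 0" using sumtr B0 by (cases J) auto
    have "1 / real N * (\<Sum>m<N. \<Sum>j<J. cmod (mat_trace (\<omega> m * Q j) - of_real (\<Omega> j)))
      = (\<Sum>m<N. \<Sum>j<J. \<bar>1 / real N * (z m * S (Q j) m - \<Omega> j)\<bar>)"
      unfolding sum_distrib_left
    proof (intro sum.cong refl)
      fix m j assume "j \<in> {..<J}"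
      then have "mat_trace (\<omega> m * Q j) - of_real (\<Omega> j) = of_real (z m * S (Q j) m - \<Omega> j)"
        using trS[OF Qpsd] by simp
      then show "1 / real N * cmod (mat_trace (\<omega> m * Q j) - of_real (\<Omega> j)) = \<bar>1 / real N * (z m * S (Q j) m - \<Omega> j)\<bar>"
        by (simp only: norm_of_real abs_mult) simp
    qed
    also have "\<dots> \<le> (\<Sum>m<N. \<Sum>j<J. \<bar>P m - 1 / real N\<bar> * (z m * S (Q j) m) +
        \<bar>S (Q j) m / real K - Re (mat_trace (Q j)) / real N\<bar> / real B)"
      using term1 by (intro sum_mono) auto
    also have "\<dots> = (\<Sum>m<N. \<bar>P m - 1 / real N\<bar> * (\<Sum>j<J. z m * S (Q j) m)) +
        (\<Sum>j<J. (\<Sum>m<N. \<bar>S (Q j) m / real K - Re (mat_trace (Q j)) / real N\<bar>) / real B)"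
      unfolding sum.distrib sum_distrib_left sum_divide_distrib
      by (rule arg_cong2[where f = "(+)", OF refl sum.swap])
    also have "\<dots> \<le> \<eta> + (\<Sum>j<J. \<eta> * Re (mat_trace (Q j)) / real B)"
    proof (rule add_mono)
      have "(\<Sum>m<N. \<bar>P m - 1 / real N\<bar> * (\<Sum>j<J. z m * S (Q j) m)) = (\<Sum>m<N. \<bar>P m - 1 / real N\<bar>)"
        using zS(2)[OF _ J] by (intro sum.cong refl) simp
      then show "(\<Sum>m<N. \<bar>P m - 1 / real N\<bar> * (\<Sum>j<J. z m * S (Q j) m)) \<le> \<eta>" using Pdev by simp
      show "(\<Sum>j<J. (\<Sum>m<N. \<bar>S (Q j) m / real K - Re (mat_trace (Q j)) / real N\<bar>) / real B)
        \<le> (\<Sum>j<J. \<eta> * Re (mat_trace (Q j)) / real B)"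
        using unifQ Qpsd B0 by (intro sum_mono divide_right_mono) auto
    qed
    also have "(\<Sum>j<J. \<eta> * Re (mat_trace (Q j)) / real B) = \<eta>"
      unfolding sum_divide_distrib[symmetric] sum_distrib_left[symmetric] sumtr using B0 by simp
    finally have main: "1 / real N * (\<Sum>m<N. \<Sum>j<J. cmod (mat_trace (\<omega> m * Q j) - of_real (\<Omega> j))) \<le> 2 * \<eta>" by simp
    have "(\<forall>j<J. 0 \<le> \<Omega> j) \<and> (\<Sum>j<J. \<Omega> j) = 1"
      using trpos B0 sumtr unfolding \<Omega>_def by (simp add: sum_divide_distrib[symmetric])
    with main show "\<exists>\<Omega> :: nat \<Rightarrow> real. (\<forall>j<J. 0 \<le> \<Omega> j) \<and> (\<Sum>j<J. \<Omega> j) = 1 \<and>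
          1 / real N * (\<Sum>m<N. \<Sum>j<J. cmod (mat_trace (\<omega> m * Q j) - of_real (\<Omega> j))) \<le> 2 * \<eta>"
      by blast
  qed
  show ?thesis using code locked unfolding \<omega>_def B_def by blast
qed

section \<open>Choice of the parameters\<close>

lemma is_code_mono: "is_code a b e V n \<epsilon> \<kappa> N \<rho> D \<Longrightarrow> \<epsilon> \<le> \<epsilon>' \<Longrightarrow> is_code a b e V n \<epsilon>' \<kappa> N \<rho> D"
  unfolding is_code_def by (auto intro: order_trans)

lemma weakly_locked_states_mono:
  "weakly_locked_states k N \<omega> \<delta> \<Longrightarrow> \<delta> \<le> \<delta>' \<Longrightarrow> weakly_locked_states k N \<omega> \<delta>'"
  unfolding weakly_locked_states_def by (meson order_trans)

text \<open>The key is split as \<open>b * 2 ^ \<sigma> + s\<close>: the upper \<open>t\<close> bits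
  choose the bases of the blocks, the lower \<sigma> bits the seed. Of the factor 4, one 2 is the
  passage to the positive part in \<open>hashed_outcomes_near_uniform\<close>, the other the two
  replacements in \<open>locking_code\<close>; 2 * \<delta> is the seed bound of
  \<open>surjective_hash_exists\<close>.\<close>

lemma locking_code_parameters:
  assumes V: "sym2_embedding d a V" and d: "d \<ge> 1" and n: "n = t * l + r"
    and N: "N \<ge> 1" "N \<le> d ^ n"
    and \<delta>: "0 < \<delta>" "\<delta> \<le> 1" and S: "Suc S = 2 ^ \<sigma>"
    and S1: "2 * real (d ^ n) * exp (- (real S * \<delta>\<^sup>2 / 4)) < 1" and S2: "1 \<le> \<delta> * 2 ^ \<sigma>"
    and v: "0 < v" "v < 1" and \<tau>: "\<tau> > 0"
    and vq: "real (d ^ l) powr (- (\<tau> / real (m + 2))) = v"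
    and \<beta>: "\<And>M. M < N \<Longrightarrow>
      ((1 + v ^ m + real (d ^ l) powr (- (1 / (2 * real (m + 2))))) / 2) ^ t * real M powr \<tau> \<le> \<beta>"
  shows "\<exists>\<rho> D. is_code a d d V n 0 (t + \<sigma>) N \<rho> D \<and>
    weakly_locked_states (d ^ n) N (\<lambda>m. eve_state a d d V n (t + \<sigma>) (\<rho> m)) (4 * (2 * \<delta> + \<beta>))"
proof -
  have S2': "1 \<le> \<delta> * real (Suc S)" using S2 by (simp add: S)
  obtain h where h: "\<And>s x. s < Suc S \<Longrightarrow> x < d ^ n \<Longrightarrow> h s x < N" "\<And>m. m < N \<Longrightarrow> h 0 m = m"
    and sampler: "\<And>T. T \<subseteq> {..<N} \<Longrightarrow> card {x\<in>{..<d ^ n}. excess N (Suc S) h T x > 2 * \<delta> * real (Suc S)} < N"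
    by (rule surjective_hash_exists[OF \<delta> N S1 S2']) blast
  define \<beta>s where "\<beta>s = (\<lambda>k. key_bits l r t (k div 2 ^ \<sigma>))"
  define H where "H = (\<lambda>k. h (k mod 2 ^ \<sigma>))"
  have "\<exists>\<rho> D. is_code a d d V n 0 (t + \<sigma>) N \<rho> D \<and>
    weakly_locked_states (d ^ n) N (\<lambda>m. eve_state a d d V n (t + \<sigma>) (\<rho> m)) (2 * (2 * (2 * \<delta> + \<beta>)))"
  proof (rule locking_code[OF V N(1), where \<beta>s = \<beta>s and H = H])
    show "length (\<beta>s k) = n" for k by (simp add: \<beta>s_def n)
    show "H k x < N" if "x < d ^ n" for k x
      unfolding H_def by (rule h(1)[OF _ that]) (simp add: S)
    \<comment> \<open>Key 0 has seed 0, for which the label \<open>m\<close> hashes to the message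
      \<open>m\<close>.\<close>
    show "\<exists>k<2 ^ (t + \<sigma>). \<exists>x<d ^ n. H k x = m" if "m < N" for m
      using h(2)[OF that] that N by (intro exI[of _ 0] conjI exI[of _ m]) (auto simp: H_def)
    fix w :: "nat \<Rightarrow> complex"
    define E where "E = (\<Sum>r<d ^ n. (cmod (w r))\<^sup>2)"
    define P where "P = (\<lambda>b. coeff_sq (d ^ n) (product_basis d (key_bits l r t b)) w)"
    have E0: "E \<ge> 0" by (simp add: E_def sum_nonneg)
    have PE: "(\<Sum>x<d ^ n. P b x) = E" for b
      using parseval[OF orthonormal_product_basis[of d "key_bits l r t b"], of w] by (simp add: P_def E_def n)
    have "(\<Sum>m<N. \<bar>(\<Sum>b<2 ^ t. \<Sum>s<Suc S. \<Sum>x<d ^ n. if h s x = m then P b x else 0) / (real (2 ^ t) * real (Suc S)) - E / real N\<bar>)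
      \<le> 2 * (2 * \<delta> + \<beta>) * E"
    proof (rule hashed_outcomes_near_uniform[OF _ _ N(1) _ _ PE h(1) sampler])
      fix L assume L: "L \<subseteq> {..<d ^ n}" "card L < N"
      have "(\<Sum>b<2 ^ t. \<Sum>x\<in>L. P b x) \<le>
          (1 + v ^ m + real (d ^ l) powr (- (1 / (2 * real (m + 2))))) ^ t * real (card L) powr \<tau> * E"
        unfolding P_def E_def n using L(1) unfolding n
        by (intro basis_choice_uncertainty[OF d v \<tau> vq])
      also have "\<dots> = ((1 + v ^ m + real (d ^ l) powr (- (1 / (2 * real (m + 2))))) / 2) ^ t * real (card L) powr \<tau> * real (2 ^ t) * E"
        by (simp add: power_divide)
      also have "\<dots> \<le> \<beta> * real (2 ^ t) * E"
        using \<beta>[OF L(2)] E0 by (intro mult_right_mono) auto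
      finally show "(\<Sum>b<2 ^ t. \<Sum>x\<in>L. P b x) \<le> \<beta> * real (2 ^ t) * E" .
    qed (use \<delta> in \<open>auto simp: P_def\<close>)
    moreover have "(\<Sum>k<2 ^ (t + \<sigma>). \<Sum>x<d ^ n. if H k x = m
        then coeff_sq (d ^ n) (product_basis d (\<beta>s k)) w x else 0) / 2 ^ (t + \<sigma>)
      = (\<Sum>b<2 ^ t. \<Sum>s<Suc S. \<Sum>x<d ^ n. if h s x = m then P b x else 0) / (real (2 ^ t) * real (Suc S))" for m
    proof -
      have "(\<Sum>k<2 ^ (t + \<sigma>). \<Sum>x<d ^ n. if H k x = m then coeff_sq (d ^ n) (product_basis d (\<beta>s k)) w x else 0)
        = (\<Sum>b<2 ^ t. \<Sum>s<2 ^ \<sigma>. \<Sum>x<d ^ n. if h s x = m then P b x else 0)"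
        unfolding power_add[of 2] sum_mult_index
      proof (rule sum.cong[OF refl], rule sum.cong[OF refl])
        fix b s :: nat assume "s \<in> {..<2 ^ \<sigma>}"
        then have "H (b * 2 ^ \<sigma> + s) = h s" "\<beta>s (b * 2 ^ \<sigma> + s) = key_bits l r t b"
          by (simp_all add: H_def \<beta>s_def)
        then show "(\<Sum>x<d ^ n. if H (b * 2 ^ \<sigma> + s) x = m
            then coeff_sq (d ^ n) (product_basis d (\<beta>s (b * 2 ^ \<sigma> + s))) w x else 0)
          = (\<Sum>x<d ^ n. if h s x = m then P b x else 0)" by (simp only: P_def)
      qed
      then show ?thesis unfolding S by (simp add: power_add)
    qed
    ultimately show "(\<Sum>m<N. \<bar>(\<Sum>k<2 ^ (t + \<sigma>). \<Sum>x<d ^ n. if H k x = m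
        then coeff_sq (d ^ n) (product_basis d (\<beta>s k)) w x else 0) / 2 ^ (t + \<sigma>) - (\<Sum>r<d ^ n. (cmod (w r))\<^sup>2) / real N\<bar>)
      \<le> 2 * (2 * \<delta> + \<beta>) * (\<Sum>r<d ^ n. (cmod (w r))\<^sup>2)"
      by (simp only: E_def)
  qed
  then show ?thesis by simp
qed

text \<open>Both sides equal 2 at v = 1, and there the derivative of their difference is m - 2 *
  \<alpha> > 0, so the inequality is strict just to the left of 1.\<close>

lemma slack_base_exists:
  fixes \<alpha> :: real
  assumes "2 * \<alpha> < real m"
  obtains v where "0 < v" "v < 1" "1 + v ^ m < 2 * v powr \<alpha>"
proof -
  define f where "f = (\<lambda>v::real. 1 + v ^ m - 2 * v powr \<alpha>)"
  have "(f has_real_derivative (real m - 2 * \<alpha>)) (at 1)"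
    unfolding f_def by (auto intro!: derivative_eq_intros)
  then obtain \<epsilon> where \<epsilon>: "\<epsilon> > 0" "\<And>h. 0 < h \<Longrightarrow> h < \<epsilon> \<Longrightarrow> f (1 - h) < f 1"
    using DERIV_pos_inc_left[of f "real m - 2 * \<alpha>" 1] assms by auto
  define h where "h = min (\<epsilon> / 2) (1 / 2)"
  have h: "0 < h" "h < \<epsilon>" "h < 1" using \<epsilon>(1) by (auto simp: h_def)
  have "f (1 - h) < 0" using \<epsilon>(2)[OF h(1,2)] by (simp add: f_def)
  then show ?thesis using h by (intro that[of "1 - h"]) (auto simp: f_def)
qed

lemma diagonal_sequence:
  assumes "\<And>\<delta> :: real. \<delta> > 0 \<Longrightarrow> \<forall>\<^sub>F n in sequentially. P \<delta> n"
  obtains \<delta> :: "nat \<Rightarrow> real" where "\<delta> \<longlonglongrightarrow> 0" "\<forall>\<^sub>F n in sequentially. P (\<delta> n) n"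
proof -
  have "\<forall>j. \<exists>k. \<forall>n\<ge>k. P (inverse (real (Suc j))) n"
    using assms by (simp add: eventually_sequentially)
  then obtain k where k: "\<And>j n. n \<ge> k j \<Longrightarrow> P (inverse (real (Suc j))) n" by metis
  define A where "A = (\<lambda>n. {j. j \<le> n \<and> k j \<le> n})"
  define f where "f = (\<lambda>n. Max (A n))"
  have fin: "finite (A n)" for n by (simp add: A_def)
  have fA: "f n \<in> A n" if "k 0 \<le> n" for n
    unfolding f_def using that by (intro Max_in fin) (auto simp: A_def)
  have f_ge: "j \<le> f n" if "j \<le> n" "k j \<le> n" for j n
    unfolding f_def using that by (intro Max_ge fin) (simp add: A_def)
  have "filterlim f at_top sequentially"
    unfolding filterlim_at_top eventually_sequentially
  proof (intro allI)
    fix Z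
    show "\<exists>K. \<forall>n\<ge>K. Z \<le> f n"
      by (intro exI[of _ "max Z (k Z)"]) (auto intro: f_ge)
  qed
  then have "(\<lambda>n. inverse (real (Suc (f n)))) \<longlonglongrightarrow> 0"
    by (rule filterlim_compose[OF LIMSEQ_inverse_real_of_nat])
  moreover have "\<forall>\<^sub>F n in sequentially. P (inverse (real (Suc (f n)))) n"
    using eventually_ge_at_top[of "k 0"]
  proof eventually_elim
    case (elim n)
    then show ?case using fA[of n] k by (simp add: A_def)
  qed
  ultimately show ?thesis using that by blast
qed

lemma locking_codes_eventually:
  assumes V: "sym2_embedding d a V" and d: "d \<ge> 2"
    and R: "0 < R" "R < 1 / 2 * log 2 (real d)" and \<delta>: "\<delta> > 0"
  shows "\<forall>\<^sub>F n in sequentially. \<exists>\<kappa> N \<rho> D. real \<kappa> \<le> \<delta> * real n \<and> real N \<ge> 2 powr (real n * R) \<and>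
    is_code a d d V n \<delta> \<kappa> N \<rho> D \<and>
    weakly_locked_states (d ^ n) N (\<lambda>m. eve_state a d d V n \<kappa> (\<rho> m)) \<delta>"
proof -
  have d1: "d \<ge> 1" and lnd: "ln (real d) > 0" using d by auto
  define \<theta> where "\<theta> = R / log 2 (real d)"
  have \<theta>: "0 < \<theta>" "\<theta> < 1 / 2" using R lnd by (auto simp: \<theta>_def log_def field_simps)
  have R\<theta>: "R * ln 2 = \<theta> * ln (real d)" using lnd by (simp add: \<theta>_def log_def)
  \<comment> \<open>The room between \<theta> and \<theta>' absorbs the rounding in n = t * l + r,
    by which n / l exceeds \<open>t\<close> slightly.\<close>
  define \<theta>' where "\<theta>' = (\<theta> + 1 / 2) / 2"
  have \<theta>': "\<theta> < \<theta>'" "\<theta>' < 1 / 2" "0 < \<theta>'" using \<theta> by (auto simp: \<theta>'_def)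
  \<comment> \<open>This is the condition 2 * \<alpha> < m solved for \<open>m\<close>.\<close>
  obtain m :: nat where m: "2 * \<theta>' / (1 / 2 - \<theta>') < real m" using reals_Archimedean2 by blast
  define \<alpha> where "\<alpha> = real (m + 2) * \<theta>'"
  have "2 * \<alpha> < real m"
    using m \<theta>' by (simp add: \<alpha>_def pos_divide_less_eq algebra_simps)
  then obtain v where v: "0 < v" "v < 1" and vlt: "1 + v ^ m < 2 * v powr \<alpha>"
    by (rule slack_base_exists)
  \<comment> \<open>Half of the slack in \<open>vlt\<close> is given to \<eta>, which will dominate
    the error term of the uncertainty relation once the blocks are long. \<beta> is the resulting
    factor per block, still below 1.\<close>
  define g where "g = 2 * v powr \<alpha>"
  define \<eta> where "\<eta> = (g - (1 + v ^ m)) / 2"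
  define \<beta> where "\<beta> = (1 + v ^ m + \<eta>) / g"
  have g0: "g > 0" using v by (simp add: g_def)
  have \<eta>0: "\<eta> > 0" using vlt by (simp add: \<eta>_def g_def)
  have "g - (1 + v ^ m) = 2 * \<eta>" by (simp add: \<eta>_def)
  then have "1 + v ^ m + \<eta> < g" using \<eta>0 by linarith
  then have \<beta>1: "\<beta> < 1" using g0 by (simp add: \<beta>_def)
  have \<beta>0: "0 \<le> \<beta>" using v g0 \<eta>0 by (simp add: \<beta>_def)
  have "(\<lambda>t. \<beta> ^ t) \<longlonglongrightarrow> 0" using \<beta>0 \<beta>1 by (intro LIMSEQ_realpow_zero)
  then have "\<forall>\<^sub>F t in sequentially. \<beta> ^ t < \<delta> / 8" using \<delta> by (intro order_tendstoD(2)) auto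
  then obtain T where T: "\<And>t. t \<ge> T \<Longrightarrow> \<beta> ^ t < \<delta> / 8" by (auto simp: eventually_sequentially)
  \<comment> \<open>The number of blocks depends on \<delta> but not on \<open>n\<close>, so the
    block length grows with \<open>n\<close> and the basis part of the key stays constant.\<close>
  define t where "t = max T 1"
  have t: "\<beta> ^ t < \<delta> / 8" "t \<ge> 1" using T[of t] by (auto simp: t_def)
  define \<delta>0 where "\<delta>0 = min (\<delta> / 16) 1"
  have \<delta>0: "0 < \<delta>0" "\<delta>0 \<le> 1" "\<delta>0 \<le> \<delta> / 16" using \<delta> by (auto simp: \<delta>0_def)
  \<comment> \<open>Half of the permitted key goes to the seed; the constant \<open>t\<close>
    eventually fits into the other half. The number of seeds is then exponential in
    \<open>n\<close>, where the union bound asks only for a number linear in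
    \<open>n\<close>.\<close>
  define \<sigma> where "\<sigma> = (\<lambda>n::nat. nat \<lfloor>\<delta> / 2 * real n\<rfloor>)"
  have \<sigma>: "real (\<sigma> n) \<le> \<delta> / 2 * real n" "\<delta> / 2 * real n - 1 \<le> real (\<sigma> n)" for n
    using \<delta> unfolding \<sigma>_def by (simp_all add: of_nat_nat) linarith
  have pow\<sigma>: "2 powr (\<delta> / 2 * real n - 1) \<le> 2 ^ \<sigma> n" for n
  proof -
    have "2 powr (\<delta> / 2 * real n - 1) \<le> 2 powr real (\<sigma> n)" using \<sigma>(2) by (intro powr_mono) auto
    then show ?thesis by (simp add: powr_realpow)
  qed
  have divlim: "filterlim (\<lambda>n. n div t) at_top sequentially"
    unfolding filterlim_at_top eventually_sequentially
  proof (intro allI)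
    fix Z
    show "\<exists>k. \<forall>n\<ge>k. Z \<le> n div t"
    proof (intro exI allI impI)
      fix n assume "Z * t \<le> n"
      then have "Z * t div t \<le> n div t" by (rule div_le_mono)
      then show "Z \<le> n div t" using t(2) by simp
    qed
  qed
  have c1: "\<forall>\<^sub>F n in sequentially. real (d ^ (n div t)) powr (- (1 / (2 * real (m + 2)))) \<le> \<eta>"
  proof -
    have "(\<lambda>l. real (d ^ l) powr (- (1 / (2 * real (m + 2))))) \<longlonglongrightarrow> 0"
    proof (rule tendsto_neg_powr)
      have "filterlim (\<lambda>l. real d ^ l) at_top sequentially"
        using d by real_asymp
      then show "filterlim (\<lambda>l. real (d ^ l)) at_top sequentially" by simp
    qed simp
    then have "\<forall>\<^sub>F l in sequentially. real (d ^ l) powr (- (1 / (2 * real (m + 2)))) < \<eta>"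
      using \<eta>0 by (intro order_tendstoD(2)) auto
    then have "\<forall>\<^sub>F n in sequentially. real (d ^ (n div t)) powr (- (1 / (2 * real (m + 2)))) < \<eta>"
      using divlim by (rule eventually_compose_filterlim)
    then show ?thesis by (rule eventually_mono) simp
  qed
  have c2: "\<forall>\<^sub>F n in sequentially. n div t \<ge> 1 \<and> \<theta> * (1 + 1 / real (n div t)) \<le> \<theta>'"
  proof -
    have "(\<lambda>l. \<theta> * (1 + 1 / real l)) \<longlonglongrightarrow> \<theta> * (1 + 0)"
      by (intro tendsto_intros lim_1_over_n)
    then have "\<forall>\<^sub>F l in sequentially. \<theta> * (1 + 1 / real l) < \<theta>'"
      using \<theta>'(1) by (intro order_tendstoD(2)) auto
    then have "\<forall>\<^sub>F l in sequentially. l \<ge> 1 \<and> \<theta> * (1 + 1 / real l) \<le> \<theta>'"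
      using eventually_ge_at_top[of 1] by eventually_elim simp
    then show ?thesis using divlim by (rule eventually_compose_filterlim)
  qed
  have c3: "\<forall>\<^sub>F n in sequentially. ln 2 + real n * ln (real d) < (2 powr (\<delta> / 2 * real n - 1) - 1) * \<delta>0\<^sup>2 / 4"
    using \<delta> \<delta>0(1) lnd by real_asymp
  have c4: "\<forall>\<^sub>F n in sequentially. 1 \<le> \<delta>0 * 2 powr (\<delta> / 2 * real n - 1)"
    using \<delta> \<delta>0(1) by real_asymp
  have c5: "\<forall>\<^sub>F n in sequentially. real t \<le> \<delta> / 2 * real n"
    using \<delta> by real_asymp
  show ?thesis
    using c1 c2 c3 c4 c5 eventually_ge_at_top[of 1]
  proof eventually_elim
    case (elim n)
    define l where "l = n div t"
    define r where "r = n mod t"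
    define N where "N = nat \<lceil>2 powr (real n * R)\<rceil>"
    define S where "S = 2 ^ \<sigma> n - (1::nat)"
    have n: "n = t * l + r" by (simp add: l_def r_def)
    have l1: "l \<ge> 1" and \<theta>l: "\<theta> * (1 + 1 / real l) \<le> \<theta>'" using elim(2) by (auto simp: l_def)
    have SS: "Suc S = 2 ^ \<sigma> n" by (simp add: S_def)
    have Sreal: "real S = 2 ^ \<sigma> n - 1"
      using arg_cong[OF SS, of real] by simp
    have NR: "real N \<ge> 2 powr (real n * R)" unfolding N_def by linarith
    have N1: "N \<ge> 1"
    proof -
      have "0 < real N" by (rule less_le_trans[OF _ NR]) simp
      then show ?thesis by simp
    qed
    have ND: "N \<le> d ^ n"
    proof -
      have "2 powr (real n * R) = exp (real n * (R * ln 2))" by (simp add: powr_def mult.assoc)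
      also have "\<dots> \<le> exp (real n * ln (real d))"
        using R\<theta> \<theta> lnd by (simp add: mult_left_mono)
      also have "\<dots> = real (d ^ n)" using d by (simp add: exp_of_nat_mult)
      finally have "\<lceil>2 powr (real n * R)\<rceil> \<le> int (d ^ n)" by (simp add: ceiling_le_iff)
      then show ?thesis unfolding N_def by linarith
    qed
    have S1: "2 * real (d ^ n) * exp (- (real S * \<delta>0\<^sup>2 / 4)) < 1"
    proof -
      have "ln 2 + real n * ln (real d) < real S * \<delta>0\<^sup>2 / 4"
      proof -
        have "(2 powr (\<delta> / 2 * real n - 1) - 1) * \<delta>0\<^sup>2 / 4 \<le> real S * \<delta>0\<^sup>2 / 4"
          using pow\<sigma>[of n] unfolding Sreal by (intro divide_right_mono mult_right_mono) auto
        with elim(3) show ?thesis by linarith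
      qed
      then have "exp (ln 2 + real n * ln (real d)) < exp (real S * \<delta>0\<^sup>2 / 4)" by simp
      moreover have "exp (ln 2 + real n * ln (real d)) = 2 * real (d ^ n)"
        using d by (simp add: exp_add exp_of_nat_mult)
      ultimately show ?thesis by (simp add: exp_minus field_simps)
    qed
    have S2: "1 \<le> \<delta>0 * 2 ^ \<sigma> n"
      using elim(4) mult_left_mono[OF pow\<sigma>[of n], of \<delta>0] \<delta>0 by linarith
    \<comment> \<open>The solution of \<open>vq\<close>: \<tau> is inversely proportional to the
      block length, so that \<open>v\<close> can be fixed in advance.\<close>
    define \<tau> where "\<tau> = real (m + 2) * ln (1 / v) / (real l * ln (real d))"
    have lnv: "ln (1 / v) > 0" using v by (simp add: ln_div)
    have \<tau>0: "\<tau> > 0" using lnv lnd l1 by (simp add: \<tau>_def)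
    have vq: "real (d ^ l) powr (- (\<tau> / real (m + 2))) = v"
    proof -
      have "real (d ^ l) powr (- (\<tau> / real (m + 2))) = exp (- (\<tau> / real (m + 2)) * (real l * ln (real d)))"
        using d by (simp add: powr_def ln_realpow)
      also have "- (\<tau> / real (m + 2)) * (real l * ln (real d)) = - ln (1 / v)"
        using l1 lnd by (simp add: \<tau>_def del: of_nat_add)
      finally show ?thesis using v by (simp add: ln_div)
    qed
    have \<beta>t: "((1 + v ^ m + real (d ^ l) powr (- (1 / (2 * real (m + 2))))) / 2) ^ t * real M powr \<tau> \<le> \<beta> ^ t"
      if M: "M < N" for M
    proof -
      have "real M \<le> 2 powr (real n * R)" using M unfolding N_def by linarith
      then have "real M powr \<tau> \<le> (2 powr (real n * R)) powr \<tau>" using \<tau>0 by (intro powr_mono2) auto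
      also have "\<dots> = exp (real n * R * \<tau> * ln 2)" by (simp add: powr_powr powr_def)
      \<comment> \<open>By the choice of \<tau>, a set of \<open>d powr (n * \<theta>)\<close>
        labels costs a factor (1 / v) powr ((m + 2) * \<theta> * n / l). As n / l is at most t * (1
        + 1 / l), this is at most (1 / v) powr \<alpha> for each of the \<open>t\<close>
        blocks.\<close>
      also have "\<dots> \<le> exp (real t * \<alpha> * ln (1 / v))"
      proof -
        have "r < t" using t(2) by (simp add: r_def)
        then have "real n \<le> real t * real l + real t" unfolding n by simp
        then have "real n / real l \<le> real t * (1 + 1 / real l)" using l1 by (simp add: field_simps)
        then have "\<theta> * (real n / real l) \<le> \<theta> * (real t * (1 + 1 / real l))"
          using \<theta> by (intro mult_left_mono) auto
        also have "\<dots> = real t * (\<theta> * (1 + 1 / real l))" by (simp only: mult.left_commute)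
        also have "\<dots> \<le> real t * \<theta>'" using \<theta>l by (intro mult_left_mono) auto
        finally have 1: "\<theta> * (real n / real l) \<le> real t * \<theta>'" .
        have "real n * R * \<tau> * ln 2 = real n * (R * ln 2) * \<tau>" by simp
        also have "\<dots> = \<theta> * (real n / real l) * (real (m + 2) * ln (1 / v))"
          unfolding R\<theta> \<tau>_def using lnd l1 by (simp add: field_simps del: of_nat_add)
        also have "\<dots> \<le> real t * \<theta>' * (real (m + 2) * ln (1 / v))"
          using 1 lnv by (intro mult_right_mono) auto
        also have "\<dots> = real t * \<alpha> * ln (1 / v)" by (simp add: \<alpha>_def)
        finally show ?thesis by simp
      qed
      also have "\<dots> = (1 / v powr \<alpha>) ^ t"
        using v by (simp add: powr_def ln_div exp_minus exp_of_nat_mult[symmetric] power_one_over inverse_eq_divide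
            power_divide[symmetric] mult.assoc)
      finally have M\<tau>: "real M powr \<tau> \<le> (1 / v powr \<alpha>) ^ t" .
      have "((1 + v ^ m + real (d ^ l) powr (- (1 / (2 * real (m + 2))))) / 2) ^ t \<le> ((1 + v ^ m + \<eta>) / 2) ^ t"
        using elim(1) v by (intro power_mono divide_right_mono add_left_mono) (auto simp: l_def add_nonneg_nonneg)
      then have "((1 + v ^ m + real (d ^ l) powr (- (1 / (2 * real (m + 2))))) / 2) ^ t * real M powr \<tau>
        \<le> ((1 + v ^ m + \<eta>) / 2) ^ t * (1 / v powr \<alpha>) ^ t"
        using M\<tau> v \<eta>0 by (intro mult_mono) auto
      also have "\<dots> = \<beta> ^ t" by (simp add: \<beta>_def g_def power_mult_distrib[symmetric])
      finally show ?thesis .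
    qed
    obtain \<rho> D where code: "is_code a d d V n 0 (t + \<sigma> n) N \<rho> D"
      and locked: "weakly_locked_states (d ^ n) N (\<lambda>m. eve_state a d d V n (t + \<sigma> n) (\<rho> m)) (4 * (2 * \<delta>0 + \<beta> ^ t))"
      using locking_code_parameters[OF V d1 n N1 ND \<delta>0(1,2) SS S1 S2 v \<tau>0 vq \<beta>t] by blast
    have "4 * (2 * \<delta>0 + \<beta> ^ t) \<le> \<delta>" using \<delta>0(3) t(1) by simp
    then have "weakly_locked_states (d ^ n) N (\<lambda>m. eve_state a d d V n (t + \<sigma> n) (\<rho> m)) \<delta>"
      by (rule weakly_locked_states_mono[OF locked])
    moreover have "is_code a d d V n \<delta> (t + \<sigma> n) N \<rho> D" using is_code_mono[OF code] \<delta> by simp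
    moreover have "real (t + \<sigma> n) \<le> \<delta> * real n" using elim(5) \<sigma>(1)[of n] by simp
    ultimately show ?case using NR by blast
  qed
qed

lemma achievable_locking_rate:
  assumes V: "sym2_embedding d a V" and d: "d \<ge> 2" and R: "0 < R" "R < 1 / 2 * log 2 (real d)"
  shows "achievable_rate weakly_locked_states a d d V R"
proof -
  define P where "P = (\<lambda>\<delta> n \<kappa>. \<exists>N \<rho> D. real N \<ge> 2 powr (real n * R) \<and>
    is_code a d d V n \<delta> \<kappa> N \<rho> D \<and>
    weakly_locked_states (d ^ n) N (\<lambda>m. eve_state a d d V n \<kappa> (\<rho> m)) \<delta>)"
  have "\<forall>\<^sub>F n in sequentially. \<exists>\<kappa>. real \<kappa> \<le> \<delta> * real n \<and> P \<delta> n \<kappa>" if "\<delta> > 0" for \<delta>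
    using locking_codes_eventually[OF V d R that] by (rule eventually_mono) (auto simp: P_def)
  then obtain \<delta> :: "nat \<Rightarrow> real" where \<delta>: "\<delta> \<longlonglongrightarrow> 0"
    and ev: "\<forall>\<^sub>F n in sequentially. \<exists>\<kappa>. real \<kappa> \<le> \<delta> n * real n \<and> P (\<delta> n) n \<kappa>"
    by (rule diagonal_sequence)
  \<comment> \<open>\<open>achievable_rate\<close> asks for one sequence \<kappa> on all
    \<open>n\<close>, whereas suitable values exist only for large \<open>n\<close>; elsewhere the
    choice is arbitrary.\<close>
  define \<kappa> where "\<kappa> = (\<lambda>n. SOME \<kappa>. real \<kappa> \<le> \<delta> n * real n \<and> P (\<delta> n) n \<kappa>)"
  have ev': "\<forall>\<^sub>F n in sequentially. real (\<kappa> n) \<le> \<delta> n * real n \<and> P (\<delta> n) n (\<kappa> n)"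
    using ev by (rule eventually_mono) (unfold \<kappa>_def, rule someI_ex)
  have "(\<lambda>n. real (\<kappa> n)) \<in> o(\<lambda>n. real n)"
  proof (rule landau_o.smallI)
    fix c :: real assume "c > 0"
    then have "\<forall>\<^sub>F n in sequentially. \<delta> n < c" using \<delta> by (intro order_tendstoD(2))
    with ev' show "\<forall>\<^sub>F n in sequentially. norm (real (\<kappa> n)) \<le> c * norm (real n)"
    proof eventually_elim
      case (elim n)
      then have "real (\<kappa> n) \<le> \<delta> n * real n" "\<delta> n * real n \<le> c * real n" by (auto intro: mult_right_mono)
      then show ?case by simp
    qed
  qed
  moreover have "\<forall>\<^sub>F n in sequentially. P (\<delta> n) n (\<kappa> n)" using ev' by (rule eventually_mono) simp
  ultimately show ?thesis
    unfolding achievable_rate_def P_def using \<delta> by blast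
qed

theorem theorem13:
  fixes d dA :: nat and V :: "complex mat"
  assumes "d \<ge> 1" and "sym2_embedding d dA V"
  shows "private_capacity dA d d V = 0 \<and>
    weak_locking_capacity dA d d V \<ge> ereal (1 / 2 * log 2 (real d))"
proof
  show "private_capacity dA d d V = 0" by (rule private_capacity_sym2[OF assms])
  have ach0: "achievable_rate weakly_locked_states dA d d V 0"
    by (rule achievable_rate_0[OF assms]) (rule weakly_locked_states_single)
  have upper: "ereal R \<le> weak_locking_capacity dA d d V" if "achievable_rate weakly_locked_states dA d d V R" for R
    unfolding weak_locking_capacity_def using that by (intro SUP_upper) simp
  show "ereal (1 / 2 * log 2 (real d)) \<le> weak_locking_capacity dA d d V"
  \<comment> \<open>For d = 1 the bound is 0, which rate 0 attains. For larger \<open>d\<close>, a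
    rate strictly between the capacity and the bound would be positive, since the capacity is at
    least 0, and hence achievable.\<close>
  proof (cases "d = 1")
    case True
    then show ?thesis using upper[OF ach0] by simp
  next
    case False
    then have d: "d \<ge> 2" using assms(1) by simp
    show ?thesis
    proof (rule ccontr)
      assume "\<not> ?thesis"
      then have "weak_locking_capacity dA d d V < ereal (1 / 2 * log 2 (real d))" by simp
      then obtain R where R: "weak_locking_capacity dA d d V < ereal R" "ereal R < ereal (1 / 2 * log 2 (real d))"
        using ereal_dense2 by blast
      have "ereal 0 < ereal R" using upper[OF ach0] R(1) by (rule le_less_trans)
      then have "achievable_rate weakly_locked_states dA d d V R"
        using R(2) by (intro achievable_locking_rate[OF assms(2) d]) auto
      then show False using upper R(1) by (simp add: leD)
    qed
  qed
qed

end
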